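(* Let $G$ be a simple $2$-connected claw-free cubic graph. Then $G$ is tightly two-face-embeddable if and only if $G\in\mathcal{F}$.
   Context: A cubic graph is $3$-regular; $G$ is claw-free if it has no induced subgraph isomorphic to $K_{1,3}$. For connected $H$, $\beta(H)=|E(H)|-|V(H)|+1$. A connected graph is upper-embeddable if it has a cellular embedding (all faces open discs) in a closed orientable surface with at most two faces; a cubic upper-embeddable graph with odd $\beta$ is two-face-embeddable. In an upper-embeddable cubic graph $G$, a pair $\{x,y\}$ of distinct vertices is removable if $x,y$ are joined by exactly one edge, $xy$ is not a bridge, and $G-\{x,y\}$ is (connected and) upper-embeddable. A two-face-embeddable cubic graph is tightly two-face-embeddable if it has no removable pair. Inflating a vertex $v$ of a cubic graph to a triangle: replace $v$ by a triangle $W_v$ and attach the three edges formerly incident with $v$ to distinct vertices of $W_v$. A diamond is $K_4$ minus an edge, its two $2$-valent vertices being its ends. Replacing an edge $uv$ with a string of $k\ge1$ diamonds: replace it by the alternating sequence $uu_1, D_1, v_1u_2, D_2,\dots, v_{k-1}u_k, D_k, v_kv$ where $D_i$ is a diamond with $2$-valent vertices $u_i,v_i$. The necklace $L_4$ is obtained from a $4$-cycle by replacing every second edge by a pair of parallel edges. The family $\mathcal{F}$: take $K\in\{K_4,L_4\}$, inflate each vertex to a triangle (vertex-triangles), then replace each edge not lying on a vertex-triangle by a string of diamonds of positive length (lengths may differ between edges); $\mathcal{F}$ consists of all graphs so obtained. *)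

theory Defs
  imports Main
begin

definition simple_graph :: "'a set \<Rightarrow> 'a set set \<Rightarrow> bool" where
  "simple_graph V E \<longleftrightarrow> finite V \<and> (\<forall>e\<in>E. \<exists>x y. x \<in> V \<and> y \<in> V \<and> x \<noteq> y \<and> e = {x, y})"

definition degree :: "'a set set \<Rightarrow> 'a \<Rightarrow> nat" where
  "degree E v = card {e \<in> E. v \<in> e}"

definition cubic :: "'a set \<Rightarrow> 'a set set \<Rightarrow> bool" where
  "cubic V E \<longleftrightarrow> (\<forall>v\<in>V. degree E v = 3)"

definition claw_free :: "'a set \<Rightarrow> 'a set set \<Rightarrow> bool" where
  "claw_free V E \<longleftrightarrow> \<not> (\<exists>v a b c. v \<in> V \<and> a \<in> V \<and> b \<in> V \<and> c \<in> V \<and>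
      a \<noteq> b \<and> a \<noteq> c \<and> b \<noteq> c \<and>
      {v, a} \<in> E \<and> {v, b} \<in> E \<and> {v, c} \<in> E \<and>
      {a, b} \<notin> E \<and> {a, c} \<notin> E \<and> {b, c} \<notin> E)"

definition adj :: "'a set set \<Rightarrow> 'a \<Rightarrow> 'a \<Rightarrow> bool" where
  "adj E x y \<longleftrightarrow> {x, y} \<in> E"

definition connected :: "'a set \<Rightarrow> 'a set set \<Rightarrow> bool" where
  "connected V E \<longleftrightarrow> V \<noteq> {} \<and> (\<forall>x\<in>V. \<forall>y\<in>V. (adj E)\<^sup>*\<^sup>* x y)"

definition del_verts_E :: "'a set set \<Rightarrow> 'a set \<Rightarrow> 'a set set" where
  "del_verts_E E S = {e \<in> E. e \<inter> S = {}}"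

definition two_connected :: "'a set \<Rightarrow> 'a set set \<Rightarrow> bool" where
  "two_connected V E \<longleftrightarrow> card V \<ge> 3 \<and> connected V E \<and>
     (\<forall>v\<in>V. connected (V - {v}) (del_verts_E E {v}))"

definition is_bridge :: "'a set \<Rightarrow> 'a set set \<Rightarrow> 'a set \<Rightarrow> bool" where
  "is_bridge V E e \<longleftrightarrow> e \<in> E \<and> connected V E \<and> \<not> connected V (E - {e})"

definition betti :: "'a set \<Rightarrow> 'a set set \<Rightarrow> int" where
  "betti V E = int (card E) - int (card V) + 1"

definition darts :: "'a set set \<Rightarrow> ('a \<times> 'a) set" where
  "darts E = {(u, v). {u, v} \<in> E}"

definition rotation_system :: "'a set \<Rightarrow> 'a set set \<Rightarrow> ('a \<times> 'a \<Rightarrow> 'a \<times> 'a) \<Rightarrow> bool" where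
  "rotation_system V E \<rho> \<longleftrightarrow> bij_betw \<rho> (darts E) (darts E) \<and>
     (\<forall>d\<in>darts E. fst (\<rho> d) = fst d) \<and>
     (\<forall>d\<in>darts E. \<forall>d'\<in>darts E. fst d = fst d' \<longrightarrow> (\<exists>n. (\<rho> ^^ n) d = d'))"

definition face_perm :: "('a \<times> 'a \<Rightarrow> 'a \<times> 'a) \<Rightarrow> 'a \<times> 'a \<Rightarrow> 'a \<times> 'a" where
  "face_perm \<rho> d = \<rho> (snd d, fst d)"

definition face_rel :: "'a set set \<Rightarrow> ('a \<times> 'a \<Rightarrow> 'a \<times> 'a) \<Rightarrow> (('a \<times> 'a) \<times> ('a \<times> 'a)) set" where
  "face_rel E \<rho> = {(d, d'). d \<in> darts E \<and> d' \<in> darts E \<and> (\<exists>n. (face_perm \<rho> ^^ n) d = d')}"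

text \<open>Number of faces of the cellular embedding given by the rotation system
  (the orbits of the face permutation); a graph without edges has one face.\<close>
definition num_faces :: "'a set set \<Rightarrow> ('a \<times> 'a \<Rightarrow> 'a \<times> 'a) \<Rightarrow> nat" where
  "num_faces E \<rho> = (if E = {} then 1 else card (darts E // face_rel E \<rho>))"

definition upper_embeddable :: "'a set \<Rightarrow> 'a set set \<Rightarrow> bool" where
  "upper_embeddable V E \<longleftrightarrow> connected V E \<and>
     (\<exists>\<rho>. rotation_system V E \<rho> \<and> num_faces E \<rho> \<le> 2)"

definition two_face_embeddable :: "'a set \<Rightarrow> 'a set set \<Rightarrow> bool" where
  "two_face_embeddable V E \<longleftrightarrow> cubic V E \<and> upper_embeddable V E \<and> odd (betti V E)"

definition removable_pair :: "'a set \<Rightarrow> 'a set set \<Rightarrow> 'a \<Rightarrow> 'a \<Rightarrow> bool" where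
  "removable_pair V E x y \<longleftrightarrow> x \<in> V \<and> y \<in> V \<and> x \<noteq> y \<and> {x, y} \<in> E \<and>
     \<not> is_bridge V E {x, y} \<and>
     connected (V - {x, y}) (del_verts_E E {x, y}) \<and>
     upper_embeddable (V - {x, y}) (del_verts_E E {x, y})"

definition tightly_two_face_embeddable :: "'a set \<Rightarrow> 'a set set \<Rightarrow> bool" where
  "tightly_two_face_embeddable V E \<longleftrightarrow> two_face_embeddable V E \<and>
     \<not> (\<exists>x y. removable_pair V E x y)"

text \<open>Base multigraphs on vertices 0..3, given as lists of 6 edges (index j < 6).\<close>
definition K4_base :: "nat \<Rightarrow> nat \<times> nat" where
  "K4_base j = [(0,1),(0,2),(0,3),(1,2),(1,3),(2,3)] ! j"

definition L4_base :: "nat \<Rightarrow> nat \<times> nat" where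
  "L4_base j = [(0,1),(0,1),(1,2),(2,3),(2,3),(3,0)] ! j"

text \<open>Vertices: Tri j s is the vertex of a vertex-triangle to which end s (0 or 1) of base
  edge j is attached; Dia j i l is local vertex l (0..3) of the i-th diamond on base edge j,
  with 0 and 3 its 2-valent ends.\<close>
datatype fvert = Tri nat nat | Dia nat nat nat

definition endpt :: "(nat \<Rightarrow> nat \<times> nat) \<Rightarrow> nat \<Rightarrow> nat \<Rightarrow> nat" where
  "endpt B j s = (if s = 0 then fst (B j) else snd (B j))"

definition FV :: "(nat \<Rightarrow> nat) \<Rightarrow> fvert set" where
  "FV k = {Tri j s | j s. j < 6 \<and> s < 2} \<union> {Dia j i l | j i l. j < 6 \<and> i < k j \<and> l < 4}"

definition FE :: "(nat \<Rightarrow> nat \<times> nat) \<Rightarrow> (nat \<Rightarrow> nat) \<Rightarrow> fvert set set" where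
  "FE B k =
     {{Tri j s, Tri j' s'} | j s j' s'. j < 6 \<and> s < 2 \<and> j' < 6 \<and> s' < 2 \<and> (j, s) \<noteq> (j', s') \<and>
                              endpt B j s = endpt B j' s'}
   \<union> {{Dia j i a, Dia j i b} | j i a b. j < 6 \<and> i < k j \<and>
                              (a, b) \<in> {(0,1),(0,2),(1,2),(1,3),(2,3)}}
   \<union> {{Tri j 0, Dia j 0 0} | j. j < 6}
   \<union> {{Dia j i 3, Dia j (Suc i) 0} | j i. j < 6 \<and> Suc i < k j}
   \<union> {{Dia j (k j - 1) 3, Tri j 1} | j. j < 6}"

definition graph_iso :: "'a set \<Rightarrow> 'a set set \<Rightarrow> 'b set \<Rightarrow> 'b set set \<Rightarrow> bool" where
  "graph_iso V E V' E' \<longleftrightarrow> (\<exists>f. bij_betw f V V' \<and>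
     (\<forall>x\<in>V. \<forall>y\<in>V. {x, y} \<in> E \<longleftrightarrow> {f x, f y} \<in> E'))"

definition in_family_F :: "'a set \<Rightarrow> 'a set set \<Rightarrow> bool" where
  "in_family_F V E \<longleftrightarrow> (\<exists>B \<in> {K4_base, L4_base}. \<exists>k. (\<forall>j<6. k j \<ge> 1) \<and>
     graph_iso V E (FV k) (FE B k))"

end

theory Submission
  imports Defs "HOL-Combinatorics.Transposition"
begin

text \<open>The key quantity is the number of orbits of the face permutation on darts. Deleting an edge
  multiplies this permutation by a transposition, which changes the number of orbits by exactly one.
  Hence, for every partition of the vertices of a graph embedded with \<open>f\<close> faces, the number of classes
  plus the number of classes of odd Betti number is at most \<open>f\<close> plus the number of edges between classes.

  A claw-free cubic graph that is 2-connected is \<open>K\<^sub>4\<close>, or a ring of diamonds, or consists of \<open>h\<close> triangles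
  and \<open>d\<close> diamonds joined by \<open>3h/2 + d\<close> edges. In the last case the inequality, applied with the triangles
  and diamonds as classes, gives \<open>2h + d \<le> 2 + 3h/2 + d\<close>, so \<open>h \<le> 4\<close>, and \<open>h = 4\<close> by parity. When no string of
  diamonds is empty, the inequality is violated after the deletion of any two adjacent vertices.

  Conversely, replacing an edge by a diamond preserves the number of faces for a suitable rotation at the
  new vertices. So a removable pair of \<open>K\<^sub>4\<close>, or of an inflated \<open>K\<^sub>4\<close> or \<open>L\<^sub>4\<close>, survives as long as the
  edge joining it is not replaced, and only finitely many embeddings have to be exhibited.\<close>

section \<open>Cycles of a permutation\<close>

text \<open>The induction replaces a diamond by an edge. 2-connectedness and claw-freeness are
  awkward to carry through that step; being bridgeless and having every vertex in a triangle do
  carry through, and bridgelessness also ensures that the new edge is not parallel to an old one.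
  What can go wrong is that the new edge lies in a triangle: then the smaller graph is K4, the
  larger one is a ring of two diamonds, and a removable pair is visible. Otherwise everything known
  of the smaller graph can be lifted. Two parities drive the counting. A cubic graph has odd Betti
  number iff 4 divides the number of vertices, here 3h + 4d, so 4 divides h. Deleting two adjacent
  vertices removes 2 vertices and 5 edges, and the number of faces is congruent to vertices plus
  edges modulo 2; so an embedding of the rest with at most two faces has exactly one. This is why
  the certificates for removable pairs have a single face, which also yields connectedness of the
  rest, and why a lower bound of two faces refutes removability.\<close>

definition orb_rel :: "'a set \<Rightarrow> ('a \<Rightarrow> 'a) \<Rightarrow> ('a \<times> 'a) set" where
  "orb_rel D \<pi> = {(x, y). x \<in> D \<and> y \<in> D \<and> (\<exists>n. (\<pi> ^^ n) x = y)}"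

definition ncyc :: "'a set \<Rightarrow> ('a \<Rightarrow> 'a) \<Rightarrow> nat" where
  "ncyc D \<pi> = card (D // orb_rel D \<pi>)"

text \<open>For an equivalence \<open>r\<close>, the relation in which the classes of
  \<open>a\<close> and \<open>b\<close> are merged into one.\<close>

definition join_rel :: "('a \<times> 'a) set \<Rightarrow> 'a \<Rightarrow> 'a \<Rightarrow> ('a \<times> 'a) set" where
  "join_rel r a b = r \<union> (r `` {a, b}) \<times> (r `` {a, b})"

lemma funpow_mem:
  assumes "\<And>x. x \<in> D \<Longrightarrow> \<pi> x \<in> D" "x \<in> D"
  shows "(\<pi> ^^ n) x \<in> D"
  using assms by (induction n) auto

lemma inj_on_funpow:
  assumes "inj_on \<pi> D" "\<And>x. x \<in> D \<Longrightarrow> \<pi> x \<in> D"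
  shows "inj_on (\<pi> ^^ n) D"
proof (induction n)
  case (Suc n)
  have "inj_on \<pi> ((\<pi> ^^ n) ` D)"
    using assms(1) by (rule inj_on_subset) (use funpow_mem[of D \<pi>] assms(2) in auto)
  then show ?case using comp_inj_on[OF Suc] by (simp add: comp_def)
qed simp

lemma funpow_return:
  assumes "bij_betw \<pi> D D" "finite D" "x \<in> D"
  shows "\<exists>n>0. (\<pi> ^^ n) x = x"
proof -
  have mem: "\<And>x. x \<in> D \<Longrightarrow> \<pi> x \<in> D" and inj: "inj_on \<pi> D"
    using assms(1) by (auto simp: bij_betw_def)
  have "range (\<lambda>n. (\<pi> ^^ n) x) \<subseteq> D"
    using funpow_mem[OF mem assms(3)] by auto
  then have "\<not> inj (\<lambda>n. (\<pi> ^^ n) x)"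
    using assms(2) finite_subset finite_imageD infinite_UNIV_nat by blast
  then obtain m n where mn: "m < n" "(\<pi> ^^ m) x = (\<pi> ^^ n) x"
    by (metis (mono_tags, lifting) injI linorder_neqE_nat)
  have "(\<pi> ^^ m) ((\<pi> ^^ (n - m)) x) = (\<pi> ^^ m) x"
    using mn by (simp flip: funpow_add comp_apply[of "\<pi> ^^ m" "\<pi> ^^ (n - m)"])
  then have "(\<pi> ^^ (n - m)) x = x"
    using inj_on_funpow[OF inj mem, of m] funpow_mem[OF mem assms(3)] assms(3)
    by (auto simp: inj_on_def)
  then show ?thesis using mn(1) by (intro exI[of _ "n - m"]) auto
qed

text \<open>Orbits are formed with nonnegative powers only, so symmetry is where finiteness enters:
  some positive power \<open>m\<close> returns \<open>x\<close> to itself, and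
  \<open>m * n - n\<close> further steps lead from \<open>y\<close> back to
  \<open>x\<close>.\<close>

lemma equiv_orb_rel:
  assumes "bij_betw \<pi> D D" "finite D"
  shows "equiv D (orb_rel D \<pi>)"
proof (rule equivI)
  show "orb_rel D \<pi> \<subseteq> D \<times> D" by (auto simp: orb_rel_def)
  show "refl_on D (orb_rel D \<pi>)"
    unfolding orb_rel_def refl_on_def by (auto intro: exI[of _ 0])
  show "sym (orb_rel D \<pi>)"
  proof (rule symI)
    fix x y assume "(x, y) \<in> orb_rel D \<pi>"
    then obtain n where n: "x \<in> D" "y \<in> D" "(\<pi> ^^ n) x = y"
      unfolding orb_rel_def by auto
    obtain m where m: "m > 0" "(\<pi> ^^ m) x = x"
      using funpow_return[OF assms n(1)] by auto
    have "(\<pi> ^^ (m * q)) x = x" for q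
      by (induction q) (auto simp: funpow_add m)
    then have "(\<pi> ^^ (m * n)) x = x" .
    moreover have "m * n = (m * n - n) + n" using m(1) by (cases m) auto
    ultimately have "(\<pi> ^^ (m * n - n)) y = x"
      using n(3) by (metis comp_apply funpow_add)
    then show "(y, x) \<in> orb_rel D \<pi>"
      using n unfolding orb_rel_def by auto
  qed
  show "trans (orb_rel D \<pi>)"
  proof (rule transI)
    fix x y z assume "(x, y) \<in> orb_rel D \<pi>" "(y, z) \<in> orb_rel D \<pi>"
    then obtain n m where "x \<in> D" "z \<in> D" "(\<pi> ^^ n) x = y" "(\<pi> ^^ m) y = z"
      unfolding orb_rel_def by auto
    then show "(x, z) \<in> orb_rel D \<pi>"
      unfolding orb_rel_def by (auto intro!: exI[of _ "m + n"] simp: funpow_add)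
  qed
qed

lemma equiv_join_rel:
  assumes "equiv D r" "a \<in> D" "b \<in> D"
  shows "equiv D (join_rel r a b)" "r \<subseteq> join_rel r a b" "(a, b) \<in> join_rel r a b"
proof -
  have s: "r \<subseteq> D \<times> D" "\<And>x. x \<in> D \<Longrightarrow> (x, x) \<in> r" "\<And>x y. (x, y) \<in> r \<Longrightarrow> (y, x) \<in> r"
    "\<And>x y z. (x, y) \<in> r \<Longrightarrow> (y, z) \<in> r \<Longrightarrow> (x, z) \<in> r"
    using assms(1) by (auto elim!: equivE simp: refl_on_def dest: symD transD)
  show "equiv D (join_rel r a b)"
  proof (rule equivI)
    show "join_rel r a b \<subseteq> D \<times> D" using s(1) by (auto simp: join_rel_def)
    show "refl_on D (join_rel r a b)" using s(2) by (auto simp: join_rel_def refl_on_def)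
    show "sym (join_rel r a b)" using s(3) by (auto simp: join_rel_def sym_def)
    define P where "P x \<longleftrightarrow> x \<in> r `` {a, b}" for x
    have P: "(x, y) \<in> r \<Longrightarrow> P x \<longleftrightarrow> P y" for x y
      unfolding P_def using s(3,4) by blast
    have "(x, y) \<in> join_rel r a b \<longleftrightarrow> (x, y) \<in> r \<or> P x \<and> P y" for x y
      unfolding join_rel_def P_def by blast
    then show "trans (join_rel r a b)"
      unfolding trans_def using s(4) P by metis
  qed
  show "r \<subseteq> join_rel r a b" by (auto simp: join_rel_def)
  show "(a, b) \<in> join_rel r a b" using s(2) assms by (auto simp: join_rel_def)
qed

lemma card_quotient_join_rel:
  assumes "equiv D r" "finite D" "a \<in> D" "b \<in> D"
  shows "card (D // r) = card (D // join_rel r a b) + (if (a, b) \<in> r then 0 else 1)"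
proof (cases "(a, b) \<in> r")
  case True
  have "r `` {a, b} = r `` {a}"
    using equiv_class_eq[OF assms(1) True] by auto
  then have "join_rel r a b = r"
    using assms(1) by (auto simp: join_rel_def elim!: equivE dest: symD transD)
  then show ?thesis using True by simp
next
  case False
  let ?J = "join_rel r a b" and ?A = "r `` {a}" and ?B = "r `` {b}"
  have s: "r \<subseteq> D \<times> D" "\<And>x. x \<in> D \<Longrightarrow> (x, x) \<in> r" "\<And>x y. (x, y) \<in> r \<Longrightarrow> (y, x) \<in> r"
    "\<And>x y z. (x, y) \<in> r \<Longrightarrow> (y, z) \<in> r \<Longrightarrow> (x, z) \<in> r"
    using assms(1) by (auto elim!: equivE simp: refl_on_def dest: symD transD)
  have J1: "?J `` {x} = ?A \<union> ?B" if "(a, x) \<in> r \<or> (b, x) \<in> r" for x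
    using that s(3,4) unfolding join_rel_def by blast
  have J2: "?J `` {x} = r `` {x}" if "\<not> ((a, x) \<in> r \<or> (b, x) \<in> r)" for x
    using that by (auto simp: join_rel_def)
  have ne: "?A \<noteq> ?B" using False s(2)[OF assms(4)] by auto
  have q: "r `` {x} = ?A \<longleftrightarrow> (a, x) \<in> r" "r `` {x} = ?B \<longleftrightarrow> (b, x) \<in> r" if "x \<in> D" for x
    using that assms(1,3,4) by (metis eq_equiv_class_iff equiv_class_eq_iff s(3))+
  have "D // ?J = (D // r - {?A, ?B}) \<union> {?A \<union> ?B}"
  proof (intro equalityI subsetI)
    fix X assume "X \<in> D // ?J"
    then obtain x where x: "x \<in> D" "X = ?J `` {x}" by (auto elim: quotientE)
    show "X \<in> (D // r - {?A, ?B}) \<union> {?A \<union> ?B}"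
    proof (cases "(a, x) \<in> r \<or> (b, x) \<in> r")
      case True then show ?thesis using J1 x by auto
    next
      case f: False
      then show ?thesis using J2[OF f] x q[OF x(1)] by (auto intro: quotientI)
    qed
  next
    fix X assume "X \<in> (D // r - {?A, ?B}) \<union> {?A \<union> ?B}"
    then consider "X \<in> D // r" "X \<noteq> ?A" "X \<noteq> ?B" | "X = ?A \<union> ?B" by auto
    then show "X \<in> D // ?J"
    proof cases
      case 1
      then obtain x where x: "x \<in> D" "X = r `` {x}" by (auto elim: quotientE)
      then have "?J `` {x} = X" using J2 q[OF x(1)] 1 by auto
      then show ?thesis using x(1) by (auto intro: quotientI)
    next
      case 2
      then have "?J `` {a} = X" using J1[of a] s(2)[OF assms(3)] by auto
      then show ?thesis using assms(3) by (auto intro: quotientI)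
    qed
  qed
  moreover have "?A \<union> ?B \<notin> D // r"
  proof
    assume "?A \<union> ?B \<in> D // r"
    then obtain x where x: "?A \<union> ?B = r `` {x}" by (auto elim: quotientE)
    then have "(x, a) \<in> r" "(x, b) \<in> r" using s(2) assms(3,4) by auto
    then show False using False s(3,4) by blast
  qed
  moreover have fin: "finite (D // r)"
    using assms(1,2) by (simp add: equiv_def finite_quotient)
  moreover have "?A \<in> D // r" "?B \<in> D // r" using assms(3,4) by (auto intro: quotientI)
  ultimately have "card (D // ?J) = card (D // r) - 2 + 1" "card (D // r) \<ge> 2"
    using ne card_mono[of "D // r" "{?A, ?B}"] by (auto simp: card_Diff_subset)
  then show ?thesis using False by auto
qed

lemma orb_rel_subset_equiv:
  assumes "equiv D r" "\<And>x. x \<in> D \<Longrightarrow> (x, \<pi> x) \<in> r"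
  shows "orb_rel D \<pi> \<subseteq> r"
proof -
  have s: "r \<subseteq> D \<times> D" "refl_on D r" "trans r" using assms(1) by (auto elim!: equivE)
  have "x \<in> D \<Longrightarrow> (x, (\<pi> ^^ n) x) \<in> r" for x n
  proof (induction n)
    case 0 then show ?case using s(2) by (auto simp: refl_on_def)
  next
    case (Suc n)
    then have "(x, (\<pi> ^^ n) x) \<in> r" by auto
    moreover from this have "((\<pi> ^^ n) x, \<pi> ((\<pi> ^^ n) x)) \<in> r" using s(1) assms(2) by auto
    ultimately show ?case using s(3) by (auto dest: transD)
  qed
  then show ?thesis by (auto simp: orb_rel_def)
qed

lemma bij_betw_comp_transpose:
  assumes "bij_betw \<pi> D D" "a \<in> D" "b \<in> D"
  shows "bij_betw (\<pi> \<circ> transpose a b) D D"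
proof -
  have "bij_betw (transpose a b) D D"
    by (rule bij_betw_byWitness[where f' = "transpose a b"]) (use assms in \<open>auto simp: transpose_def\<close>)
  then show ?thesis using assms(1) bij_betw_trans by blast
qed

text \<open>The two permutations differ only at \<open>a\<close> and \<open>b\<close>, where their
  values are exchanged; once \<open>a\<close> and \<open>b\<close> are identified, a step of one
  stays within a class of the other.\<close>

lemma join_orb_rel_transpose_subset:
  assumes "bij_betw \<pi> D D" "finite D" "a \<in> D" "b \<in> D"
  shows "join_rel (orb_rel D \<pi>) a b \<subseteq> join_rel (orb_rel D (\<pi> \<circ> transpose a b)) a b"
proof -
  let ?\<pi>' = "\<pi> \<circ> transpose a b"
  let ?J' = "join_rel (orb_rel D ?\<pi>') a b"
  have b': "bij_betw ?\<pi>' D D" using bij_betw_comp_transpose[OF assms(1,3,4)] .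
  note eq' = equiv_orb_rel[OF b' assms(2)]
  note J' = equiv_join_rel[OF eq' assms(3,4)]
  have sym: "sym ?J'" and tr: "trans ?J'" using J'(1) by (auto elim!: equivE)
  have step: "(x, ?\<pi>' x) \<in> ?J'" if "x \<in> D" for x
  proof -
    have "(x, ?\<pi>' x) \<in> orb_rel D ?\<pi>'"
      using that bij_betw_apply[OF b' that] unfolding orb_rel_def by (auto intro!: exI[of _ 1])
    then show ?thesis using J'(2) by auto
  qed
  have "(x, \<pi> x) \<in> ?J'" if "x \<in> D" for x
  proof -
    consider "x = a" | "x = b" | "x \<noteq> a" "x \<noteq> b" by auto
    then show ?thesis
    proof cases
      case 1
      then show ?thesis using J'(3) step[OF assms(4)] tr by (auto dest: transD)
    next
      case 2
      then show ?thesis using symD[OF sym J'(3)] step[OF assms(3)] tr by (auto dest: transD)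
    next
      case 3
      then show ?thesis using step[OF that] by (simp add: transpose_def)
    qed
  qed
  then have sub: "orb_rel D \<pi> \<subseteq> ?J'" using orb_rel_subset_equiv[OF J'(1)] by blast
  show ?thesis
  proof (rule subrelI)
    fix x y assume "(x, y) \<in> join_rel (orb_rel D \<pi>) a b"
    then show "(x, y) \<in> ?J'"
      unfolding join_rel_def[of "orb_rel D \<pi>"]
      using sub J'(3) sym tr by (auto dest: symD; meson subsetD symD transD)
  qed
qed

lemma join_orb_rel_transpose:
  assumes "bij_betw \<pi> D D" "finite D" "a \<in> D" "b \<in> D"
  shows "join_rel (orb_rel D (\<pi> \<circ> transpose a b)) a b = join_rel (orb_rel D \<pi>) a b"
proof -
  have "\<pi> \<circ> transpose a b \<circ> transpose a b = \<pi>" by (auto simp: fun_eq_iff)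
  then show ?thesis
    using join_orb_rel_transpose_subset[OF assms]
      join_orb_rel_transpose_subset[OF bij_betw_comp_transpose[OF assms(1,3,4)] assms(2-4)]
    by auto
qed

text \<open>Let \<open>n\<close> be least such that n steps of \<pi> lead from \<open>b\<close> to
  \<open>a\<close>. The arc of the cycle after \<open>b\<close> up to and including \<open>a\<close>
  is closed under the new permutation, which jumps from \<open>a\<close> back to the start of the
  arc; so the orbit of \<open>a\<close> never reaches \<open>b\<close>.\<close>

lemma orb_rel_comp_transpose_separates:
  assumes "bij_betw \<pi> D D" "finite D" "a \<in> D" "b \<in> D" "a \<noteq> b" "(a, b) \<in> orb_rel D \<pi>"
  shows "(a, b) \<notin> orb_rel D (\<pi> \<circ> transpose a b)"
proof
  let ?\<pi>' = "\<pi> \<circ> transpose a b"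
  assume "(a, b) \<in> orb_rel D ?\<pi>'"
  then obtain q where q: "(?\<pi>' ^^ q) a = b" by (auto simp: orb_rel_def)
  have "(b, a) \<in> orb_rel D \<pi>"
    using equiv_orb_rel[OF assms(1,2)] assms(6) by (auto elim!: equivE dest: symD)
  then have ex: "\<exists>n. (\<pi> ^^ n) b = a" by (auto simp: orb_rel_def)
  define n where "n = (LEAST n. (\<pi> ^^ n) b = a)"
  have n: "(\<pi> ^^ n) b = a" unfolding n_def using ex by (rule LeastI_ex)
  have min: "(\<pi> ^^ i) b \<noteq> a" if "i < n" for i
    using not_less_Least that unfolding n_def by blast
  have n0: "n > 0" using n assms(5) by (cases n) auto
  have nb: "(\<pi> ^^ i) b \<noteq> b" if "0 < i" "i \<le> n" for i
  proof
    assume "(\<pi> ^^ i) b = b"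
    then have "(\<pi> ^^ (n - i)) b = (\<pi> ^^ (n - i)) ((\<pi> ^^ i) b)" by simp
    also have "\<dots> = a" using that n by (simp flip: funpow_add comp_apply[of "\<pi> ^^ (n - i)" "\<pi> ^^ i"])
    finally show False using min[of "n - i"] that by auto
  qed
  let ?X = "(\<lambda>i. (\<pi> ^^ i) b) ` {1..n}"
  have aX: "a \<in> ?X" using n n0 by (auto intro!: image_eqI[of _ _ n])
  have "?\<pi>' x \<in> ?X" if "x \<in> ?X" for x
  proof -
    obtain i where "i \<in> {1..n}" and ix: "x = (\<pi> ^^ i) b" using \<open>x \<in> ?X\<close> by (rule imageE)
    then have i: "0 < i" "i \<le> n" "x = (\<pi> ^^ i) b" by auto
    show ?thesis
    proof (cases "i = n")
      case True
      then have "?\<pi>' x = (\<pi> ^^ 1) b" using i n by simp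
      then show ?thesis using n0 by (intro image_eqI[of _ _ 1]) auto
    next
      case False
      then have "x \<noteq> a" "x \<noteq> b" using i min nb by auto
      then have "?\<pi>' x = (\<pi> ^^ (Suc i)) b" using i by (simp add: transpose_def)
      then show ?thesis using False i by (intro image_eqI[of _ _ "Suc i"]) auto
    qed
  qed
  then have "(?\<pi>' ^^ q) a \<in> ?X" using funpow_mem[of ?X ?\<pi>'] aX by blast
  then obtain i where "i \<in> {1..n}" "b = (\<pi> ^^ i) b" unfolding q by (rule imageE)
  then show False using nb[of i] by auto
qed

text \<open>From \<open>a\<close> the new permutation jumps to the \<pi>-successor of
  \<open>b\<close> and then follows the old cycle of \<open>b\<close>, which does not meet
  \<open>a\<close>, until it arrives at \<open>b\<close>.\<close>

lemma orb_rel_comp_transpose_joins: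
  assumes "bij_betw \<pi> D D" "finite D" "a \<in> D" "b \<in> D" "(a, b) \<notin> orb_rel D \<pi>"
  shows "(a, b) \<in> orb_rel D (\<pi> \<circ> transpose a b)"
proof -
  let ?\<pi>' = "\<pi> \<circ> transpose a b"
  have mem: "\<And>x. x \<in> D \<Longrightarrow> \<pi> x \<in> D" using assms(1) by (auto simp: bij_betw_def)
  have ex: "\<exists>n. n > 0 \<and> (\<pi> ^^ n) b = b" using funpow_return[OF assms(1,2,4)] by auto
  define n where "n = (LEAST n. n > 0 \<and> (\<pi> ^^ n) b = b)"
  have n: "n > 0" "(\<pi> ^^ n) b = b" using LeastI_ex[OF ex] unfolding n_def by auto
  have min: "(\<pi> ^^ i) b \<noteq> b" if "0 < i" "i < n" for i
    using not_less_Least[of i "\<lambda>n. n > 0 \<and> (\<pi> ^^ n) b = b"] that unfolding n_def by blast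
  have na: "(\<pi> ^^ i) b \<noteq> a" for i
  proof
    assume "(\<pi> ^^ i) b = a"
    then have "(b, a) \<in> orb_rel D \<pi>" using assms(3,4) by (auto simp: orb_rel_def)
    then show False
      using assms(5) equiv_orb_rel[OF assms(1,2)] by (auto elim!: equivE dest: symD)
  qed
  have "0 < i \<Longrightarrow> i \<le> n \<Longrightarrow> (?\<pi>' ^^ i) a = (\<pi> ^^ i) b" for i
  proof (induction i)
    case (Suc i)
    show ?case
    proof (cases "i = 0")
      case False
      then have "(?\<pi>' ^^ i) a = (\<pi> ^^ i) b" using Suc.IH Suc.prems by (metis Suc_leD gr0I)
      moreover have "(\<pi> ^^ i) b \<noteq> b" using min False Suc by auto
      ultimately have "?\<pi>' ((?\<pi>' ^^ i) a) = \<pi> ((\<pi> ^^ i) b)"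
        using na[of i] by (metis comp_apply transpose_apply_other)
      then show ?thesis by (metis comp_apply funpow.simps(2))
    qed simp
  qed simp
  then have "(?\<pi>' ^^ n) a = b" using n by auto
  then show ?thesis using assms(3,4) by (auto simp: orb_rel_def)
qed

text \<open>After merging \<open>a\<close> with \<open>b\<close> both permutations have the same
  classes, and \<open>a\<close>, \<open>b\<close> share a cycle for exactly one of the two; that one
  has one cycle fewer.\<close>

lemma ncyc_comp_transpose:
  assumes "bij_betw \<pi> D D" "finite D" "a \<in> D" "b \<in> D" "a \<noteq> b"
  shows "ncyc D (\<pi> \<circ> transpose a b) = ncyc D \<pi> + 1 \<or> ncyc D \<pi> = ncyc D (\<pi> \<circ> transpose a b) + 1"
proof -
  have "(a, b) \<in> orb_rel D \<pi> \<longleftrightarrow> (a, b) \<notin> orb_rel D (\<pi> \<circ> transpose a b)"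
    using orb_rel_comp_transpose_joins orb_rel_comp_transpose_separates assms by metis
  then show ?thesis
    using card_quotient_join_rel[OF equiv_orb_rel[OF assms(1,2)] assms(2-4)]
      card_quotient_join_rel[OF equiv_orb_rel[OF bij_betw_comp_transpose[OF assms(1,3,4)] assms(2)] assms(2-4)]
      join_orb_rel_transpose[OF assms(1-4)]
    unfolding ncyc_def by (auto split: if_splits)
qed

section \<open>A lower bound for the number of faces\<close>

text \<open>A rotation composed with this map stays the rotation when \<open>F\<close> is empty and
  becomes the face permutation when \<open>F\<close> contains all edges. The sets in between connect
  the two by one transposition per edge.\<close>

definition flip_on :: "'a set set \<Rightarrow> 'a \<times> 'a \<Rightarrow> 'a \<times> 'a" where
  "flip_on F d = (if {fst d, snd d} \<in> F then (snd d, fst d) else d)"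

definition loopless :: "'a set set \<Rightarrow> bool" where
  "loopless E \<longleftrightarrow> (\<forall>e\<in>E. \<exists>x y. x \<noteq> y \<and> e = {x, y})"

text \<open>Since \<^term>\<open>ncyc {} \<pi> = 0\<close>, the edgeless graph counts as having no face here, whereas
  \<^const>\<open>num_faces\<close> assigns it one face; the two conventions agree for \<open>n \<ge> 1\<close>.\<close>

definition emb :: "nat \<Rightarrow> 'a set set \<Rightarrow> bool" where
  "emb n E \<longleftrightarrow> (\<exists>\<rho>. rotation_system UNIV E \<rho> \<and> ncyc (darts E) (face_perm \<rho>) \<le> n)"

lemma rotation_system_UNIV: "rotation_system V E \<rho> \<longleftrightarrow> rotation_system UNIV E \<rho>"
  by (simp add: rotation_system_def)

lemma simple_graph_loopless: "simple_graph V E \<Longrightarrow> loopless E"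
  unfolding simple_graph_def loopless_def by metis

lemma simple_graph_finite: "simple_graph V E \<Longrightarrow> finite V" "simple_graph V E \<Longrightarrow> finite E"
  "simple_graph V E \<Longrightarrow> e \<in> E \<Longrightarrow> e \<subseteq> V"
proof -
  show "simple_graph V E \<Longrightarrow> finite V" by (simp add: simple_graph_def)
  show sub: "simple_graph V E \<Longrightarrow> e \<in> E \<Longrightarrow> e \<subseteq> V" for e by (auto simp: simple_graph_def)
  show "simple_graph V E \<Longrightarrow> finite E"
    using sub finite_subset[of E "Pow V"] by (auto simp: simple_graph_def)
qed

lemma finite_darts: "finite E \<Longrightarrow> loopless E \<Longrightarrow> finite (darts E)"
proof -
  assume "finite E" "loopless E"
  then have "finite (\<Union>E)" by (auto simp: loopless_def)
  moreover have "darts E \<subseteq> \<Union>E \<times> \<Union>E" by (auto simp: darts_def)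
  ultimately show ?thesis using finite_subset by blast
qed

lemma orb_rel_Image:
  assumes "\<And>x. x \<in> D \<Longrightarrow> \<pi> x \<in> D" "x \<in> D"
  shows "orb_rel D \<pi> `` {x} = range (\<lambda>n. (\<pi> ^^ n) x)"
  using funpow_mem[OF assms] assms(2) by (auto simp: orb_rel_def)

lemma orb_rel_cong:
  assumes "\<And>x. x \<in> D \<Longrightarrow> \<pi> x \<in> D" "\<And>x. x \<in> D \<Longrightarrow> \<pi> x = \<pi>' x"
  shows "orb_rel D \<pi> = orb_rel D \<pi>'"
proof -
  have "(\<pi> ^^ n) x = (\<pi>' ^^ n) x" if "x \<in> D" for n x
  proof (induction n)
    case (Suc n)
    have "(\<pi> ^^ n) x \<in> D" using funpow_mem[of D \<pi>] assms(1) that by blast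
    then have "\<pi> ((\<pi> ^^ n) x) = \<pi>' ((\<pi> ^^ n) x)" by (rule assms(2))
    then show ?case by (simp add: Suc)
  qed simp
  then show ?thesis by (auto simp: orb_rel_def)
qed

lemma flip_on_insert:
  assumes "{u, v} \<notin> F"
  shows "flip_on (insert {u, v} F) = flip_on F \<circ> transpose (u, v) (v, u)"
proof
  fix d :: "'a \<times> 'a"
  obtain x y where d: "d = (x, y)" by (cases d)
  show "flip_on (insert {u, v} F) d = (flip_on F \<circ> transpose (u, v) (v, u)) d"
    using assms by (auto simp: d flip_on_def transpose_def doubleton_eq_iff insert_commute)
qed

text \<open>Each edge of \<open>F\<close> contributes one transposition and so changes the number of
  cycles by exactly one. \<open>G\<close> holds the edges already flipped: it is empty when a parity
  is wanted, and consists of the edges inside classes when the crossing edges are to be paid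
  for.\<close>

lemma ncyc_flip_on:
  assumes "finite F" "finite D" "F \<inter> G = {}"
    "\<And>e. e \<in> F \<Longrightarrow> \<exists>u v. u \<noteq> v \<and> e = {u, v} \<and> (u, v) \<in> D \<and> (v, u) \<in> D"
    "bij_betw (\<rho> \<circ> flip_on G) D D"
  shows "bij_betw (\<rho> \<circ> flip_on (F \<union> G)) D D \<and>
    even (ncyc D (\<rho> \<circ> flip_on (F \<union> G)) + ncyc D (\<rho> \<circ> flip_on G) + card F) \<and>
    ncyc D (\<rho> \<circ> flip_on G) \<le> ncyc D (\<rho> \<circ> flip_on (F \<union> G)) + card F"
  using assms(1,3,4)
proof (induction F rule: finite_induct)
  case empty
  then show ?case using assms(5) by (simp add: comp_def)
next
  case (insert e F)
  obtain u v where uv: "u \<noteq> v" "e = {u, v}" "(u, v) \<in> D" "(v, u) \<in> D"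
    using insert.prems(2)[of e] by auto
  have IH: "bij_betw (\<rho> \<circ> flip_on (F \<union> G)) D D"
    "even (ncyc D (\<rho> \<circ> flip_on (F \<union> G)) + ncyc D (\<rho> \<circ> flip_on G) + card F)"
    "ncyc D (\<rho> \<circ> flip_on G) \<le> ncyc D (\<rho> \<circ> flip_on (F \<union> G)) + card F"
    using insert.IH insert.prems by (blast+)
  have "{u, v} \<notin> F \<union> G" using insert.hyps(2) insert.prems(1) uv(2) by auto
  from flip_on_insert[OF this] have eq: "\<rho> \<circ> flip_on (insert e F \<union> G) = (\<rho> \<circ> flip_on (F \<union> G)) \<circ> transpose (u, v) (v, u)"
    by (simp only: uv(2) comp_assoc Un_insert_left)
  have ne: "(u, v) \<noteq> (v, u)" using uv by simp
  have card: "card (insert e F) = Suc (card F)" using insert.hyps by simp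
  note ch = ncyc_comp_transpose[OF IH(1) assms(2) uv(3,4) ne]
  show ?case
    unfolding eq card
  proof (intro conjI)
    show "bij_betw (\<rho> \<circ> flip_on (F \<union> G) \<circ> transpose (u, v) (v, u)) D D"
      using bij_betw_comp_transpose[OF IH(1) uv(3,4)] .
  qed (use ch IH(2,3) in presburger)+
qed

text \<open>Counting through representatives avoids any bijection between cycles: it is enough that
  everything is reached from one of at most \<open>n\<close> starting points.\<close>

lemma ncyc_le_cover:
  assumes "finite S" "card S \<le> n" "S \<subseteq> D" "\<And>d. d \<in> D \<Longrightarrow> \<exists>s\<in>S. \<exists>m. (\<pi> ^^ m) s = d"
    "bij_betw \<pi> D D" "finite D"
  shows "ncyc D \<pi> \<le> n"
proof -
  have eq: "equiv D (orb_rel D \<pi>)" using equiv_orb_rel assms by blast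
  have "D // orb_rel D \<pi> \<subseteq> (\<lambda>s. orb_rel D \<pi> `` {s}) ` S"
  proof
    fix X assume "X \<in> D // orb_rel D \<pi>"
    then obtain d where d: "d \<in> D" "X = orb_rel D \<pi> `` {d}" by (auto elim: quotientE)
    then obtain s m where s: "s \<in> S" "(\<pi> ^^ m) s = d" using assms(4) by blast
    then have "(s, d) \<in> orb_rel D \<pi>" using d assms(3) by (auto simp: orb_rel_def)
    then show "X \<in> (\<lambda>s. orb_rel D \<pi> `` {s}) ` S"
      using d s equiv_class_eq[OF eq] by blast
  qed
  then show ?thesis
    unfolding ncyc_def using assms(1,2) by (meson card_image_le card_mono finite_imageI le_trans)
qed

lemma ncyc_cover:
  assumes "finite D"
  obtains S where "finite S" "card S \<le> ncyc D \<pi>" "S \<subseteq> D"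
    "\<And>d. d \<in> D \<Longrightarrow> \<exists>s\<in>S. (s, d) \<in> orb_rel D \<pi>"
proof -
  define f where "f X = (SOME s. s \<in> D \<and> X = orb_rel D \<pi> `` {s})" for X
  have f: "f X \<in> D \<and> X = orb_rel D \<pi> `` {f X}" if "X \<in> D // orb_rel D \<pi>" for X
    unfolding f_def by (rule someI_ex) (use that in \<open>auto elim: quotientE\<close>)
  have fin: "finite (D // orb_rel D \<pi>)"
    using assms finite_quotient[OF assms, of "orb_rel D \<pi>"] by (auto simp: orb_rel_def)
  show ?thesis
  proof
    show "finite (f ` (D // orb_rel D \<pi>))" using fin by simp
    show "card (f ` (D // orb_rel D \<pi>)) \<le> ncyc D \<pi>"
      using card_image_le[OF fin, of f] unfolding ncyc_def by linarith
    show "f ` (D // orb_rel D \<pi>) \<subseteq> D" using f by auto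
    fix d assume d: "d \<in> D"
    have "(d, d) \<in> orb_rel D \<pi>" using d unfolding orb_rel_def by (auto intro: exI[of _ 0])
    moreover have "orb_rel D \<pi> `` {d} \<in> D // orb_rel D \<pi>" using d by (rule quotientI)
    ultimately show "\<exists>s\<in>f ` (D // orb_rel D \<pi>). (s, d) \<in> orb_rel D \<pi>" using f by blast
  qed
qed

lemma face_perm_bij:
  assumes "rotation_system V E \<rho>"
  shows "bij_betw (face_perm \<rho>) (darts E) (darts E)"
proof -
  have "bij_betw (\<lambda>d. (snd d, fst d)) (darts E) (darts E)"
    by (rule bij_betw_byWitness[where f' = "\<lambda>d. (snd d, fst d)"])
      (auto simp: darts_def insert_commute)
  then have "bij_betw (\<rho> \<circ> (\<lambda>d. (snd d, fst d))) (darts E) (darts E)"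
    using assms bij_betw_trans unfolding rotation_system_def by blast
  then show ?thesis by (simp add: comp_def face_perm_def[abs_def])
qed

lemma upper_embeddable_iff:
  assumes "loopless E"
  shows "upper_embeddable V E \<longleftrightarrow> connected V E \<and> emb 2 E"
proof (cases "E = {}")
  case True
  then have "rotation_system V E id" for V :: "'a set" by (auto simp: rotation_system_def darts_def)
  then show ?thesis
    using True unfolding upper_embeddable_def emb_def num_faces_def ncyc_def
    by (auto simp: darts_def)
next
  case False
  have "face_rel E \<rho> = orb_rel (darts E) (face_perm \<rho>)" for \<rho>
    by (auto simp: face_rel_def orb_rel_def)
  then have "num_faces E \<rho> = ncyc (darts E) (face_perm \<rho>)" for \<rho>
    using False by (simp add: num_faces_def ncyc_def)
  then show ?thesis
    unfolding upper_embeddable_def emb_def using rotation_system_UNIV by metis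
qed

text \<open>The cycles of a rotation are the vertices. The restriction to \<open>C\<close> makes
  this available inside a single class; a vertex without edges would have no cycle, hence the second
  hypothesis.\<close>

lemma ncyc_rotation_system:
  assumes "rotation_system UNIV E \<rho>" "\<And>c. c \<in> C \<Longrightarrow> \<exists>w. {c, w} \<in> E"
  shows "ncyc {d \<in> darts E. fst d \<in> C} \<rho> = card C"
proof -
  let ?D = "{d \<in> darts E. fst d \<in> C}"
  have fx: "fst ((\<rho> ^^ n) d) = fst d \<and> (\<rho> ^^ n) d \<in> darts E" if "d \<in> darts E" for d n
    using that assms(1) unfolding rotation_system_def bij_betw_def by (induction n) auto
  have r: "orb_rel ?D \<rho> = {(d, d'). d \<in> ?D \<and> d' \<in> ?D \<and> fst d = fst d'}"
  proof (rule set_eqI, clarify)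
    fix x y x' y'
    have "(\<exists>n. (\<rho> ^^ n) (x, y) = (x', y')) \<longleftrightarrow> x = x'" if "(x, y) \<in> darts E" "(x', y') \<in> darts E"
    proof
      show "\<exists>n. (\<rho> ^^ n) (x, y) = (x', y') \<Longrightarrow> x = x'" using fx[OF that(1)] by (metis fst_conv)
      show "x = x' \<Longrightarrow> \<exists>n. (\<rho> ^^ n) (x, y) = (x', y')"
        using assms(1) that unfolding rotation_system_def by (metis fst_conv)
    qed
    then show "((x, y), x', y') \<in> orb_rel ?D \<rho> \<longleftrightarrow>
      ((x, y), x', y') \<in> {(d, d'). d \<in> ?D \<and> d' \<in> ?D \<and> fst d = fst d'}"
      unfolding orb_rel_def by auto
  qed
  define g where "g c = {d \<in> ?D. fst d = c}" for c
  have "?D // orb_rel ?D \<rho> = g ` C"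
  proof (intro equalityI subsetI)
    fix X assume "X \<in> ?D // orb_rel ?D \<rho>"
    then obtain d where d: "d \<in> ?D" "X = orb_rel ?D \<rho> `` {d}" by (auto elim: quotientE)
    then have "X = g (fst d)" unfolding r g_def by auto
    then show "X \<in> g ` C" using d by auto
  next
    fix X assume "X \<in> g ` C"
    then obtain c where c: "c \<in> C" "X = g c" by auto
    obtain w where "{c, w} \<in> E" using assms(2) c by auto
    then have "(c, w) \<in> ?D" using c by (auto simp: darts_def)
    moreover from this have "X = orb_rel ?D \<rho> `` {(c, w)}" unfolding r c g_def by auto
    ultimately show "X \<in> ?D // orb_rel ?D \<rho>" by (auto intro: quotientI)
  qed
  moreover have "inj_on g C"
  proof (rule inj_onI)
    fix c c' assume c: "c \<in> C" "c' \<in> C" "g c = g c'"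
    obtain w where "{c, w} \<in> E" using assms(2) c by auto
    then have "(c, w) \<in> g c" using c by (auto simp: darts_def g_def)
    then show "c = c'" using c(3) by (auto simp: g_def)
  qed
  ultimately show ?thesis by (simp add: ncyc_def card_image)
qed

text \<open>For a class that induces a connected subgraph the weight is 2 iff its Betti number is odd.\<close>

definition even_weight :: "'a set \<Rightarrow> 'a set set \<Rightarrow> ('a \<Rightarrow> 'c) \<Rightarrow> 'c \<Rightarrow> nat" where
  "even_weight V E p c = (if even (card {v \<in> V. p v = c} + card {e \<in> E. p ` e = {c}}) then 2 else 1)"

definition cross_edges :: "'a set set \<Rightarrow> ('a \<Rightarrow> 'c) \<Rightarrow> 'a set set" where
  "cross_edges E p = {e \<in> E. \<not> (\<exists>c. p ` e = {c})}"

text \<open>This is the easy direction of Nebesky's theorem on upper-embeddability. The classes of \<open>p\<close> need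
  not be connected: once the crossing edges are no longer flipped, every orbit stays within one class,
  and the parity of the number of orbits within a class is that of its vertices plus its edges.\<close>

lemma ncyc_face_perm_parity_bound:
  assumes "simple_graph V E" "rotation_system UNIV E \<rho>" "\<And>v. v \<in> V \<Longrightarrow> \<exists>w. {v, w} \<in> E"
  shows "even (ncyc (darts E) (face_perm \<rho>) + card V + card E)"
    and "(\<Sum>c\<in>p ` V. even_weight V E p c) \<le> ncyc (darts E) (face_perm \<rho>) + card (cross_edges E p)"
proof -
  let ?D = "darts E"
  note fin = simple_graph_finite(1,2)[OF assms(1)] simple_graph_finite(3)[OF assms(1)] and ll = simple_graph_loopless[OF assms(1)]
  have finD: "finite ?D" using finite_darts fin ll by blast
  have bij: "bij_betw \<rho> ?D ?D" and fst\<rho>: "\<And>d. d \<in> ?D \<Longrightarrow> fst (\<rho> d) = fst d"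
    using assms(2) by (auto simp: rotation_system_def)
  have D\<rho>: "\<rho> d \<in> ?D" if "d \<in> ?D" for d using bij that by (auto simp: bij_betw_def)
  have flipD: "flip_on F d \<in> ?D" if "d \<in> ?D" for d F
    using that by (auto simp: flip_on_def darts_def insert_commute split: prod.splits)
  have dV: "fst d \<in> V" "snd d \<in> V" if "d \<in> ?D" for d
    using that fin(3)[of "{fst d, snd d}"] by (auto simp: darts_def)
  have edge: "\<exists>u v. u \<noteq> v \<and> e = {u, v} \<and> (u, v) \<in> ?D \<and> (v, u) \<in> ?D" if "e \<in> E" for e
  proof -
    obtain u v where uv: "u \<noteq> v" "e = {u, v}"
      using ll \<open>e \<in> E\<close> unfolding loopless_def by metis
    then have "{u, v} \<in> E" "{v, u} \<in> E" using that by (simp_all add: insert_commute)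
    then show ?thesis using uv by (intro exI[of _ u] exI[of _ v]) (simp add: darts_def)
  qed
  have \<rho>0: "\<rho> \<circ> flip_on {} = \<rho>" by (auto simp: flip_on_def fun_eq_iff)
  have face: "orb_rel ?D (\<rho> \<circ> flip_on E) = orb_rel ?D (face_perm \<rho>)"
    by (rule orb_rel_cong) (auto simp: D\<rho> flipD, auto simp: flip_on_def darts_def face_perm_def)
  then have ncf: "ncyc ?D (face_perm \<rho>) = ncyc ?D (\<rho> \<circ> flip_on E)" by (simp add: ncyc_def)
  have "{d \<in> ?D. fst d \<in> V} = ?D" using dV by auto
  then have cV: "ncyc ?D \<rho> = card V" using ncyc_rotation_system[OF assms(2), of V] assms(3) by simp
  \<comment> \<open>The rotation has \<open>card V\<close> cycles, and \<open>card E\<close>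
    transpositions lead from it to the face permutation.\<close>
  show "even (ncyc (darts E) (face_perm \<rho>) + card V + card E)"
    using ncyc_flip_on[of E ?D "{}" \<rho>] fin finD edge bij unfolding \<rho>0 ncf cV by auto
  define Bc where "Bc c = {e \<in> E. p ` e = {c}}" for c
  define Dc where "Dc c = {d \<in> ?D. fst d \<in> {v \<in> V. p v = c}}" for c
  define B where "B = E - cross_edges E p"
  define \<pi> where "\<pi> = \<rho> \<circ> flip_on B"
  have BE: "cross_edges E p \<union> B = E" "cross_edges E p \<inter> B = {}" "cross_edges E p \<subseteq> E" "B \<subseteq> E"
    by (auto simp: B_def cross_edges_def)
  have Bp: "{u, v} \<in> B \<longleftrightarrow> {u, v} \<in> E \<and> p u = p v" for u v
    by (auto simp: B_def cross_edges_def)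
  have b\<pi>: "bij_betw \<pi> ?D ?D"
    using ncyc_flip_on[of B ?D "{}" \<rho>] finite_subset[OF BE(4) fin(2)] finD edge[OF subsetD[OF BE(4)]] bij
    unfolding \<rho>0 \<pi>_def by simp
  have "finite (cross_edges E p)" using BE(3) fin finite_subset by blast
  then have le1: "ncyc ?D \<pi> \<le> ncyc ?D (\<rho> \<circ> flip_on E) + card (cross_edges E p)"
    using ncyc_flip_on[of "cross_edges E p" ?D B \<rho>] finD edge BE b\<pi>
    unfolding \<pi>_def by auto
  have D\<pi>: "\<pi> d \<in> ?D" if "d \<in> ?D" for d using D\<rho> flipD that by (simp add: \<pi>_def)
  have Dc\<rho>: "\<rho> d \<in> Dc c" if "d \<in> Dc c" for d c
    using that D\<rho> fst\<rho> by (auto simp: Dc_def)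
  have Dcf: "flip_on B d \<in> Dc c" if "d \<in> Dc c" for d c
    using that flipD[of d B] dV[of d] Bp by (auto simp: Dc_def flip_on_def split: if_splits)
  have Dc\<pi>: "\<pi> d \<in> Dc c" if "d \<in> Dc c" for d c
    using Dc\<rho> Dcf that by (simp add: \<pi>_def)
  have wt: "even_weight V E p c \<le> card (Dc c // orb_rel (Dc c) \<pi>)" if c: "c \<in> p ` V" for c
  proof -
    have finc: "finite (Dc c)" using finD by (simp add: Dc_def)
    have bc: "bij_betw \<rho> (Dc c) (Dc c)"
      unfolding bij_betw_def
    proof
      show "inj_on \<rho> (Dc c)" using bij by (auto simp: bij_betw_def Dc_def inj_on_def)
      then show "\<rho> ` Dc c = Dc c" using endo_inj_surj[OF finc] Dc\<rho> by blast
    qed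
    have "\<exists>u v. u \<noteq> v \<and> e = {u, v} \<and> (u, v) \<in> Dc c \<and> (v, u) \<in> Dc c" if e: "e \<in> Bc c" for e
    proof -
      obtain u v where uv: "u \<noteq> v" "e = {u, v}" "(u, v) \<in> ?D" "(v, u) \<in> ?D"
        using edge[of e] e unfolding Bc_def by (metis (no_types, lifting) mem_Collect_eq)
      then show ?thesis using e dV[OF uv(3)] by (auto simp: Bc_def Dc_def)
    qed
    then have "even (ncyc (Dc c) (\<rho> \<circ> flip_on (Bc c)) + ncyc (Dc c) \<rho> + card (Bc c))"
      using ncyc_flip_on[of "Bc c" "Dc c" "{}" \<rho>] finc fin(2) bc unfolding \<rho>0
      by (auto simp: Bc_def)
    moreover have "ncyc (Dc c) \<rho> = card {v \<in> V. p v = c}"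
      unfolding Dc_def by (rule ncyc_rotation_system) (use assms in auto)
    moreover have "orb_rel (Dc c) \<pi> = orb_rel (Dc c) (\<rho> \<circ> flip_on (Bc c))"
    proof (rule orb_rel_cong)
      fix d assume d: "d \<in> Dc c"
      then have "{fst d, snd d} \<in> B \<longleftrightarrow> {fst d, snd d} \<in> Bc c"
        using Bp by (auto simp: Dc_def Bc_def)
      then show "\<pi> d = (\<rho> \<circ> flip_on (Bc c)) d" by (simp add: \<pi>_def flip_on_def)
    qed (rule Dc\<pi>)
    moreover have "card (Dc c // orb_rel (Dc c) \<pi>) > 0"
    proof -
      obtain v w where "v \<in> V" "p v = c" "{v, w} \<in> E" using c assms(3) by blast
      then have "(v, w) \<in> Dc c" by (auto simp: Dc_def darts_def)
      then have "Dc c // orb_rel (Dc c) \<pi> \<noteq> {}" by (auto simp: quotient_def)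
      moreover have "finite (Dc c // orb_rel (Dc c) \<pi>)"
        using finite_quotient[OF finc, of "orb_rel (Dc c) \<pi>"] by (auto simp: orb_rel_def)
      ultimately show ?thesis by (simp add: card_gt_0_iff)
    qed
    \<comment> \<open>The number of cycles inside the class is positive and has the parity of its
      vertices plus edges; when that sum is even there are at least two.\<close>
    ultimately show ?thesis
      unfolding even_weight_def ncyc_def Bc_def
      by (cases "card (Dc c // orb_rel (Dc c) \<pi>) = 1") auto
  qed
  \<comment> \<open>A cycle of \<pi> that meets a class stays in it, so the cycles found in the
    separate classes are distinct cycles of the whole.\<close>
  have im: "orb_rel (Dc c) \<pi> `` {d} = orb_rel ?D \<pi> `` {d}" if "d \<in> Dc c" for c d
    using orb_rel_Image[of "Dc c" \<pi> d] orb_rel_Image[of ?D \<pi> d] Dc\<pi> D\<pi> that by (auto simp: Dc_def)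
  have finq: "finite (?D // orb_rel ?D \<pi>)"
    using finite_quotient[OF finD, of "orb_rel ?D \<pi>"] by (auto simp: orb_rel_def)
  have sub: "Dc c // orb_rel (Dc c) \<pi> \<subseteq> ?D // orb_rel ?D \<pi>" for c
    using im by (fastforce simp: quotient_def Dc_def)
  have inD: "X \<noteq> {} \<and> X \<subseteq> Dc c" if X: "X \<in> Dc c // orb_rel (Dc c) \<pi>" for X c
  proof -
    obtain d where d: "d \<in> Dc c" "X = orb_rel (Dc c) \<pi> `` {d}" using X by (rule quotientE)
    then have "(d, d) \<in> orb_rel (Dc c) \<pi>" unfolding orb_rel_def by (auto intro: exI[of _ 0])
    moreover have "X \<subseteq> Dc c" unfolding d(2) orb_rel_def by blast
    ultimately show ?thesis using d(2) by blast
  qed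
  have dis: "Dc c // orb_rel (Dc c) \<pi> \<inter> Dc c' // orb_rel (Dc c') \<pi> = {}" if "c \<noteq> c'" for c c'
    using inD[of _ c] inD[of _ c'] that by (fastforce simp: Dc_def)
  have "(\<Sum>c\<in>p ` V. even_weight V E p c) \<le> (\<Sum>c\<in>p ` V. card (Dc c // orb_rel (Dc c) \<pi>))"
    by (rule sum_mono) (rule wt)
  also have "\<dots> = card (\<Union>c\<in>p ` V. Dc c // orb_rel (Dc c) \<pi>)"
    by (subst card_UN_disjoint) (use fin assms(1) dis finite_subset[OF sub finq] in auto)
  also have "\<dots> \<le> card (?D // orb_rel ?D \<pi>)"
    by (rule card_mono[OF finq]) (use sub in blast)
  finally show "(\<Sum>c\<in>p ` V. even_weight V E p c) \<le> ncyc ?D (face_perm \<rho>) + card (cross_edges E p)"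
    using le1 unfolding ncf unfolding ncyc_def by linarith
qed

section \<open>Embeddings with few faces\<close>

lemma darts_empty: "darts {} = {}"
  by (simp add: darts_def)

lemma darts_Un: "darts (E \<union> F) = darts E \<union> darts F"
  by (auto simp: darts_def)

lemma darts_insert: "darts (insert {x, y} E) = {(x, y), (y, x)} \<union> darts E"
  by (auto simp: darts_def doubleton_eq_iff)

lemma darts_Diff_edge: "darts (E - {{x, y}}) = darts E - {(x, y), (y, x)}"
  by (auto simp: darts_def doubleton_eq_iff)

text \<open>Transitivity at each vertex already gives surjectivity, since the iterate leading from
  \<open>\<rho> d\<close> back to \<open>d\<close> exhibits a preimage of \<open>d\<close>;
  injectivity then follows from finiteness.\<close>

lemma rotation_systemI:
  assumes "finite (darts E)"
    "\<And>d. d \<in> darts E \<Longrightarrow> \<rho> d \<in> darts E \<and> fst (\<rho> d) = fst d"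
    "\<And>d d'. d \<in> darts E \<Longrightarrow> d' \<in> darts E \<Longrightarrow> fst d = fst d' \<Longrightarrow> \<exists>n. (\<rho> ^^ n) d = d'"
  shows "rotation_system V E \<rho>"
  unfolding rotation_system_def
proof (intro conjI ballI impI)
  have "darts E \<subseteq> \<rho> ` darts E"
  proof
    fix d assume d: "d \<in> darts E"
    then obtain n where n: "(\<rho> ^^ n) (\<rho> d) = d" using assms(3)[of "\<rho> d" d] assms(2)[OF d] by auto
    then have "\<rho> ((\<rho> ^^ n) d) = d" by (simp add: funpow_swap1)
    moreover have "(\<rho> ^^ n) d \<in> darts E" using funpow_mem[of "darts E" \<rho>] assms(2) d by blast
    ultimately show "d \<in> \<rho> ` darts E" by (metis imageI)
  qed
  then have "\<rho> ` darts E = darts E" using assms(2) by auto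
  then show "bij_betw \<rho> (darts E) (darts E)"
    using assms(1) by (simp add: bij_betw_def eq_card_imp_inj_on)
qed (use assms in auto)

lemma funpow_trans: "(f ^^ m) x = y \<Longrightarrow> (f ^^ n) y = z \<Longrightarrow> (f ^^ (n + m)) x = z"
  by (simp add: funpow_add)

text \<open>One face step in \<open>E\<close> may become several in \<open>E'\<close>, so
  \<open>g\<close> need not commute with the face permutations. Faces are still carried into faces,
  and since every dart of \<open>E'\<close> is reached from some image, images of representatives
  represent all faces of \<open>E'\<close>.\<close>

lemma emb_transport:
  assumes "rotation_system UNIV E \<rho>" "ncyc (darts E) (face_perm \<rho>) \<le> n" "finite (darts E)"
    "rotation_system UNIV E' \<rho>'" "finite (darts E')"
    "\<And>d. d \<in> darts E \<Longrightarrow> g d \<in> darts E'"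
    "\<And>d. d \<in> darts E \<Longrightarrow> \<exists>m. (face_perm \<rho>' ^^ m) (g d) = g (face_perm \<rho> d)"
    "\<And>d'. d' \<in> darts E' \<Longrightarrow> \<exists>d\<in>darts E. \<exists>m. (face_perm \<rho>' ^^ m) (g d) = d'"
  shows "emb n E'"
proof -
  obtain S where S: "finite S" "card S \<le> ncyc (darts E) (face_perm \<rho>)"
    "S \<subseteq> darts E" "\<And>d. d \<in> darts E \<Longrightarrow> \<exists>s\<in>S. (s, d) \<in> orb_rel (darts E) (face_perm \<rho>)"
    using ncyc_cover[OF assms(3)] by metis
  have mem: "\<And>d. d \<in> darts E \<Longrightarrow> face_perm \<rho> d \<in> darts E"
    using face_perm_bij[OF assms(1)] by (auto simp: bij_betw_def)
  have iter: "\<exists>m. (face_perm \<rho>' ^^ m) (g s) = g ((face_perm \<rho> ^^ k) s)" if "s \<in> darts E" for s k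
  proof (induction k)
    case 0
    show ?case by (intro exI[of _ 0]) simp
  next
    case (Suc k)
    have "(face_perm \<rho> ^^ k) s \<in> darts E" using funpow_mem[of "darts E" "face_perm \<rho>"] mem that by blast
    then show ?case using Suc assms(7) funpow_trans by (metis comp_apply funpow.simps(2))
  qed
  have "ncyc (darts E') (face_perm \<rho>') \<le> n"
  proof (rule ncyc_le_cover)
    show "finite (g ` S)" using S(1) by simp
    show "card (g ` S) \<le> n" using card_image_le[OF S(1), of g] S(2) assms(2) by linarith
    show "g ` S \<subseteq> darts E'" using S(3) assms(6) by auto
    fix d' assume "d' \<in> darts E'"
    then obtain d m where d: "d \<in> darts E" "(face_perm \<rho>' ^^ m) (g d) = d'" using assms(8) by blast
    obtain s where s: "s \<in> S" "(s, d) \<in> orb_rel (darts E) (face_perm \<rho>)" using S(4) d by blast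
    then obtain k where "s \<in> darts E" "(face_perm \<rho> ^^ k) s = d" by (auto simp: orb_rel_def)
    then obtain m' where "(face_perm \<rho>' ^^ m') (g s) = g d" using iter by metis
    then show "\<exists>s\<in>g ` S. \<exists>m. (face_perm \<rho>' ^^ m) s = d'"
      using funpow_trans d s(1) by (metis imageI)
  qed (use face_perm_bij[OF assms(4)] assms(5) in auto)
  then show ?thesis using assms(4) unfolding emb_def by blast
qed

text \<open>Injectivity is only available on the vertices that carry edges, so the rotation is
  pulled back through an inverse chosen there.\<close>

lemma emb_image:
  assumes "emb n E" "finite E" "loopless E" "inj_on f (\<Union>E)"
  shows "emb n ((`) f ` E)"
proof -
  obtain \<rho> where \<rho>: "rotation_system UNIV E \<rho>" "ncyc (darts E) (face_perm \<rho>) \<le> n"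
    using assms(1) unfolding emb_def by blast
  let ?E = "(`) f ` E" and ?g = "map_prod f f"
  define h where "h = inv_into (\<Union>E) f"
  have h: "h (f x) = x" if "x \<in> \<Union>E" for x unfolding h_def using that assms(4) by simp
  define \<rho>' where "\<rho>' = ?g \<circ> \<rho> \<circ> map_prod h h"
  note finD = finite_darts[OF assms(2,3)]
  have "darts ?E = ?g ` darts E"
  proof (intro equalityI subsetI)
    fix d assume "d \<in> darts ?E"
    then obtain x y e where d: "d = (x, y)" "e \<in> E" "{x, y} = f ` e" by (auto simp: darts_def)
    obtain a b where ab: "a \<noteq> b" "e = {a, b}" using assms(3) d(2) unfolding loopless_def by metis
    have "(a, b) \<in> darts E" "(b, a) \<in> darts E" using d(2) ab by (auto simp: darts_def insert_commute)
    moreover have "x = f a \<and> y = f b \<or> x = f b \<and> y = f a"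
      using d(3) ab by (auto simp: doubleton_eq_iff)
    ultimately show "d \<in> ?g ` darts E" using d(1) by force
  next
    fix d assume "d \<in> ?g ` darts E"
    then obtain x y where d: "d = (f x, f y)" "{x, y} \<in> E" by (auto simp: darts_def)
    then have "f ` {x, y} \<in> ?E" by blast
    then show "d \<in> darts ?E" using d(1) by (simp add: darts_def)
  qed
  note dE = this
  have hg: "map_prod h h (?g d) = d" if "d \<in> darts E" for d
  proof -
    obtain x y where "d = (x, y)" "{x, y} \<in> E" using \<open>d \<in> darts E\<close> by (auto simp: darts_def)
    moreover from this have "x \<in> \<Union>E" "y \<in> \<Union>E" by auto
    ultimately show ?thesis using h by simp
  qed
  then have \<rho>'g: "\<rho>' (?g d) = ?g (\<rho> d)" if "d \<in> darts E" for d using that by (simp add: \<rho>'_def)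
  have \<rho>D: "\<rho> d \<in> darts E" "fst (\<rho> d) = fst d" if "d \<in> darts E" for d
    using that \<rho>(1) by (auto simp: rotation_system_def bij_betw_def)
  have iter: "(\<rho>' ^^ k) (?g d) = ?g ((\<rho> ^^ k) d) \<and> (\<rho> ^^ k) d \<in> darts E" if "d \<in> darts E" for k d
    by (induction k) (use that \<rho>D \<rho>'g in auto)
  have "rotation_system UNIV ?E \<rho>'"
  proof (rule rotation_systemI)
    show "finite (darts ?E)" using finD dE by simp
    show "\<rho>' d \<in> darts ?E \<and> fst (\<rho>' d) = fst d" if "d \<in> darts ?E" for d
      using that \<rho>D \<rho>'g unfolding dE by auto
    fix d d' assume "d \<in> darts ?E" "d' \<in> darts ?E" "fst d = fst d'"
    then obtain c c' where c: "c \<in> darts E" "c' \<in> darts E" "d = ?g c" "d' = ?g c'" "f (fst c) = f (fst c')"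
      unfolding dE by auto
    then have "fst c \<in> \<Union>E" "fst c' \<in> \<Union>E" by (auto simp: darts_def)
    then have "fst c = fst c'" using inj_onD[OF assms(4) c(5)] by blast
    then obtain k where "(\<rho> ^^ k) c = c'" using \<rho>(1) c unfolding rotation_system_def by metis
    then show "\<exists>k. (\<rho>' ^^ k) d = d'" using iter c by metis
  qed
  then show ?thesis
  proof (rule emb_transport[OF \<rho> finD])
    show "finite (darts ?E)" using finD dE by simp
    show "?g d \<in> darts ?E" if "d \<in> darts E" for d using that dE by auto
    show "\<exists>m. (face_perm \<rho>' ^^ m) (?g d) = ?g (face_perm \<rho> d)" if "d \<in> darts E" for d
    proof -
      have "(snd d, fst d) \<in> darts E" using that by (auto simp: darts_def insert_commute)
      then show ?thesis
        using \<rho>'g[of "(snd d, fst d)"] by (intro exI[of _ 1]) (auto simp: face_perm_def)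
    qed
    show "\<exists>d\<in>darts E. \<exists>m. (face_perm \<rho>' ^^ m) (?g d) = d'" if d': "d' \<in> darts ?E" for d'
    proof -
      have "d' \<in> ?g ` darts E" using d' dE by simp
      then obtain d where "d' = ?g d" "d \<in> darts E" by (rule imageE)
      then show ?thesis by (intro bexI[of _ d] exI[of _ 0]) auto
    qed
  qed
qed

text \<open>A single face is one closed walk through all darts, so any two vertices are joined by a
  piece of it. A one-face certificate therefore settles connectedness as well.\<close>

lemma emb_one_connected:
  assumes "emb 1 E" "finite E" "loopless E" "V \<noteq> {}" "\<And>v. v \<in> V \<Longrightarrow> \<exists>w. {v, w} \<in> E"
  shows "connected V E"
proof -
  obtain \<rho> where \<rho>: "rotation_system UNIV E \<rho>" "ncyc (darts E) (face_perm \<rho>) \<le> 1"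
    using assms(1) unfolding emb_def by blast
  obtain S where S: "finite S" "card S \<le> ncyc (darts E) (face_perm \<rho>)"
    "S \<subseteq> darts E" "\<And>d. d \<in> darts E \<Longrightarrow> \<exists>s\<in>S. (s, d) \<in> orb_rel (darts E) (face_perm \<rho>)"
    using ncyc_cover[OF finite_darts[OF assms(2,3)]] by metis
  have S1: "card S \<le> 1" using S(2) \<rho>(2) by linarith
  have mem: "face_perm \<rho> d \<in> darts E" "fst (face_perm \<rho> d) = snd d" if "d \<in> darts E" for d
  proof -
    show "face_perm \<rho> d \<in> darts E" using face_perm_bij[OF \<rho>(1)] that by (auto simp: bij_betw_def)
    have "(snd d, fst d) \<in> darts E" using that by (auto simp: darts_def insert_commute)
    then show "fst (face_perm \<rho> d) = snd d" using \<rho>(1) by (auto simp: face_perm_def rotation_system_def)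
  qed
  have walk: "(face_perm \<rho> ^^ k) d \<in> darts E \<and> (adj E)\<^sup>*\<^sup>* (fst d) (fst ((face_perm \<rho> ^^ k) d))"
    if "d \<in> darts E" for d k
  proof (induction k)
    case (Suc k)
    let ?d = "(face_perm \<rho> ^^ k) d"
    have "adj E (fst ?d) (snd ?d)" using Suc by (auto simp: darts_def adj_def split: prod.splits)
    then show ?case using Suc mem[of ?d] by (auto intro: rtranclp.rtrancl_into_rtrancl)
  qed (use that in simp)
  have sym: "(adj E)\<^sup>*\<^sup>* x y \<Longrightarrow> (adj E)\<^sup>*\<^sup>* y x" for x y
    by (rule sympD[OF symp_rtranclp]) (auto simp: symp_def adj_def insert_commute)
  have "(adj E)\<^sup>*\<^sup>* x y" if xy: "x \<in> V" "y \<in> V" for x y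
  proof -
    obtain x' y' where "{x, x'} \<in> E" "{y, y'} \<in> E" using assms(5) xy by metis
    then have "(x, x') \<in> darts E" "(y, y') \<in> darts E" by (simp_all add: darts_def)
    then obtain s t where st: "s \<in> S" "(s, (x, x')) \<in> orb_rel (darts E) (face_perm \<rho>)"
      "t \<in> S" "(t, (y, y')) \<in> orb_rel (darts E) (face_perm \<rho>)"
      using S(4) by meson
    then have "s = t" using S1 S(1) card_le_Suc0_iff_eq by (metis One_nat_def)
    have "(adj E)\<^sup>*\<^sup>* (fst s) x" "(adj E)\<^sup>*\<^sup>* (fst s) y"
    proof -
      obtain j k where "s \<in> darts E" "(face_perm \<rho> ^^ j) s = (x, x')" "(face_perm \<rho> ^^ k) s = (y, y')"
        using st \<open>s = t\<close> by (auto simp: orb_rel_def)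
      then show "(adj E)\<^sup>*\<^sup>* (fst s) x" "(adj E)\<^sup>*\<^sup>* (fst s) y"
        using walk[of s] by (metis fst_conv)+
    qed
    then show ?thesis using sym by (meson rtranclp_trans)
  qed
  then show ?thesis using assms(4) by (simp add: connected_def)
qed

section \<open>Replacing an edge by a diamond in an embedding\<close>

definition diamond_edges :: "'a \<Rightarrow> 'a \<Rightarrow> 'a \<Rightarrow> 'a \<Rightarrow> 'a set set" where
  "diamond_edges a b c d = {{a, b}, {a, c}, {b, c}, {b, d}, {c, d}}"

definition insert_diamond :: "'a set set \<Rightarrow> 'a \<Rightarrow> 'a \<Rightarrow> 'a \<Rightarrow> 'a \<Rightarrow> 'a \<Rightarrow> 'a \<Rightarrow> 'a set set" where
  "insert_diamond E u v a b c d = (E - {{u, v}}) \<union> {{u, a}, {d, v}} \<union> diamond_edges a b c d"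

lemma finite_insert_diamond: "finite E \<Longrightarrow> finite (insert_diamond E u v a b c d)"
  by (simp add: insert_diamond_def diamond_edges_def)

lemma loopless_insert_diamond:
  assumes "loopless E" "distinct [a, b, c, d]" "{u, v} \<in> E" "{a, b, c, d} \<inter> \<Union>E = {}"
  shows "loopless (insert_diamond E u v a b c d)"
proof -
  have "u \<notin> {a, b, c, d}" "v \<notin> {a, b, c, d}" using assms(3,4) by auto
  then have "\<exists>x y. x \<noteq> y \<and> e = {x, y}" if "e \<in> {{u, a}, {d, v}} \<union> diamond_edges a b c d" for e
    using assms(2) that unfolding diamond_edges_def by simp metis
  then show ?thesis
    using assms(1) unfolding loopless_def insert_diamond_def by blast
qed

lemma emb_insert_diamond:
  assumes "emb n E" "finite E" "loopless E" "{u, v} \<in> E"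
    and dist: "distinct [a, b, c, d]" and fresh: "{a, b, c, d} \<inter> \<Union>E = {}"
  shows "emb n (insert_diamond E u v a b c d)"
proof -
  obtain \<rho> where \<rho>: "rotation_system UNIV E \<rho>" "ncyc (darts E) (face_perm \<rho>) \<le> n"
    using assms(1) unfolding emb_def by blast
  let ?E = "insert_diamond E u v a b c d"
  note finD = finite_darts[OF assms(2,3)]
  have finD': "finite (darts ?E)"
    using finite_darts finite_insert_diamond loopless_insert_diamond assms by metis
  have nuv: "u \<notin> {a, b, c, d}" "v \<notin> {a, b, c, d}" using assms(4) fresh by auto
  have "u \<noteq> v" using assms(3,4) unfolding loopless_def by fastforce
  have ne: "a \<noteq> b" "a \<noteq> c" "a \<noteq> d" "b \<noteq> c" "b \<noteq> d" "c \<noteq> d" "u \<noteq> a" "u \<noteq> b" "u \<noteq> c" "u \<noteq> d"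
    "v \<noteq> a" "v \<noteq> b" "v \<noteq> c" "v \<noteq> d" "u \<noteq> v"
    using dist nuv \<open>u \<noteq> v\<close> by auto
  note ne = ne ne[symmetric]
  have D: "fst x \<notin> {a, b, c, d} \<and> snd x \<notin> {a, b, c, d}" if "x \<in> darts E" for x
    using that fresh by (auto simp: darts_def)
  have uvD: "(u, v) \<in> darts E" "(v, u) \<in> darts E" using assms(4) by (auto simp: darts_def insert_commute)
  \<comment> \<open>The rotation at the new vertices is chosen so that \<open>uv\<close> becomes the walk \<open>u a b c d v\<close> and \<open>vu\<close> the
    walk \<open>v d b a c b d c a u\<close>; together they traverse every new dart once.\<close>
  define r where "r x = (if x = (u, v) then (u, a) else if x = (v, u) then (v, d) else x)" for x
  define r' where "r' x = (if x = (u, a) then (u, v) else if x = (v, d) then (v, u) else x)" for x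
  define \<rho>' where "\<rho>' x =
     (if x = (a, u) then (a, b) else if x = (a, b) then (a, c) else if x = (a, c) then (a, u)
      else if x = (b, a) then (b, c) else if x = (b, c) then (b, d) else if x = (b, d) then (b, a)
      else if x = (c, a) then (c, b) else if x = (c, b) then (c, d) else if x = (c, d) then (c, a)
      else if x = (d, v) then (d, b) else if x = (d, b) then (d, c) else if x = (d, c) then (d, v)
      else r (\<rho> (r' x)))" for x
  let ?N = "{(a, u), (a, b), (a, c), (b, a), (b, c), (b, d), (c, a), (c, b), (c, d), (d, v), (d, b), (d, c)}"
  \<comment> \<open>\<open>r\<close> renames the two darts of the removed edge to the darts that now
    leave \<open>u\<close> and \<open>v\<close>; at the old vertices the new rotation is the old one
    up to this renaming.\<close>
  have r'r: "r' (r x) = x" if "x \<in> darts E" for x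
    using D[OF that] ne by (auto simp: r_def r'_def)
  have fr: "fst (r x) = fst x" for x by (auto simp: r_def)
  have rN: "r x \<notin> ?N" if "x \<in> darts E" for x
    using D[OF that] fr[of x] by (cases "r x") auto
  have dE: "darts ?E = r ` darts E \<union> ?N"
  proof -
    have 1: "darts ?E = (darts E - {(u, v), (v, u)}) \<union> {(u, a), (v, d)} \<union> ?N"
      unfolding insert_diamond_def diamond_edges_def
      by (simp only: darts_Un darts_insert darts_Diff_edge darts_empty
          Un_insert_left Un_insert_right Un_empty_left Un_empty_right insert_commute)
    have 2: "r ` darts E = (darts E - {(u, v), (v, u)}) \<union> {(u, a), (v, d)}"
    proof -
      have "r ` (darts E - {(u, v), (v, u)}) = darts E - {(u, v), (v, u)}"
        by (rule trans[OF image_cong image_ident]) (auto simp: r_def)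
      moreover have "darts E = (darts E - {(u, v), (v, u)}) \<union> {(u, v), (v, u)}" using uvD by auto
      moreover have "r ` {(u, v), (v, u)} = {(u, a), (v, d)}" using \<open>u \<noteq> v\<close> by (auto simp: r_def)
      ultimately show ?thesis by (metis image_Un)
    qed
    show ?thesis unfolding 1 2 by blast
  qed
  have \<rho>D: "\<rho> x \<in> darts E" "fst (\<rho> x) = fst x" if "x \<in> darts E" for x
    using that \<rho>(1) by (auto simp: rotation_system_def bij_betw_def)
  have \<rho>'r: "\<rho>' (r x) = r (\<rho> x)" if "x \<in> darts E" for x
    using rN[OF that] r'r[OF that] unfolding \<rho>'_def by simp
  have iter: "(\<rho>' ^^ k) (r x) = r ((\<rho> ^^ k) x) \<and> (\<rho> ^^ k) x \<in> darts E" if "x \<in> darts E" for k x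
    by (induction k) (use that \<rho>D \<rho>'r in auto)
  have rotN: "\<rho>' (a, u) = (a, b)" "\<rho>' (a, b) = (a, c)" "\<rho>' (a, c) = (a, u)"
    "\<rho>' (b, a) = (b, c)" "\<rho>' (b, c) = (b, d)" "\<rho>' (b, d) = (b, a)"
    "\<rho>' (c, a) = (c, b)" "\<rho>' (c, b) = (c, d)" "\<rho>' (c, d) = (c, a)"
    "\<rho>' (d, v) = (d, b)" "\<rho>' (d, b) = (d, c)" "\<rho>' (d, c) = (d, v)"
    using ne by (simp_all add: \<rho>'_def)
  have cyc3: "\<exists>n. (f ^^ n) x = y" if "f p = q" "f q = s" "f s = p" "x \<in> {p, q, s}" "y \<in> {p, q, s}"
    for f :: "'b \<Rightarrow> 'b" and p q s x y
  proof -
    have "(f ^^ 0) x = x" "(f ^^ 1) x = f x" "(f ^^ 2) x = f (f x)" by (simp_all add: numeral_2_eq_2)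
    then show ?thesis using that by (auto; metis)
  qed
  have rot: "rotation_system UNIV ?E \<rho>'"
  proof (rule rotation_systemI[OF finD'])
    show "\<rho>' x \<in> darts ?E \<and> fst (\<rho>' x) = fst x" if x: "x \<in> darts ?E" for x
    proof (cases "x \<in> ?N")
      case True
      then show ?thesis unfolding dE by (auto simp: rotN)
    next
      case False
      then obtain y where "y \<in> darts E" "x = r y" using x unfolding dE by auto
      then show ?thesis unfolding dE using \<rho>D \<rho>'r fr by auto
    qed
    fix x y assume xy: "x \<in> darts ?E" "y \<in> darts ?E" "fst x = fst y"
    have N: "z \<in> ?N \<longleftrightarrow> fst z \<in> {a, b, c, d}" if "z \<in> darts ?E" for z
      using that D fr unfolding dE by (auto, (metis fst_conv)+)
    show "\<exists>n. (\<rho>' ^^ n) x = y"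
    proof (cases "x \<in> ?N")
      case True
      then have "y \<in> ?N" using N xy by metis
      have NX: "z \<in> {(a, u), (a, b), (a, c)} \<and> fst z = a \<or> z \<in> {(b, a), (b, c), (b, d)} \<and> fst z = b \<or>
        z \<in> {(c, a), (c, b), (c, d)} \<and> fst z = c \<or> z \<in> {(d, v), (d, b), (d, c)} \<and> fst z = d"
        if "z \<in> ?N" for z using that by (elim insertE emptyE) simp_all
      note NY = NX[OF \<open>y \<in> ?N\<close>]
      from NX[OF True] show ?thesis
      proof (elim disjE conjE)
        assume "x \<in> {(a, u), (a, b), (a, c)}" "fst x = a"
        then show ?thesis using cyc3[OF rotN(1-3), of x y] NY xy(3) ne by metis
      next
        assume "x \<in> {(b, a), (b, c), (b, d)}" "fst x = b"
        then show ?thesis using cyc3[OF rotN(4-6), of x y] NY xy(3) ne by metis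
      next
        assume "x \<in> {(c, a), (c, b), (c, d)}" "fst x = c"
        then show ?thesis using cyc3[OF rotN(7-9), of x y] NY xy(3) ne by metis
      next
        assume "x \<in> {(d, v), (d, b), (d, c)}" "fst x = d"
        then show ?thesis using cyc3[OF rotN(10-12), of x y] NY xy(3) ne by metis
      qed
    next
      case False
      then have "y \<notin> ?N" using N xy by metis
      then obtain x' y' where "x' \<in> darts E" "x = r x'" "y' \<in> darts E" "y = r y'"
        using False xy unfolding dE by auto
      moreover from this obtain k where "(\<rho> ^^ k) x' = y'"
        using \<rho>(1) xy(3) fr unfolding rotation_system_def by metis
      ultimately show ?thesis using iter by metis
    qed
  qed
  define \<phi> where "\<phi> = face_perm \<rho>'"
  have f: "\<phi> (x, y) = \<rho>' (y, x)" for x y by (simp add: \<phi>_def face_perm_def)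
  have p1: "\<phi> (u, a) = (a, b)" "\<phi> (a, b) = (b, c)" "\<phi> (b, c) = (c, d)" "\<phi> (c, d) = (d, v)"
    by (simp_all add: f rotN)
  have p2: "\<phi> (v, d) = (d, b)" "\<phi> (d, b) = (b, a)" "\<phi> (b, a) = (a, c)" "\<phi> (a, c) = (c, b)"
    "\<phi> (c, b) = (b, d)" "\<phi> (b, d) = (d, c)" "\<phi> (d, c) = (c, a)" "\<phi> (c, a) = (a, u)"
    by (simp_all add: f rotN)
  have st: "(\<phi> ^^ m) x = y \<Longrightarrow> \<phi> y = z \<Longrightarrow> (\<phi> ^^ Suc m) x = z" for m x y z by simp
  have q1: "(\<phi> ^^ 1) (u, a) = (a, b)" using p1 by simp
  note q2 = st[OF q1 p1(2)] note q3 = st[OF q2 p1(3)] note q4 = st[OF q3 p1(4)]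
  have s1: "(\<phi> ^^ 1) (v, d) = (d, b)" using p2 by simp
  note s2 = st[OF s1 p2(2)] note s3 = st[OF s2 p2(3)] note s4 = st[OF s3 p2(4)] note s5 = st[OF s4 p2(5)]
  note s6 = st[OF s5 p2(6)] note s7 = st[OF s6 p2(7)] note s8 = st[OF s7 p2(8)]
  have ruv: "r (u, v) = (u, a)" "r (v, u) = (v, d)" using \<open>u \<noteq> v\<close> by (auto simp: r_def)
  have \<rho>'uv: "\<rho>' (u, a) = r (\<rho> (u, v))" "\<rho>' (v, d) = r (\<rho> (v, u))"
    using \<rho>'r uvD ruv by metis+
  show ?thesis
  proof (rule emb_transport[OF \<rho> finD rot finD'])
    show "r x \<in> darts ?E" if "x \<in> darts E" for x using that unfolding dE by auto
    show "\<exists>m. (face_perm \<rho>' ^^ m) (r x) = r (face_perm \<rho> x)" if x: "x \<in> darts E" for x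
    proof -
      consider "x = (u, v)" | "x = (v, u)" | "x \<noteq> (u, v)" "x \<noteq> (v, u)" by auto
      then show ?thesis
      proof cases
        case 1
        \<comment> \<open>Four steps lead from \<open>(u, a)\<close> through the diamond to
          \<open>(d, v)\<close>, and the fifth leaves \<open>v\<close> as the old face did after
          \<open>(u, v)\<close>. In the other direction eight steps cross the diamond and the ninth
          leaves \<open>u\<close>.\<close>
        then have "(\<phi> ^^ Suc (Suc (Suc (Suc 1)))) (r x) = r (face_perm \<rho> x)"
          using st[OF q4, of "r (\<rho> (v, u))"] \<rho>'uv by (simp add: f ruv face_perm_def del: funpow.simps)
        then show ?thesis unfolding \<phi>_def by blast
      next
        case 2
        then have "\<exists>m. (\<phi> ^^ m) (r x) = r (face_perm \<rho> x)"
          using st[OF s8, of "r (\<rho> (u, v))"] \<rho>'uv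
          by (auto simp: f ruv face_perm_def simp del: funpow.simps)
        then show ?thesis unfolding \<phi>_def .
      next
        case 3
        obtain y z where yz: "x = (y, z)" by (cases x)
        have "(z, y) \<in> darts E" using x yz by (auto simp: darts_def insert_commute)
        moreover have "(y, z) \<noteq> (u, v)" "(y, z) \<noteq> (v, u)" using 3 yz by simp_all
        then have "r (z, y) = (z, y)" "r x = (y, z)" unfolding r_def yz by (metis prod.inject)+
        ultimately have "(\<phi> ^^ 1) (r x) = r (face_perm \<rho> x)"
          using \<rho>'r[of "(z, y)"] yz by (simp add: f face_perm_def)
        then show ?thesis unfolding \<phi>_def by blast
      qed
    qed
    fix y assume "y \<in> darts ?E"
    then consider x where "x \<in> darts E" "y = r x" | "y \<in> ?N" unfolding dE by auto
    then show "\<exists>x\<in>darts E. \<exists>m. (face_perm \<rho>' ^^ m) (r x) = y"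
    proof cases
      case 1
      then show ?thesis by (intro bexI[of _ x] exI[of _ 0]) auto
    next
      case 2
      define R where "R x y \<longleftrightarrow> (\<exists>m. (\<phi> ^^ m) x = y)" for x y
      have "R (u, a) (a, b)" "R (u, a) (b, c)" "R (u, a) (c, d)" "R (u, a) (d, v)"
        "R (v, d) (d, b)" "R (v, d) (b, a)" "R (v, d) (a, c)" "R (v, d) (c, b)"
        "R (v, d) (b, d)" "R (v, d) (d, c)" "R (v, d) (c, a)" "R (v, d) (a, u)"
        unfolding R_def by (rule exI, rule q1 q2 q3 q4 s1 s2 s3 s4 s5 s6 s7 s8)+
      then have "R (u, a) y \<or> R (v, d) y"
        using 2 by (elim insertE emptyE) simp_all
      then have "(\<exists>m. (\<phi> ^^ m) (r (u, v)) = y) \<or> (\<exists>m. (\<phi> ^^ m) (r (v, u)) = y)"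
        unfolding ruv R_def .
      then show ?thesis unfolding \<phi>_def using uvD by blast
    qed
  qed
qed

section \<open>Certificates for explicit embeddings\<close>

definition walk_darts :: "'a list \<Rightarrow> ('a \<times> 'a) list" where
  "walk_darts w = zip w (rotate1 w)"

text \<open>The successor of each dart along its closed walk, that is, the face permutation; the
  rotation is recovered from it by reversing the dart first.\<close>

definition face_table :: "'a list list \<Rightarrow> (('a \<times> 'a) \<times> ('a \<times> 'a)) list" where
  "face_table ws = concat (map (\<lambda>w. zip (walk_darts w) (rotate1 (walk_darts w))) ws)"

text \<open>Darts on no walk are fixed merely as a default: \<open>face_check\<close> requires every
  dart of the graph to lie on some walk.\<close>

definition face_step :: "(('a \<times> 'a) \<times> ('a \<times> 'a)) list \<Rightarrow> 'a \<times> 'a \<Rightarrow> 'a \<times> 'a" where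
  "face_step ps d = (case map_of ps d of None \<Rightarrow> d | Some d' \<Rightarrow> d')"

text \<open>The faces are given as closed walks. Looking at two rotation steps only is enough because
  all degrees are at most 3.\<close>

definition face_check :: "('a \<times> 'a) list \<Rightarrow> 'a list list \<Rightarrow> bool" where
  "face_check es ws \<longleftrightarrow>
     (let ds = es @ map (\<lambda>(a, b). (b, a)) es; f = face_step (face_table ws); r = (\<lambda>d. f (snd d, fst d)) in
       list_all (\<lambda>(a, b). a \<noteq> b) es \<and>
       list_all (\<lambda>d. fst (f d) = snd d \<and> f d \<in> set ds) ds \<and>
       list_all (\<lambda>d. list_all (\<lambda>d'. d' = d \<or> d' = r d \<or> d' = r (r d))
           (filter (\<lambda>d'. fst d' = fst d) ds)) ds \<and>
       list_all (\<lambda>w. w \<noteq> [] \<and> hd (walk_darts w) \<in> set ds \<and>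
         list_all (\<lambda>(d, d'). f d = d') (zip (walk_darts w) (tl (walk_darts w)))) ws \<and>
       list_all (\<lambda>d. list_ex (\<lambda>w. d \<in> set (walk_darts w)) ws) ds)"

lemma funpow_walk:
  assumes "list_all (\<lambda>(d, d'). f d = d') (zip w (tl w))" "d \<in> set w"
  shows "\<exists>m. (f ^^ m) (hd w) = d"
  using assms
proof (induction w)
  case (Cons x w)
  show ?case
  proof (cases "d = x")
    case True
    then show ?thesis by (intro exI[of _ 0]) simp
  next
    case False
    then obtain y w' where w: "w = y # w'" using Cons.prems by (cases w) auto
    then have "f x = y" "list_all (\<lambda>(d, d'). f d = d') (zip w (tl w))" using Cons.prems(1) by auto
    moreover obtain m where "(f ^^ m) (hd w) = d" using Cons.IH calculation Cons.prems(2) False by auto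
    ultimately have "(f ^^ Suc m) (hd (x # w)) = d" using w by (simp add: funpow_swap1)
    then show ?thesis by blast
  qed
qed simp

text \<open>The face permutation runs along each walk from its first dart, and the walks cover all
  darts; so the first darts represent all faces, one per walk.\<close>

lemma emb_face_check:
  fixes es :: "('a \<times> 'a) list"
  assumes "face_check es ws"
  shows "emb (length ws) ((\<lambda>(a, b). {a, b}) ` set es)" "loopless ((\<lambda>(a, b). {a, b}) ` set es)"
proof -
  let ?E = "(\<lambda>(a, b). {a, b}) ` set es" and ?f = "face_step (face_table ws)"
  let ?ds = "es @ map (\<lambda>(a, b). (b, a)) es" and ?r = "\<lambda>d. face_step (face_table ws) (snd d, fst d)"
  note c0 = assms[unfolded face_check_def Let_def list_all_iff list_ex_iff]
  note c = conjunct1[OF c0] conjunct1[OF conjunct2[OF c0]] conjunct1[OF conjunct2[OF conjunct2[OF c0]]]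
    conjunct1[OF conjunct2[OF conjunct2[OF conjunct2[OF c0]]]]
    conjunct2[OF conjunct2[OF conjunct2[OF conjunct2[OF c0]]]]
  show ll: "loopless ?E" using c(1) unfolding loopless_def by fastforce
  have dE: "darts ?E = set ?ds"
    unfolding darts_def by (auto simp: doubleton_eq_iff image_iff split: prod.splits; force)
  have finD: "finite (darts ?E)" unfolding dE by simp
  have flip: "(snd d, fst d) \<in> set ?ds" if "d \<in> set ?ds" for d
    using that unfolding dE[symmetric] by (auto simp: darts_def insert_commute)
  have rot: "rotation_system UNIV ?E ?r"
  proof (rule rotation_systemI[OF finD])
    fix d assume "d \<in> darts ?E"
    then have "(snd d, fst d) \<in> set ?ds" using flip dE by blast
    then show "?r d \<in> darts ?E \<and> fst (?r d) = fst d" using c(2) unfolding dE by (metis snd_conv)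
  next
    fix d d' assume d: "d \<in> darts ?E" "d' \<in> darts ?E" "fst d = fst d'"
    then have "d' \<in> set (filter (\<lambda>d'. fst d' = fst d) ?ds)" unfolding dE set_filter by auto
    from bspec[OF bspec[OF c(3) d(1)[unfolded dE]] this]
    have "d' = d \<or> d' = ?r d \<or> d' = ?r (?r d)" .
    moreover have "(?r ^^ 0) d = d" "(?r ^^ 1) d = ?r d" "(?r ^^ 2) d = ?r (?r d)"
      by (simp_all add: numeral_2_eq_2)
    ultimately show "\<exists>n. (?r ^^ n) d = d'" by metis
  qed
  have fp: "face_perm ?r = ?f" by (auto simp: face_perm_def fun_eq_iff)
  have "ncyc (darts ?E) (face_perm ?r) \<le> length ws"
  proof (rule ncyc_le_cover)
    let ?S = "set (map (\<lambda>w. hd (walk_darts w)) ws)"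
    show "finite ?S" by simp
    show "card ?S \<le> length ws" using card_length[of "map (\<lambda>w. hd (walk_darts w)) ws"] by simp
    show "?S \<subseteq> darts ?E" unfolding dE set_map using c(4) by blast
    fix d assume "d \<in> darts ?E"
    from bspec[OF c(5) this[unfolded dE]] obtain w where w: "w \<in> set ws" "d \<in> set (walk_darts w)" ..
    have "\<exists>m. (?f ^^ m) (hd (walk_darts w)) = d"
      by (rule funpow_walk[OF _ w(2)]) (use bspec[OF c(4) w(1)] in \<open>simp add: list_all_iff\<close>)
    then show "\<exists>s\<in>?S. \<exists>m. (face_perm ?r ^^ m) s = d" unfolding fp using w(1) by auto
  qed (use face_perm_bij[OF rot] finD in auto)
  then show "emb (length ws) ?E" using rot unfolding emb_def by blast
qed

definition end_label :: "(nat \<Rightarrow> nat \<times> nat) \<Rightarrow> nat \<Rightarrow> nat" where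
  "end_label B a = endpt B (a div 2) (a mod 2)"

text \<open>The natural number \<open>2j + s\<close> stands for the vertex \<open>Tri j s\<close>.\<close>

definition base_edges :: "(nat \<Rightarrow> nat \<times> nat) \<Rightarrow> nat list \<Rightarrow> (nat \<times> nat) list" where
  "base_edges B R = filter (\<lambda>(a, b). a < b \<and> a \<notin> set R \<and> b \<notin> set R \<and>
     (end_label B a = end_label B b \<or> even a \<and> b = Suc a)) (List.product [0..<12] [0..<12])"

text \<open>The walks below were found by exhaustive search over the rotation systems.\<close>

lemma face_check_K4_base:
  "face_check (base_edges K4_base []) [[0, 1, 6, 8, 9, 5, 11, 9, 8, 1, 0, 2, 4, 5, 9, 11, 10, 3, 2, 0, 4, 2, 3, 7, 10, 11, 5, 4], [1, 8, 6, 7, 3, 10, 7, 6]]"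
  by code_simp

text \<open>Without the two ends of a base edge, 10 vertices and 13 edges remain; the single walk
  passes through all 26 darts. The certificates for the other base edges have the same
  shape.\<close>

lemma face_check_K4_base_0:
  "face_check (base_edges K4_base [0, 1]) [[2, 3, 7, 10, 11, 9, 8, 6, 7, 3, 10, 7, 6, 8, 9, 5, 11, 10, 3, 2, 4, 5, 9, 11, 5, 4]]"
  by code_simp

lemma face_check_K4_base_1:
  "face_check (base_edges K4_base [2, 3]) [[0, 1, 6, 8, 9, 5, 11, 9, 8, 1, 0, 4, 5, 9, 11, 10, 7, 6, 1, 8, 6, 7, 10, 11, 5, 4]]"
  by code_simp

lemma face_check_K4_base_2:
  "face_check (base_edges K4_base [4, 5]) [[0, 1, 6, 8, 9, 11, 10, 7, 6, 1, 8, 6, 7, 3, 10, 11, 9, 8, 1, 0, 2, 3, 7, 10, 3, 2]]"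
  by code_simp

lemma face_check_K4_base_3:
  "face_check (base_edges K4_base [6, 7]) [[0, 1, 8, 9, 5, 11, 9, 8, 1, 0, 2, 4, 5, 9, 11, 10, 3, 2, 0, 4, 2, 3, 10, 11, 5, 4]]"
  by code_simp

lemma face_check_K4_base_4:
  "face_check (base_edges K4_base [8, 9]) [[0, 1, 6, 7, 3, 10, 7, 6, 1, 0, 2, 4, 5, 11, 10, 3, 2, 0, 4, 2, 3, 7, 10, 11, 5, 4]]"
  by code_simp

lemma face_check_K4_base_5:
  "face_check (base_edges K4_base [10, 11]) [[0, 1, 6, 8, 1, 0, 2, 4, 5, 9, 8, 6, 7, 3, 2, 0, 4, 2, 3, 7, 6, 1, 8, 9, 5, 4]]"
  by code_simp

lemma face_check_L4_base:
  "face_check (base_edges L4_base []) [[0, 1, 3, 4, 5, 6, 8, 9, 7, 10, 9, 8, 5, 4, 1, 0, 2, 11, 10, 7, 6, 5, 8, 6, 7, 9, 10, 11], [0, 11, 2, 3, 1, 4, 3, 2]]"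
  by code_simp

lemma face_check_L4_base_0:
  "face_check (base_edges L4_base [0, 1]) [[2, 3, 4, 5, 6, 8, 9, 7, 10, 9, 8, 5, 4, 3, 2, 11, 10, 7, 6, 5, 8, 6, 7, 9, 10, 11]]"
  by code_simp

lemma face_check_L4_base_1:
  "face_check (base_edges L4_base [2, 3]) [[0, 1, 4, 5, 6, 8, 9, 7, 10, 9, 8, 5, 4, 1, 0, 11, 10, 7, 6, 5, 8, 6, 7, 9, 10, 11]]"
  by code_simp

lemma face_check_L4_base_2:
  "face_check (base_edges L4_base [4, 5]) [[0, 1, 3, 2, 0, 11, 2, 3, 1, 0, 2, 11, 10, 7, 6, 8, 9, 7, 10, 9, 8, 6, 7, 9, 10, 11]]"
  by code_simp

lemma face_check_L4_base_3:
  "face_check (base_edges L4_base [6, 7]) [[0, 1, 3, 4, 5, 8, 9, 10, 11, 2, 3, 1, 4, 3, 2, 0, 11, 10, 9, 8, 5, 4, 1, 0, 2, 11]]"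
  by code_simp

lemma face_check_L4_base_4:
  "face_check (base_edges L4_base [8, 9]) [[0, 1, 3, 4, 5, 6, 7, 10, 11, 2, 3, 1, 4, 3, 2, 0, 11, 10, 7, 6, 5, 4, 1, 0, 2, 11]]"
  by code_simp

lemma face_check_L4_base_5:
  "face_check (base_edges L4_base [10, 11]) [[0, 1, 3, 4, 5, 6, 8, 9, 7, 6, 5, 8, 6, 7, 9, 8, 5, 4, 1, 0, 2, 3, 1, 4, 3, 2]]"
  by code_simp

abbreviation base_graph :: "(nat \<Rightarrow> nat \<times> nat) \<Rightarrow> nat list \<Rightarrow> nat set set" where
  "base_graph B R \<equiv> (\<lambda>(a, b). {a, b}) ` set (base_edges B R)"

lemma emb_base_graph:
  assumes "B \<in> {K4_base, L4_base}"
  shows "emb 2 (base_graph B [])"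
  using assms emb_face_check(1)[OF face_check_K4_base] emb_face_check(1)[OF face_check_L4_base]
  by (auto simp: numeral_2_eq_2)

lemma emb_base_graph_removed:
  assumes "B \<in> {K4_base, L4_base}" "j < 6"
  shows "emb 1 (base_graph B [2 * j, Suc (2 * j)])"
proof -
  have j: "j = 0 \<or> j = 1 \<or> j = 2 \<or> j = 3 \<or> j = 4 \<or> j = 5" using assms(2) by linarith
  have "emb 1 (base_graph K4_base [2 * j, Suc (2 * j)])"
    using j emb_face_check(1)[OF face_check_K4_base_0] emb_face_check(1)[OF face_check_K4_base_1]
      emb_face_check(1)[OF face_check_K4_base_2] emb_face_check(1)[OF face_check_K4_base_3]
      emb_face_check(1)[OF face_check_K4_base_4] emb_face_check(1)[OF face_check_K4_base_5]
    by (elim disjE) (simp_all del: One_nat_def add: One_nat_def[symmetric])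
  moreover have "emb 1 (base_graph L4_base [2 * j, Suc (2 * j)])"
    using j emb_face_check(1)[OF face_check_L4_base_0] emb_face_check(1)[OF face_check_L4_base_1]
      emb_face_check(1)[OF face_check_L4_base_2] emb_face_check(1)[OF face_check_L4_base_3]
      emb_face_check(1)[OF face_check_L4_base_4] emb_face_check(1)[OF face_check_L4_base_5]
    by (elim disjE) (simp_all del: One_nat_def add: One_nat_def[symmetric])
  ultimately show ?thesis using assms(1) by auto
qed

section \<open>Triangles joined by strings of diamonds\<close>

text \<open>Unlike \<^const>\<open>FE\<close>, the edge set \<open>GE\<close> is meaningful for empty strings: the \<open>i\<close>-th edge joining the units
  along base edge \<open>j\<close> runs from \<open>lport j i\<close> to \<open>rport k j i\<close>, for \<open>i \<le> k j\<close>.\<close>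

definition lport :: "nat \<Rightarrow> nat \<Rightarrow> fvert" where
  "lport j i = (case i of 0 \<Rightarrow> Tri j 0 | Suc m \<Rightarrow> Dia j m 3)"

definition rport :: "(nat \<Rightarrow> nat) \<Rightarrow> nat \<Rightarrow> nat \<Rightarrow> fvert" where
  "rport k j i = (if i < k j then Dia j i 0 else Tri j 1)"

definition tri_edges :: "(nat \<Rightarrow> nat \<times> nat) \<Rightarrow> fvert set set" where
  "tri_edges B = {{Tri j s, Tri j' s'} | j s j' s'. j < 6 \<and> s < 2 \<and> j' < 6 \<and> s' < 2 \<and> (j, s) \<noteq> (j', s') \<and>
                              endpt B j s = endpt B j' s'}"

definition dia_edges :: "nat \<Rightarrow> nat \<Rightarrow> fvert set set" where
  "dia_edges j i = diamond_edges (Dia j i 0) (Dia j i 1) (Dia j i 2) (Dia j i 3)"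

definition conn :: "(nat \<Rightarrow> nat) \<Rightarrow> nat \<Rightarrow> nat \<Rightarrow> fvert set" where
  "conn k j i = {lport j i, rport k j i}"

definition GE :: "(nat \<Rightarrow> nat \<times> nat) \<Rightarrow> (nat \<Rightarrow> nat) \<Rightarrow> fvert set set" where
  "GE B k = tri_edges B \<union> (\<Union>j<6. \<Union>i<k j. dia_edges j i) \<union> {conn k j i | j i. j < 6 \<and> i \<le> k j}"

text \<open>The connecting edges with \<open>i = 0\<close>, with \<open>0 < i < k j\<close> and with
  \<open>i = k j\<close> are the last three families in \<open>FE\<close>. For an empty string
  \<open>FE\<close> would mention vertices of a diamond that does not exist, hence the
  hypothesis.\<close>

lemma FE_eq_GE:
  assumes "\<forall>j<6. k j \<ge> 1"
  shows "FE B k = GE B k"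
proof -
  have 1: "{{Dia j i a, Dia j i b} | j i a b. j < 6 \<and> i < k j \<and>
       (a, b) \<in> {(0,1),(0,2),(1,2),(1,3),(2,3)}} = (\<Union>j<6. \<Union>i<k j. dia_edges j i)"
    unfolding dia_edges_def diamond_edges_def by blast
  have 2: "{conn k j i | j i. j < 6 \<and> i \<le> k j} = {{Tri j 0, Dia j 0 0} | j. j < 6}
   \<union> {{Dia j i 3, Dia j (Suc i) 0} | j i. j < 6 \<and> Suc i < k j}
   \<union> {{Dia j (k j - 1) 3, Tri j 1} | j. j < 6}" (is "?L = ?A \<union> ?B \<union> ?C")
  proof (intro equalityI subsetI)
    fix e assume "e \<in> ?L"
    then obtain j i where ji: "e = conn k j i" "j < 6" "i \<le> k j" by blast
    have "k j \<ge> 1" using assms ji by simp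
    show "e \<in> ?A \<union> ?B \<union> ?C"
    proof (cases i)
      case 0
      then have "e = {Tri j 0, Dia j 0 0}" using ji \<open>k j \<ge> 1\<close> by (simp add: conn_def lport_def rport_def)
      then show ?thesis using ji by blast
    next
      case (Suc m)
      show ?thesis
      proof (cases "Suc m < k j")
        case True
        then have "e = {Dia j m 3, Dia j (Suc m) 0}" using ji Suc by (simp add: conn_def lport_def rport_def)
        then show ?thesis using ji True by blast
      next
        case False
        then have "k j - 1 = m" "\<not> i < k j" using ji Suc by linarith+
        then have "e = {Dia j (k j - 1) 3, Tri j 1}" using ji Suc by (simp add: conn_def lport_def rport_def)
        then show ?thesis using ji by blast
      qed
    qed
  next
    fix e assume "e \<in> ?A \<union> ?B \<union> ?C"
    then consider j where "j < 6" "e = {Tri j 0, Dia j 0 0}"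
      | j i where "j < 6" "Suc i < k j" "e = {Dia j i 3, Dia j (Suc i) 0}"
      | j where "j < 6" "e = {Dia j (k j - 1) 3, Tri j 1}" by blast
    then show "e \<in> ?L"
    proof cases
      case 1
      then have "e = conn k j 0" using assms by (auto simp: conn_def lport_def rport_def)
      then show ?thesis using 1 by blast
    next
      case 2
      then have "e = conn k j (Suc i)" "Suc i \<le> k j" by (auto simp: conn_def lport_def rport_def)
      then show ?thesis using 2 by blast
    next
      case 3
      obtain m where "k j = Suc m" using assms 3(1) by (cases "k j") auto
      then have "e = conn k j (k j)" using 3 by (simp add: conn_def lport_def rport_def)
      then show ?thesis using 3 by blast
    qed
  qed
  show ?thesis unfolding FE_def GE_def 1[symmetric] 2 tri_edges_def by (simp only: Un_assoc)
qed

lemma mem_FV [simp]: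
  "Tri j s \<in> FV k \<longleftrightarrow> j < 6 \<and> s < 2"
  "Dia j i l \<in> FV k \<longleftrightarrow> j < 6 \<and> i < k j \<and> l < 4"
  by (auto simp: FV_def)

lemma lport_in_FV: "j < 6 \<Longrightarrow> i \<le> k j \<Longrightarrow> lport j i \<in> FV k"
  by (cases i) (auto simp: lport_def FV_def)

lemma rport_in_FV: "j < 6 \<Longrightarrow> rport k j i \<in> FV k"
  by (auto simp: rport_def FV_def)

lemma tri_edges_subset: "e \<in> tri_edges B \<Longrightarrow> e \<subseteq> {Tri j s | j s. j < 6 \<and> s < 2}"
  unfolding tri_edges_def by blast

lemma dia_edges_subset: "e \<in> dia_edges j i \<Longrightarrow> e \<subseteq> {Dia j i 0, Dia j i 1, Dia j i 2, Dia j i 3}"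
  unfolding dia_edges_def diamond_edges_def by auto

lemma GE_subset: "e \<in> GE B k \<Longrightarrow> e \<subseteq> FV k"
proof -
  assume "e \<in> GE B k"
  then consider "e \<in> tri_edges B" | j i where "j < 6" "i < k j" "e \<in> dia_edges j i"
    | j i where "j < 6" "i \<le> k j" "e = conn k j i" unfolding GE_def by blast
  then show ?thesis
  proof cases
    case 1
    have "{Tri j s | j s. j < 6 \<and> s < 2} \<subseteq> FV k" unfolding FV_def by blast
    then show ?thesis using tri_edges_subset[OF 1] by (rule subset_trans[rotated])
  next
    case 2 then show ?thesis using dia_edges_subset[OF 2(3)] by (auto simp: FV_def)
  next
    case 3 then show ?thesis using lport_in_FV rport_in_FV by (simp add: conn_def)
  qed
qed

lemma finite_FV: "finite (FV k)"
proof -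
  have "FV k = (\<Union>j<6. Tri j ` {..<2}) \<union> (\<Union>j<6. \<Union>i<k j. Dia j i ` {..<4})"
    unfolding FV_def by blast
  then show ?thesis by simp
qed

lemma lport_neq_rport: "lport j i \<noteq> rport k j i"
  by (cases i) (auto simp: lport_def rport_def)

lemma simple_graph_GE: "simple_graph (FV k) (GE B k)"
  unfolding simple_graph_def
proof (intro conjI ballI)
  fix e assume e: "e \<in> GE B k"
  then have "\<exists>x y. x \<noteq> y \<and> e = {x, y}"
  proof -
    consider "e \<in> tri_edges B" | j i where "e \<in> dia_edges j i" | j i where "e = conn k j i"
      using e unfolding GE_def by blast
    then show ?thesis
    proof cases
      case 1
      then obtain j s j' s' where "e = {Tri j s, Tri j' s'}" "(j, s) \<noteq> (j', s')" unfolding tri_edges_def by blast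
      then show ?thesis by (metis fvert.inject(1))
    next
      case 2
      have "Dia j i a \<noteq> Dia j i b" if "a \<noteq> b" for a b using that by simp
      then show ?thesis using 2 unfolding dia_edges_def diamond_edges_def
        by (elim insertE emptyE) (metis zero_neq_one zero_neq_numeral numeral_eq_iff one_eq_numeral_iff num.distinct(1,3,5))+
    next
      case 3 then show ?thesis using lport_neq_rport unfolding conn_def by metis
    qed
  qed
  then show "\<exists>x y. x \<in> FV k \<and> y \<in> FV k \<and> x \<noteq> y \<and> e = {x, y}" using GE_subset[OF e] by blast
qed (rule finite_FV)

section \<open>Relabelling when a string gains a diamond at position \<open>p\<close>\<close>

definition shift :: "nat \<Rightarrow> nat \<Rightarrow> fvert \<Rightarrow> fvert" where
  "shift j p x = (case x of Tri a s \<Rightarrow> Tri a s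
     | Dia a i l \<Rightarrow> if a = j \<and> p \<le> i then Dia a (Suc i) l else Dia a i l)"

lemma shift_simps [simp]:
  "shift j p (Tri a s) = Tri a s"
  "shift j p (Dia a i l) = (if a = j \<and> p \<le> i then Dia a (Suc i) l else Dia a i l)"
  by (simp_all add: shift_def)

lemma inj_shift: "inj (shift j p)"
proof (rule injI)
  fix x y show "shift j p x = shift j p y \<Longrightarrow> x = y"
    by (cases x; cases y) (auto split: if_splits)
qed

lemma shift_tri: "e \<in> tri_edges B \<Longrightarrow> shift j p ` e = e"
  unfolding tri_edges_def by auto

lemma shift_dia: "(`) (shift j p) ` dia_edges j' i = dia_edges j' (if j' = j \<and> p \<le> i then Suc i else i)"
  unfolding dia_edges_def diamond_edges_def by simp

text \<open>Here the index moves for \<open>p < i\<close>, but for right ports already for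
  \<open>p \<le> i\<close>: the \<open>p\<close>-th connecting edge is the one that is cut, its left
  end stays in place, and its right end belongs to the part that moves up.\<close>

lemma shift_lport: "shift j p (lport j' i) = lport j' (if j' = j \<and> p < i then Suc i else i)"
  by (cases i) (auto simp: lport_def)

lemma shift_rport:
  assumes "p \<le> k j"
  shows "shift j p (rport k j' i) = rport (k(j := Suc (k j))) j' (if j' = j \<and> p \<le> i then Suc i else i)"
  using assms by (auto simp: rport_def)

lemma conn_eq_iff: "conn k j i = conn k j' i' \<longleftrightarrow> j = j' \<and> i = i'"
  by (cases i; cases i') (auto simp: conn_def lport_def rport_def doubleton_eq_iff split: if_splits)

lemma conn_notin_dia: "conn k j i \<notin> dia_edges j' i'"
  by (cases i) (auto simp: conn_def lport_def rport_def dia_edges_def diamond_edges_def doubleton_eq_iff)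

lemma conn_notin_tri:
  assumes "\<forall>j<6. endpt B j 0 \<noteq> endpt B j 1"
  shows "conn k j i \<notin> tri_edges B"
proof
  assume "conn k j i \<in> tri_edges B"
  then obtain a s a' s' where e: "conn k j i = {Tri a s, Tri a' s'}" "a < 6" "endpt B a s = endpt B a' s'"
    unfolding tri_edges_def by blast
  then have "{Tri a s, Tri a' s'} = {Tri j 0, Tri j 1}"
    by (cases i) (auto simp: conn_def lport_def rport_def doubleton_eq_iff split: if_splits)
  then show False using assms e by (auto simp: doubleton_eq_iff)
qed

text \<open>All edges other than the \<open>p\<close>-th connecting edge of string \<open>j\<close>
  are only relabelled, and that edge is replaced by the new diamond with its two links. Its ends are
  written as images under \<open>shift\<close>, since the right one may belong to a diamond that
  moves.\<close>

lemma GE_insert: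
  assumes B: "\<forall>j<6. endpt B j 0 \<noteq> endpt B j 1" and j: "j < 6" and p: "p \<le> k j"
  shows "GE B (k(j := Suc (k j))) = insert_diamond ((`) (shift j p) ` GE B k)
    (shift j p (lport j p)) (shift j p (rport k j p)) (Dia j p 0) (Dia j p 1) (Dia j p 2) (Dia j p 3)"
proof -
  let ?k = "k(j := Suc (k j))" and ?\<sigma> = "shift j p"
  have lp: "?\<sigma> (lport j p) = lport j p" and rp: "?\<sigma> (rport k j p) = rport ?k j (Suc p)"
    using shift_lport[of j p j p] shift_rport[of p k j j p, OF p] by auto
  have "?\<sigma> ` conn k j p = {?\<sigma> (lport j p), ?\<sigma> (rport k j p)}" by (simp add: conn_def)
  moreover have "inj ((`) ?\<sigma>)" by (meson injI inj_image_eq_iff inj_shift)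
  ultimately have minus: "(`) ?\<sigma> ` GE B k - {{?\<sigma> (lport j p), ?\<sigma> (rport k j p)}} = (`) ?\<sigma> ` (GE B k - {conn k j p})"
    by (simp add: image_set_diff)
  let ?C = "{conn k j' i | j' i. j' < 6 \<and> i \<le> k j' \<and> (j', i) \<noteq> (j, p)}"
  have rest: "GE B k - {conn k j p} = tri_edges B \<union> (\<Union>j<6. \<Union>i<k j. dia_edges j i) \<union> ?C"
    unfolding GE_def using conn_notin_tri[OF B, of k j p] conn_notin_dia[of k j p] conn_eq_iff[of k] by auto
  have tri: "(`) ?\<sigma> ` tri_edges B = tri_edges B" using shift_tri[of _ B j p] by force
  have dia: "(\<Union>j<6. \<Union>i<?k j. dia_edges j i) = (`) ?\<sigma> ` (\<Union>j<6. \<Union>i<k j. dia_edges j i) \<union> dia_edges j p"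
  proof (intro equalityI subsetI)
    fix e assume "e \<in> (\<Union>j<6. \<Union>i<?k j. dia_edges j i)"
    then obtain j' i where e: "j' < 6" "i < ?k j'" "e \<in> dia_edges j' i" by blast
    show "e \<in> (`) ?\<sigma> ` (\<Union>j<6. \<Union>i<k j. dia_edges j i) \<union> dia_edges j p"
    proof (cases "j' = j \<and> i = p")
      case False
      \<comment> \<open>The position of this diamond before the shift.\<close>
      define i0 where "i0 = (if j' = j \<and> p < i then i - 1 else i)"
      have "i0 < k j'" "dia_edges j' i = (`) ?\<sigma> ` dia_edges j' i0"
        using e(2) False p unfolding shift_dia i0_def by (auto split: if_splits)
      then have "e \<in> (`) ?\<sigma> ` dia_edges j' i0" "i0 < k j'" using e(3) by simp_all
      then show ?thesis using e(1) by (intro UnI1, unfold image_UN) (intro UN_I, auto)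
    next
      case True
      then show ?thesis using e(3) by simp
    qed
  next
    fix e assume "e \<in> (`) ?\<sigma> ` (\<Union>j<6. \<Union>i<k j. dia_edges j i) \<union> dia_edges j p"
    then consider "e \<in> dia_edges j p" | j' i where "j' < 6" "i < k j'" "e \<in> (`) ?\<sigma> ` dia_edges j' i"
      unfolding image_UN by blast
    then show "e \<in> (\<Union>j<6. \<Union>i<?k j. dia_edges j i)"
    proof cases
      case 1
      then show ?thesis using j p by (intro UN_I[of j] UN_I[of p]) auto
    next
      case 2
      then show ?thesis unfolding shift_dia
        by (intro UN_I[of j'] UN_I[of "if j' = j \<and> p \<le> i then Suc i else i"]) auto
    qed
  qed
  have c1: "?\<sigma> ` conn k j' i = conn ?k j' (if j' = j \<and> p < i then Suc i else i)" if "(j', i) \<noteq> (j, p)" for j' i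
    using that shift_lport[of j p j' i] shift_rport[of p k j j' i, OF p] by (auto simp: conn_def)
  have con: "{conn ?k j' i | j' i. j' < 6 \<and> i \<le> ?k j'} =
    (`) ?\<sigma> ` ?C \<union> {{?\<sigma> (lport j p), Dia j p 0}, {Dia j p 3, ?\<sigma> (rport k j p)}}" (is "?L = ?R")
  proof (intro equalityI subsetI)
    fix e assume "e \<in> ?L"
    then obtain j' i where e: "e = conn ?k j' i" "j' < 6" "i \<le> ?k j'" by blast
    consider "j' = j" "i = p" | "j' = j" "i = Suc p" | "j' = j \<longrightarrow> i \<noteq> p \<and> i \<noteq> Suc p" by blast
    then show "e \<in> ?R"
    proof cases
      case 1
      then have "e = {?\<sigma> (lport j p), Dia j p 0}" unfolding lp using e p by (simp add: conn_def rport_def)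
      then show ?thesis by blast
    next
      case 2
      then have "e = {Dia j p 3, ?\<sigma> (rport k j p)}" unfolding rp using e by (simp add: conn_def lport_def)
      then show ?thesis by blast
    next
      case 3
      define i0 where "i0 = (if j' = j \<and> p < i then i - 1 else i)"
      have i0: "(j', i0) \<noteq> (j, p)" "i0 \<le> k j'" "(if j' = j \<and> p < i0 then Suc i0 else i0) = i"
        using e(3) 3 p unfolding i0_def by (auto split: if_splits)
      then have "e = ?\<sigma> ` conn k j' i0" unfolding c1[OF i0(1)] e(1) by simp
      then show ?thesis using i0 e(2) by blast
    qed
  next
    fix e assume "e \<in> ?R"
    then consider j' i where "j' < 6" "i \<le> k j'" "(j', i) \<noteq> (j, p)" "e = ?\<sigma> ` conn k j' i"
      | "e = {?\<sigma> (lport j p), Dia j p 0}" | "e = {Dia j p 3, ?\<sigma> (rport k j p)}" by blast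
    then show "e \<in> ?L"
    proof cases
      case 1
      have "(if j' = j \<and> p < i then Suc i else i) \<le> ?k j'" using 1 by auto
      then show ?thesis unfolding 1(4) c1[OF 1(3)] using 1(1) by blast
    next
      case 2
      then have "e = conn ?k j p" unfolding lp using p by (simp add: conn_def rport_def)
      moreover have "p \<le> ?k j" using p by simp
      ultimately show ?thesis using j by blast
    next
      case 3
      then have "e = conn ?k j (Suc p)" unfolding rp by (simp add: conn_def lport_def)
      moreover have "Suc p \<le> ?k j" using p by simp
      ultimately show ?thesis using j by blast
    qed
  qed
  show ?thesis
    unfolding insert_diamond_def minus rest image_Un tri
    unfolding GE_def dia con dia_edges_def by blast
qed

lemma FV_insert:
  assumes "j < 6" "p \<le> k j"
  shows "FV (k(j := Suc (k j))) = shift j p ` FV k \<union> {Dia j p 0, Dia j p 1, Dia j p 2, Dia j p 3}"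
proof (intro equalityI subsetI)
  fix x assume x: "x \<in> FV (k(j := Suc (k j)))"
  show "x \<in> shift j p ` FV k \<union> {Dia j p 0, Dia j p 1, Dia j p 2, Dia j p 3}"
  proof (cases x)
    case (Tri a s)
    then have "x = shift j p x" "x \<in> FV k" using x by (auto simp: FV_def)
    then show ?thesis by blast
  next
    case (Dia a i l)
    show ?thesis
    proof (cases "a = j \<and> i = p")
      case True
      have "l < 4" using x Dia by (auto simp: FV_def)
      then have "l = 0 \<or> l = 1 \<or> l = 2 \<or> l = 3" by linarith
      then show ?thesis using True Dia by auto
    next
      case False
      define i0 where "i0 = (if a = j \<and> p < i then i - 1 else i)"
      have "Dia a i0 l \<in> FV k" "shift j p (Dia a i0 l) = x"
        using x False Dia assms unfolding i0_def by (auto simp: FV_def split: if_splits)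
      then show ?thesis by blast
    qed
  qed
next
  fix x assume "x \<in> shift j p ` FV k \<union> {Dia j p 0, Dia j p 1, Dia j p 2, Dia j p 3}"
  then consider y where "y \<in> FV k" "x = shift j p y"
    | "x \<in> {Dia j p 0, Dia j p 1, Dia j p 2, Dia j p 3}" by blast
  then show "x \<in> FV (k(j := Suc (k j)))"
  proof cases
    case 1
    then show ?thesis by (cases y) auto
  qed (use assms in auto)
qed

lemma shift_fresh: "Dia j p l \<notin> range (shift j p)"
proof
  assume "Dia j p l \<in> range (shift j p)"
  then obtain x where "Dia j p l = shift j p x" by blast
  then show False by (cases x) (auto split: if_splits)
qed

lemma insert_diamond_swap: "insert_diamond E u v a b c d = insert_diamond E v u d c b a"
  unfolding insert_diamond_def diamond_edges_def by (simp add: insert_commute)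

lemma insert_diamond_image:
  assumes "inj_on f (\<Union>E)" "{u, v} \<in> E"
  shows "(`) f ` insert_diamond E u v a b c d = insert_diamond ((`) f ` E) (f u) (f v) (f a) (f b) (f c) (f d)"
proof -
  have "inj_on ((`) f) E"
  proof (rule inj_onI)
    fix x y assume "x \<in> E" "y \<in> E" "f ` x = f ` y"
    then show "x = y" using assms(1) by (metis Union_upper inj_on_image_eq_iff)
  qed
  then have "(`) f ` (E - {{u, v}}) = (`) f ` E - (`) f ` {{u, v}}"
    using assms(2) by (intro inj_on_image_set_diff) auto
  then show ?thesis by (simp add: insert_diamond_def diamond_edges_def image_Un)
qed

lemma del_verts_insert_diamond:
  assumes "{u, v} \<inter> S = {}" "{a, b, c, d} \<inter> S = {}"
  shows "del_verts_E (insert_diamond E u v a b c d) S = insert_diamond (del_verts_E E S) u v a b c d"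
proof -
  have un: "del_verts_E (X \<union> Y) S = del_verts_E X S \<union> del_verts_E Y S" for X Y :: "'a set set"
    by (auto simp: del_verts_E_def)
  have all: "del_verts_E X S = X" if "\<And>e. e \<in> X \<Longrightarrow> e \<inter> S = {}" for X :: "'a set set"
    using that by (auto simp: del_verts_E_def)
  have "del_verts_E (E - {{u, v}}) S = del_verts_E E S - {{u, v}}"
    by (auto simp: del_verts_E_def)
  moreover have "del_verts_E {{u, a}, {d, v}} S = {{u, a}, {d, v}}"
    by (rule all) (use assms in auto)
  moreover have "del_verts_E (diamond_edges a b c d) S = diamond_edges a b c d"
    by (rule all) (use assms in \<open>auto simp: diamond_edges_def\<close>)
  ultimately show ?thesis unfolding insert_diamond_def un by simp
qed

lemma del_verts_empty [simp]: "del_verts_E E {} = E"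
  by (simp add: del_verts_E_def)

lemma del_verts_image:
  assumes "inj_on f (\<Union>E \<union> S)"
  shows "del_verts_E ((`) f ` E) (f ` S) = (`) f ` del_verts_E E S"
proof -
  have "f ` e \<inter> f ` S = {} \<longleftrightarrow> e \<inter> S = {}" if "e \<in> E" for e
  proof -
    have "f ` (e \<inter> S) = f ` e \<inter> f ` S" using that by (intro inj_on_image_Int[OF assms]) auto
    then show ?thesis by (metis image_is_empty)
  qed
  then show ?thesis unfolding del_verts_E_def by auto
qed

lemma simple_graph_del_verts: "simple_graph V E \<Longrightarrow> simple_graph (V - S) (del_verts_E E S)"
  unfolding simple_graph_def del_verts_E_def by fastforce

definition tri_vert :: "nat \<Rightarrow> fvert" where
  "tri_vert a = Tri (a div 2) (a mod 2)"

lemma inj_tri_vert: "inj tri_vert"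
proof (rule injI)
  fix a b assume "tri_vert a = tri_vert b"
  then have "a div 2 = b div 2" "a mod 2 = b mod 2" by (simp_all add: tri_vert_def)
  then show "a = b" by (metis div_mult_mod_eq)
qed

lemma Tri_eq_tri_vert: "s < 2 \<Longrightarrow> Tri j s = tri_vert (2 * j + s)"
  by (simp add: tri_vert_def)

text \<open>With all strings empty the model is the inflated base graph, whose edges are those of
  the numbered lists on which the certificates are computed.\<close>

lemma GE_zero_base_graph:
  assumes "\<forall>j<6. k j = 0"
  shows "GE B k = (`) tri_vert ` base_graph B []"
proof -
  have g: "GE B k = tri_edges B \<union> {{Tri j 0, Tri j 1} | j. j < 6}"
  proof -
    have "conn k j 0 = {Tri j 0, Tri j 1}" if "j < 6" for j
      using assms that by (simp add: conn_def lport_def rport_def)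
    then have "{conn k j i | j i. j < 6 \<and> i \<le> k j} = {{Tri j 0, Tri j 1} | j. j < 6}"
      using assms by fastforce
    moreover have "(\<Union>j<6. \<Union>i<k j. dia_edges j i) = {}" using assms by simp
    ultimately show ?thesis unfolding GE_def by simp
  qed
  have mem: "tri_vert ` {a, b} \<in> (`) tri_vert ` base_graph B []"
    if "a \<noteq> b" "a < 12" "b < 12" "end_label B a = end_label B b \<or> even (min a b) \<and> max a b = Suc (min a b)" for a b
  proof -
    have "(min a b, max a b) \<in> set (base_edges B [])"
      using that unfolding base_edges_def by (auto simp: min_def max_def split: if_splits)
    moreover have "{a, b} = {min a b, max a b}" by (auto simp: min_def max_def)
    ultimately show ?thesis by (metis (no_types, lifting) case_prod_conv image_eqI)
  qed
  show ?thesis unfolding g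
  proof (intro equalityI subsetI)
    fix e assume "e \<in> tri_edges B \<union> {{Tri j 0, Tri j 1} | j. j < 6}"
    then show "e \<in> (`) tri_vert ` base_graph B []"
    proof
      assume "e \<in> tri_edges B"
      then obtain j s j' s' where e: "e = {Tri j s, Tri j' s'}" "j < 6" "s < 2" "j' < 6" "s' < 2"
        "(j, s) \<noteq> (j', s')" "endpt B j s = endpt B j' s'" unfolding tri_edges_def by blast
      have "e = tri_vert ` {2 * j + s, 2 * j' + s'}" using e by (simp add: Tri_eq_tri_vert)
      moreover have "end_label B (2 * j + s) = end_label B (2 * j' + s')"
        using e by (simp add: end_label_def)
      moreover have "2 * j + s \<noteq> 2 * j' + s'"
        using e Tri_eq_tri_vert by (metis fvert.inject(1))
      ultimately show ?thesis using mem[of "2 * j + s" "2 * j' + s'"] e(2-5) by simp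
    next
      assume "e \<in> {{Tri j 0, Tri j 1} | j. j < 6}"
      then obtain j where "e = {Tri j 0, Tri j 1}" "j < 6" by blast
      then have "e = tri_vert ` {2 * j, Suc (2 * j)}" by (simp add: tri_vert_def)
      then show ?thesis using mem[of "2 * j" "Suc (2 * j)"] \<open>j < 6\<close> by simp
    qed
  next
    fix e assume "e \<in> (`) tri_vert ` base_graph B []"
    then obtain a b where ab: "e = {tri_vert a, tri_vert b}" "a < b" "a < 12" "b < 12"
      "end_label B a = end_label B b \<or> even a \<and> b = Suc a" by (auto simp: base_edges_def)
    show "e \<in> tri_edges B \<union> {{Tri j 0, Tri j 1} | j. j < 6}"
    proof (cases "end_label B a = end_label B b")
      case True
      have "tri_vert a \<noteq> tri_vert b" using ab(2) injD[OF inj_tri_vert] by (metis less_irrefl)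
      then have "(a div 2, a mod 2) \<noteq> (b div 2, b mod 2)" by (auto simp: tri_vert_def)
      moreover have "a div 2 < 6" "b div 2 < 6" "a mod 2 < 2" "b mod 2 < 2" using ab by auto
      ultimately have "e \<in> tri_edges B"
        unfolding tri_edges_def ab(1) tri_vert_def using True unfolding end_label_def by blast
      then show ?thesis ..
    next
      case False
      then obtain j where "a = 2 * j" "b = Suc (2 * j)" using ab by (auto elim: evenE)
      then have "e = {Tri j 0, Tri j 1}" "j < 6" using ab by (auto simp: tri_vert_def)
      then show ?thesis by blast
    qed
  qed
qed

lemma base_graph_removed: "base_graph B R = del_verts_E (base_graph B []) (set R)"
  unfolding base_edges_def del_verts_E_def by force

lemma finite_loopless_base: "finite (base_graph B R)" "loopless (base_graph B R)"
proof -
  show "loopless (base_graph B R)" unfolding loopless_def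
  proof
    fix e assume "e \<in> base_graph B R"
    then obtain a b where "e = {a, b}" "a < b" by (auto simp: base_edges_def)
    then show "\<exists>x y. x \<noteq> y \<and> e = {x, y}" by (intro exI[of _ a] exI[of _ b]) simp
  qed
qed simp

text \<open>Induction on the total number of diamonds. The deleted vertices lie at the ends of empty
  strings, and diamonds are only ever inserted into other strings, so the replaced edge avoids
  \<open>S\<close> and deletion commutes with insertion.\<close>

lemma emb_GE_removed:
  assumes "\<forall>j<6. endpt B j 0 \<noteq> endpt B j 1" "S \<subseteq> {Tri j s | j s. j < 6 \<and> k j = 0}"
    and "\<And>k0. \<forall>j<6. k0 j = 0 \<Longrightarrow> emb n (del_verts_E (GE B k0) S)"
  shows "emb n (del_verts_E (GE B k) S)"
  using assms(2)
proof (induction "\<Sum>j<6. k j" arbitrary: k)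
  case 0
  then show ?case using assms(3) by simp
next
  case (Suc q)
  have "\<exists>j<6. k j \<noteq> 0"
  proof (rule ccontr)
    assume "\<not> (\<exists>j<6. k j \<noteq> 0)"
    then have "(\<Sum>j<6. k j) = 0" by simp
    then show False using Suc(2) by simp
  qed
  then obtain j m where j: "j < 6" "k j = Suc m" by (auto simp: gr0_conv_Suc)
  define k0 where "k0 = k(j := m)"
  have k: "k = k0(j := Suc (k0 j))" "k0 j = m" using j by (auto simp: k0_def)
  have "(\<Sum>j<6. k j) = k j + (\<Sum>i\<in>{..<6} - {j}. k i)" using j by (intro sum.remove) auto
  moreover have "(\<Sum>j<6. k0 j) = k0 j + (\<Sum>i\<in>{..<6} - {j}. k0 i)" using j by (intro sum.remove) auto
  moreover have "(\<Sum>i\<in>{..<6} - {j}. k0 i) = (\<Sum>i\<in>{..<6} - {j}. k i)" by (rule sum.cong) (auto simp: k0_def)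
  ultimately have q: "q = (\<Sum>j<6. k0 j)" using Suc(2) j k(2) by simp
  have S: "S \<subseteq> {Tri j s | j s. j < 6 \<and> k0 j = 0}" 
  proof
    fix x assume "x \<in> S"
    then obtain j' s where x: "x = Tri j' s" "j' < 6" "k j' = 0" using Suc(3) by blast
    then have "j' \<noteq> j" using j by auto
    then show "x \<in> {Tri j s | j s. j < 6 \<and> k0 j = 0}" using x by (auto simp: k0_def)
  qed
  \<comment> \<open>The new diamond is the last of its string, so the shift moves no vertex of the
    smaller model.\<close>
  have sh: "shift j m x = x" if "x \<in> FV k0" for x
    using that k(2) by (cases x) auto
  have "shift j m ` e = e" if "e \<in> GE B k0" for e
    using GE_subset[OF that] sh by force
  then have im: "(`) (shift j m) ` GE B k0 = GE B k0" by force
  have le: "m \<le> k0 j" using k by simp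
  have GE: "GE B k = insert_diamond (GE B k0) (lport j m) (rport k0 j m) (Dia j m 0) (Dia j m 1) (Dia j m 2) (Dia j m 3)"
    using GE_insert[OF assms(1) j(1), where p = m and k = k0, OF le] sh[OF lport_in_FV[where k = k0, OF j(1) le]] sh[OF rport_in_FV[OF j(1)]]
    unfolding k(1)[symmetric] im by simp
  have nS: "{lport j m, rport k0 j m} \<inter> S = {}" "{Dia j m 0, Dia j m 1, Dia j m 2, Dia j m 3} \<inter> S = {}"
    using Suc(3) j by (cases m; auto simp: lport_def rport_def)+
  have sg: "simple_graph (FV k0 - S) (del_verts_E (GE B k0) S)"
    using simple_graph_del_verts simple_graph_GE by blast
  show ?case unfolding GE del_verts_insert_diamond[OF nS]
  proof (rule emb_insert_diamond)
    show "emb n (del_verts_E (GE B k0) S)" using Suc(1)[OF q S] .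
    show "finite (del_verts_E (GE B k0) S)" "loopless (del_verts_E (GE B k0) S)"
      using simple_graph_finite(2)[OF sg] simple_graph_loopless[OF sg] by simp_all
    have "conn k0 j m \<in> GE B k0" unfolding GE_def using j le by blast
    then show "{lport j m, rport k0 j m} \<in> del_verts_E (GE B k0) S"
      using nS by (simp add: conn_def del_verts_E_def)
    have "\<Union>(del_verts_E (GE B k0) S) \<subseteq> FV k0" using GE_subset unfolding del_verts_E_def by blast
    then show "{Dia j m 0, Dia j m 1, Dia j m 2, Dia j m 3} \<inter> \<Union>(del_verts_E (GE B k0) S) = {}"
      using k(2) by auto
  qed simp
qed

lemma base_endpt_neq:
  assumes "B \<in> {K4_base, L4_base}"
  shows "\<forall>j<6. endpt B j 0 \<noteq> endpt B j 1"
proof (intro allI impI)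
  fix j :: nat assume "j < 6"
  then have "j = 0 \<or> j = 1 \<or> j = 2 \<or> j = 3 \<or> j = 4 \<or> j = 5" by linarith
  then show "endpt B j 0 \<noteq> endpt B j 1"
    using assms by (auto simp: endpt_def K4_base_def L4_base_def)
qed

lemma emb_GE:
  assumes "B \<in> {K4_base, L4_base}"
  shows "emb 2 (GE B k)"
proof -
  have "emb 2 (del_verts_E (GE B k) {})"
  proof (rule emb_GE_removed[OF base_endpt_neq[OF assms]])
    fix k0 :: "nat \<Rightarrow> nat" assume "\<forall>j<6. k0 j = 0"
    then show "emb 2 (del_verts_E (GE B k0) {})"
      using emb_image[OF emb_base_graph[OF assms] finite_loopless_base inj_on_subset[OF inj_tri_vert]]
      by (simp add: GE_zero_base_graph)
  qed simp
  then show ?thesis by simp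
qed

text \<open>Across an empty string the two triangle vertices are adjacent; they are the pair whose
  deletion the one-face certificates cover, whatever the lengths of the other strings.\<close>

lemma emb_GE_minus_pair:
  assumes "B \<in> {K4_base, L4_base}" "j < 6" "k j = 0"
  shows "emb 1 (del_verts_E (GE B k) {Tri j 0, Tri j 1})"
proof (rule emb_GE_removed[OF base_endpt_neq[OF assms(1)]])
  show "{Tri j 0, Tri j 1} \<subseteq> {Tri j s | j s. j < 6 \<and> k j = 0}" using assms by auto
  fix k0 :: "nat \<Rightarrow> nat" assume k0: "\<forall>j<6. k0 j = 0"
  have "{Tri j 0, Tri j 1} = tri_vert ` set [2 * j, Suc (2 * j)]" by (auto simp: tri_vert_def)
  then have "del_verts_E (GE B k0) {Tri j 0, Tri j 1} = (`) tri_vert ` base_graph B [2 * j, Suc (2 * j)]"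
    unfolding GE_zero_base_graph[OF k0] base_graph_removed[of B "[2 * j, Suc (2 * j)]"]
    using del_verts_image[OF inj_on_subset[OF inj_tri_vert]] by (metis subset_UNIV)
  then show "emb 1 (del_verts_E (GE B k0) {Tri j 0, Tri j 1})"
    using emb_image[OF emb_base_graph_removed[OF assms(1,2)] finite_loopless_base inj_on_subset[OF inj_tri_vert]]
    by simp
qed

text \<open>An isomorphism directed from the labels to the graph. Taking images of edge sets turns
  an insertion in \<open>GE B k\<close> into an insertion in \<open>E\<close> by rewriting, which
  the pairwise condition in \<open>graph_iso\<close> would not.\<close>

definition models :: "(nat \<Rightarrow> nat \<times> nat) \<Rightarrow> (nat \<Rightarrow> nat) \<Rightarrow> (fvert \<Rightarrow> 'a) \<Rightarrow> 'a set \<Rightarrow> 'a set set \<Rightarrow> bool" where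
  "models B k g V E \<longleftrightarrow> inj_on g (FV k) \<and> g ` FV k = V \<and> (`) g ` GE B k = E"

lemma Union_GE_subset: "\<Union>(GE B k) \<subseteq> FV k"
  using GE_subset by blast

lemma models_insert_lr:
  assumes B: "\<forall>j<6. endpt B j 0 \<noteq> endpt B j 1" and M: "models B k g V E"
    and j: "j < 6" and p: "p \<le> k j" and uv: "u = g (lport j p)" "v = g (rport k j p)"
    and dist: "distinct [a, b, c, d]" and fresh: "{a, b, c, d} \<inter> V = {}"
  shows "\<exists>g'. models B (k(j := Suc (k j))) g' (V \<union> {a, b, c, d}) (insert_diamond E u v a b c d)"
proof -
  let ?\<sigma> = "shift j p" and ?k = "k(j := Suc (k j))"
  have g: "inj_on g (FV k)" "g ` FV k = V" "(`) g ` GE B k = E" using M by (auto simp: models_def)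
  \<comment> \<open>Old labels are shifted back before \<open>g\<close> is applied; the four fresh
    labels name the new diamond.\<close>
  define g' where "g' x = (if x = Dia j p 0 then a else if x = Dia j p 1 then b else if x = Dia j p 2 then c
    else if x = Dia j p 3 then d else g (inv ?\<sigma> x))" for x
  have gs: "g' (?\<sigma> x) = g x" for x
  proof -
    have "?\<sigma> x \<noteq> Dia j p l" for l using shift_fresh by (metis rangeI)
    then show ?thesis unfolding g'_def by (simp add: inv_f_f[OF inj_shift])
  qed
  have g'D: "g' (Dia j p 0) = a" "g' (Dia j p 1) = b" "g' (Dia j p 2) = c" "g' (Dia j p 3) = d"
    by (auto simp: g'_def)
  have im: "g' ` ?\<sigma> ` X = g ` X" for X using gs by (auto simp: image_iff)
  note FVk = FV_insert[where k = k, OF j p]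
  have "inj_on g' (?\<sigma> ` FV k \<union> {Dia j p 0, Dia j p 1, Dia j p 2, Dia j p 3})"
  proof -
    have "inj_on g' (?\<sigma> ` FV k)" using g(1) gs by (auto simp: inj_on_def)
    moreover have "inj_on g' {Dia j p 0, Dia j p 1, Dia j p 2, Dia j p 3}"
      using dist by (auto simp: inj_on_def g'D g'D(2)[unfolded One_nat_def])
    moreover have "g' ` ?\<sigma> ` FV k \<inter> g' ` {Dia j p 0, Dia j p 1, Dia j p 2, Dia j p 3} = {}"
      using fresh unfolding im g(2) by (auto simp: g'D g'D(2)[unfolded One_nat_def])
    ultimately show ?thesis unfolding inj_on_Un by blast
  qed
  then have 1: "inj_on g' (FV ?k)" unfolding FVk .
  have 2: "g' ` FV ?k = V \<union> {a, b, c, d}" unfolding FVk image_Un im g(2) by (simp only: image_insert image_empty g'D)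
  have sub: "\<Union>((`) ?\<sigma> ` GE B k) \<subseteq> FV ?k" using Union_GE_subset[of B k] unfolding FVk by blast
  have "conn k j p \<in> GE B k" unfolding GE_def using j p by blast
  then have "?\<sigma> ` conn k j p \<in> (`) ?\<sigma> ` GE B k" by blast
  then have uvE: "{?\<sigma> (lport j p), ?\<sigma> (rport k j p)} \<in> (`) ?\<sigma> ` GE B k" by (simp add: conn_def)
  have "(`) g' ` (`) ?\<sigma> ` GE B k = E" unfolding g(3)[symmetric] image_image[of "(`) g'"] im ..
  then have "(`) g' ` GE B ?k = insert_diamond E u v a b c d"
    unfolding GE_insert[where k = k, OF B j p] insert_diamond_image[OF inj_on_subset[OF 1 sub] uvE] gs g'D uv by simp
  then show ?thesis using 1 2 unfolding models_def by blast
qed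

text \<open>A connecting edge is oriented from its left to its right end, whereas
  \<open>{u, v}\<close> is not. In the reversed case the diamond is read from \<open>d\<close> to
  \<open>a\<close>, which gives the same edges.\<close>

lemma models_insert:
  assumes "\<forall>j<6. endpt B j 0 \<noteq> endpt B j 1" and "models B k g V E"
    and "j < 6" and "p \<le> k j" and "{u, v} = g ` conn k j p"
    and "distinct [a, b, c, d]" and "{a, b, c, d} \<inter> V = {}"
  shows "\<exists>g'. models B (k(j := Suc (k j))) g' (V \<union> {a, b, c, d}) (insert_diamond E u v a b c d)"
proof -
  have "u = g (lport j p) \<and> v = g (rport k j p) \<or> v = g (lport j p) \<and> u = g (rport k j p)"
    using assms(5) by (auto simp: conn_def doubleton_eq_iff)
  then show ?thesis
  proof
    assume "u = g (lport j p) \<and> v = g (rport k j p)"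
    then show ?thesis using models_insert_lr[OF assms(1-4) _ _ assms(6,7)] by blast
  next
    assume "v = g (lport j p) \<and> u = g (rport k j p)"
    moreover have "distinct [d, c, b, a]" "{d, c, b, a} \<inter> V = {}" using assms(6,7) by auto
    moreover have "{d, c, b, a} = {a, b, c, d}" by auto
    ultimately show ?thesis
      using models_insert_lr[OF assms(1-4), of v u d c b a] insert_diamond_swap[of E u v a b c d] by metis
  qed
qed

lemma models_graph_iso:
  assumes "models B k g V E"
  shows "graph_iso V E (FV k) (GE B k)"
proof -
  have g: "inj_on g (FV k)" "g ` FV k = V" "(`) g ` GE B k = E" using assms by (auto simp: models_def)
  define f where "f = inv_into (FV k) g"
  have bij: "bij_betw f V (FV k)" unfolding f_def using g by (metis bij_betw_inv_into bij_betw_imageI)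
  have gf: "g (f x) = x" "f x \<in> FV k" if "x \<in> V" for x
    using that g(2) unfolding f_def by (auto simp: f_inv_into_f inv_into_into)
  have "{x, y} \<in> E \<longleftrightarrow> {f x, f y} \<in> GE B k" if "x \<in> V" "y \<in> V" for x y
  proof
    assume "{x, y} \<in> E"
    then obtain e where e: "e \<in> GE B k" "{x, y} = g ` e" using g(3) by blast
    then have "g ` {f x, f y} = g ` e" using gf that by simp
    then have "{f x, f y} = e" using g(1) GE_subset[OF e(1)] gf that by (metis empty_subsetI inj_on_image_eq_iff insert_subset)
    then show "{f x, f y} \<in> GE B k" using e by simp
  next
    assume "{f x, f y} \<in> GE B k"
    then have "g ` {f x, f y} \<in> E" using g(3) by blast
    then show "{x, y} \<in> E" using gf that by simp
  qed
  then show ?thesis unfolding graph_iso_def using bij by blast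
qed

lemma graph_iso_models:
  assumes "simple_graph V E" "graph_iso V E (FV k) (GE B k)"
  shows "\<exists>g. models B k g V E"
proof -
  obtain f where f: "bij_betw f V (FV k)" "\<And>x y. x \<in> V \<Longrightarrow> y \<in> V \<Longrightarrow> {x, y} \<in> E \<longleftrightarrow> {f x, f y} \<in> GE B k"
    using assms(2) unfolding graph_iso_def by blast
  define g where "g = inv_into V f"
  have bg: "bij_betw g (FV k) V" unfolding g_def using f(1) by (rule bij_betw_inv_into)
  have gf: "g (f x) = x" if "x \<in> V" for x using that f(1) unfolding g_def by (simp add: bij_betw_inv_into_left)
  have fg: "f (g x) = x" "g x \<in> V" if "x \<in> FV k" for x
    using that f(1) bg unfolding g_def by (auto simp: bij_betw_inv_into_right bij_betw_apply)
  have "(`) g ` GE B k = E"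
  proof (intro equalityI subsetI)
    fix e assume "e \<in> (`) g ` GE B k"
    then obtain e' where e': "e = g ` e'" "e' \<in> GE B k" by blast
    obtain x y where xy: "x \<in> FV k" "y \<in> FV k" "e' = {x, y}"
      using e' simple_graph_GE unfolding simple_graph_def by blast
    then show "e \<in> E" using f(2)[of "g x" "g y"] fg e' by simp
  next
    fix e assume e: "e \<in> E"
    then obtain x y where xy: "x \<in> V" "y \<in> V" "e = {x, y}" using assms(1) unfolding simple_graph_def by blast
    then have "{f x, f y} \<in> GE B k" "g ` {f x, f y} = e" using f(2) e gf by auto
    then show "e \<in> (`) g ` GE B k" by blast
  qed
  then show ?thesis using bg unfolding models_def bij_betw_def by blast
qed

lemma graph_iso_FE_iff: "(\<forall>j<6. k j \<ge> 1) \<Longrightarrow> graph_iso V E (FV k) (FE B k) \<longleftrightarrow> graph_iso V E (FV k) (GE B k)"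
  by (simp add: FE_eq_GE)

lemma in_family_F_iff:
  assumes "simple_graph V E"
  shows "in_family_F V E \<longleftrightarrow> (\<exists>B\<in>{K4_base, L4_base}. \<exists>k g. (\<forall>j<6. k j \<ge> 1) \<and> models B k g V E)"
  unfolding in_family_F_def using graph_iso_FE_iff graph_iso_models[OF assms] models_graph_iso by metis

lemma emb_models:
  assumes "models B k g V E" "emb n (del_verts_E (GE B k) S)" "S \<subseteq> FV k"
  shows "emb n (del_verts_E E (g ` S))"
proof -
  have g: "inj_on g (FV k)" "(`) g ` GE B k = E" using assms(1) by (auto simp: models_def)
  note sg = simple_graph_del_verts[OF simple_graph_GE, of k S B]
  have "emb n ((`) g ` del_verts_E (GE B k) S)"
  proof (rule emb_image[OF assms(2)])
    show "inj_on g (\<Union>(del_verts_E (GE B k) S))"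
      by (rule inj_on_subset[OF g(1)]) (use Union_GE_subset[of B k] in \<open>auto simp: del_verts_E_def\<close>)
  qed (rule simple_graph_finite(2)[OF sg] simple_graph_loopless[OF sg])+
  then show ?thesis
    using del_verts_image[OF inj_on_subset[OF g(1)], of "GE B k" S] Union_GE_subset[of B k] assms(3) g(2)
    by simp
qed

section \<open>Claw-free cubic graphs\<close>

definition nbrs :: "'a set set \<Rightarrow> 'a \<Rightarrow> 'a set" where
  "nbrs E v = {w. adj E v w}"

lemma adj_sym: "adj E x y \<Longrightarrow> adj E y x"
  by (simp add: adj_def insert_commute)

lemma simple_graph_adj:
  assumes "simple_graph V E" "adj E x y"
  shows "x \<in> V" "y \<in> V" "x \<noteq> y"
proof -
  obtain a b where "a \<in> V" "b \<in> V" "a \<noteq> b" "{x, y} = {a, b}"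
    using assms unfolding simple_graph_def adj_def by blast
  then show "x \<in> V" "y \<in> V" "x \<noteq> y" by (auto simp: doubleton_eq_iff)
qed

lemma degree_eq_card_nbrs:
  assumes "simple_graph V E"
  shows "degree E v = card (nbrs E v)"
proof -
  have "{e \<in> E. v \<in> e} = (\<lambda>w. {v, w}) ` nbrs E v"
  proof (intro equalityI subsetI)
    fix e assume e: "e \<in> {e \<in> E. v \<in> e}"
    then obtain x y where "e = {x, y}" using assms unfolding simple_graph_def by blast
    then have "e = {v, x} \<or> e = {v, y}" using e by auto
    then show "e \<in> (\<lambda>w. {v, w}) ` nbrs E v" using e by (auto simp: nbrs_def adj_def)
  qed (auto simp: nbrs_def adj_def)
  moreover have "inj_on (\<lambda>w. {v, w}) (nbrs E v)" by (auto simp: inj_on_def doubleton_eq_iff)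
  ultimately show ?thesis unfolding degree_def by (simp add: card_image)
qed

lemma handshake:
  assumes "simple_graph V E" "cubic V E"
  shows "2 * card E = 3 * card V"
proof -
  have "(\<Sum>v\<in>V. card {e \<in> E. v \<in> e}) = 2 * card E"
  proof (rule sum_multicount)
    show "\<forall>e\<in>E. card {v \<in> V. v \<in> e} = 2"
    proof
      fix e assume "e \<in> E"
      then obtain x y where "x \<in> V" "y \<in> V" "x \<noteq> y" "e = {x, y}" using assms(1) unfolding simple_graph_def by blast
      moreover from this have "{v \<in> V. v \<in> e} = {x, y}" by auto
      ultimately show "card {v \<in> V. v \<in> e} = 2" by simp
    qed
  qed (use simple_graph_finite assms in auto)
  moreover have "(\<Sum>v\<in>V. card {e \<in> E. v \<in> e}) = 3 * card V"
    using assms(2) unfolding cubic_def degree_def by simp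
  ultimately show ?thesis by simp
qed

lemma connected_mono: "connected V E \<Longrightarrow> E \<subseteq> E' \<Longrightarrow> connected V E'"
proof -
  assume "E \<subseteq> E'"
  then have "adj E \<le> adj E'" by (auto simp: adj_def le_fun_def)
  then have "(adj E)\<^sup>*\<^sup>* x y \<Longrightarrow> (adj E')\<^sup>*\<^sup>* x y" for x y by (meson rtranclp_mono rev_predicate2D)
  then show "connected V E \<Longrightarrow> connected V E'" by (auto simp: connected_def)
qed

lemma rtranclp_closed:
  assumes "r\<^sup>*\<^sup>* x y" "x \<in> X" "\<And>a b. a \<in> X \<Longrightarrow> r a b \<Longrightarrow> b \<in> X"
  shows "y \<in> X"
  using assms by (induction rule: rtranclp_induct) auto

lemma rtranclp_map:
  assumes "r\<^sup>*\<^sup>* x y" "\<And>a b. r a b \<Longrightarrow> f a = f b \<or> s (f a) (f b)"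
  shows "s\<^sup>*\<^sup>* (f x) (f y)"
  using assms(1)
proof (induction rule: rtranclp_induct)
  case (step y z)
  then show ?case using assms(2)[OF step(2)] by (metis rtranclp.rtrancl_into_rtrancl)
qed simp

text \<open>The class of graphs on which the induction runs. In a cubic graph
  \<open>triangle\<close> amounts to claw-freeness: among the three neighbours of a vertex some two
  are adjacent.\<close>

locale good_graph =
  fixes V :: "'a set" and E :: "'a set set"
  assumes simple: "simple_graph V E" and cubic: "cubic V E" and conn: "connected V E"
    and bridgeless: "\<And>e. e \<in> E \<Longrightarrow> connected V (E - {e})"
    and triangle: "\<And>v. v \<in> V \<Longrightarrow> \<exists>a b. adj E v a \<and> adj E v b \<and> adj E a b"
begin

lemma fin: "finite V" "finite E"
  using simple_graph_finite simple by auto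

lemma inV: "adj E x y \<Longrightarrow> x \<in> V" "adj E x y \<Longrightarrow> y \<in> V" "adj E x y \<Longrightarrow> x \<noteq> y"
  using simple_graph_adj[OF simple] by auto

lemma irr: "\<not> adj E x x"
  using inV(3) by blast

lemma card_nbrs: "v \<in> V \<Longrightarrow> card (nbrs E v) = 3"
  using cubic degree_eq_card_nbrs[OF simple] by (simp add: cubic_def)

lemma nb3:
  assumes "adj E v a" "adj E v b" "adj E v c" "a \<noteq> b" "a \<noteq> c" "b \<noteq> c" "adj E v w"
  shows "w = a \<or> w = b \<or> w = c"
proof -
  have "card {a, b, c} = card (nbrs E v)" using assms card_nbrs inV(1) by auto
  moreover have "{a, b, c} \<subseteq> nbrs E v" using assms by (simp add: nbrs_def)
  moreover have "finite (nbrs E v)" using card_nbrs[OF inV(1)[OF assms(1)]] card.infinite by fastforce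
  ultimately have "{a, b, c} = nbrs E v" using card_subset_eq by blast
  then show ?thesis using assms(7) by (auto simp: nbrs_def)
qed

lemma third:
  assumes "adj E v a" "adj E v b" "a \<noteq> b"
  obtains c where "adj E v c" "c \<noteq> a" "c \<noteq> b"
proof -
  have "nbrs E v \<noteq> {a, b}" using card_nbrs[OF inV(1)[OF assms(1)]] assms(3) by auto
  moreover have "{a, b} \<subseteq> nbrs E v" using assms by (simp add: nbrs_def)
  ultimately show ?thesis using that by (auto simp: nbrs_def)
qed

lemma closed_eq:
  assumes "x \<in> X" "X \<subseteq> V" "\<And>a b. a \<in> X \<Longrightarrow> adj E a b \<Longrightarrow> b \<in> X"
  shows "X = V"
proof -
  have "y \<in> X" if "y \<in> V" for y
    using rtranclp_closed[of "adj E" x y X] conn assms that unfolding connected_def by blast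
  then show ?thesis using assms(2) by blast
qed

text \<open>If every edge leaving \<open>X\<close> is \<open>{p, q}\<close>, then a walk avoiding
  that edge cannot leave \<open>X\<close>. The exclusions below exhibit such a set.\<close>

lemma no_bridge:
  assumes "x \<in> X" "y \<in> V" "y \<notin> X" "X \<subseteq> V" "adj E p q"
    "\<And>a b. a \<in> X \<Longrightarrow> adj E a b \<Longrightarrow> b \<notin> X \<Longrightarrow> {a, b} = {p, q}"
  shows False
proof -
  have "connected V (E - {{p, q}})" using bridgeless assms(5) by (simp add: adj_def)
  then have "(adj (E - {{p, q}}))\<^sup>*\<^sup>* x y" using assms(1,2,4) unfolding connected_def by blast
  then have "y \<in> X"
    by (rule rtranclp_closed) (use assms(1,6) in \<open>auto simp: adj_def\<close>)
  then show False using assms(3) by simp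
qed

text \<open>Each of the four vertices has its three neighbours among the others, so they are closed
  under adjacency and connectedness makes them the whole graph.\<close>

lemma K4_card:
  assumes "adj E p q" "adj E p r" "adj E q r" "adj E q s" "adj E r s" "adj E p s"
  shows "V = {p, q, r, s}" "card V = 4"
proof -
  have d: "distinct [p, q, r, s]" using assms irr by (auto)
  have "b \<in> {p, q, r, s}" if "a \<in> {p, q, r, s}" "adj E a b" for a b
    using that nb3[of p q r s b] nb3[of q p r s b] nb3[of r p q s b] nb3[of s p q r b]
      assms assms[THEN adj_sym] d by auto
  moreover have "{p, q, r, s} \<subseteq> V" using inV(1)[OF assms(1)] inV(2)[OF assms(1)] inV(2)[OF assms(2)] inV(2)[OF assms(4)] by simp
  ultimately have "{p, q, r, s} = V" by (intro closed_eq[of p]) simp_all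
  then show "V = {p, q, r, s}" by simp
  then show "card V = 4" using d by simp
qed

end

section \<open>Replacing a diamond with ends \<open>p\<close>, \<open>s\<close> and outer neighbours
  \<open>u\<close>, \<open>v\<close> by the edge \<open>{u, v}\<close>\<close>

locale diamond_graph = good_graph +
  fixes p q r s u v :: 'a
  assumes pq: "adj E p q" and pr: "adj E p r" and qr: "adj E q r" and qs: "adj E q s" and rs: "adj E r s"
    and ps: "p \<noteq> s" and nps: "\<not> adj E p s"
    and pu: "adj E p u" and uqr: "u \<noteq> q" "u \<noteq> r"
    and sv: "adj E s v" and vqr: "v \<noteq> q" "v \<noteq> r"
begin

definition "D = {p, q, r, s}"
definition "V0 = V - D"
definition "E0 = insert {u, v} (del_verts_E E D)"

lemma dist: "distinct [p, q, r, s]"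
  using pq pr qr qs rs ps irr by auto

lemma nb_p: "adj E p w \<longleftrightarrow> w = q \<or> w = r \<or> w = u"
  using nb3[of p q r u w] pq pr pu uqr qr inV(3) by metis

lemma nb_q: "adj E q w \<longleftrightarrow> w = p \<or> w = r \<or> w = s"
  using nb3[of q p r s w] pq qr qs dist adj_sym by (metis distinct_length_2_or_more)

lemma nb_r: "adj E r w \<longleftrightarrow> w = p \<or> w = q \<or> w = s"
  using nb3[of r p q s w] pr qr rs dist adj_sym by (metis distinct_length_2_or_more)

lemma nb_s: "adj E s w \<longleftrightarrow> w = q \<or> w = r \<or> w = v"
  using nb3[of s q r v w] qs rs sv vqr qr inV(3) adj_sym by metis

lemma uvD: "u \<notin> D" "v \<notin> D"
  unfolding D_def using uqr vqr pu sv nps irr adj_sym[of E s p] by auto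

lemma nb_outside:
  assumes "x \<notin> D" "y \<in> D" "adj E x y"
  shows "x = u \<and> y = p \<or> x = v \<and> y = s"
  using assms nb_p[of x] nb_q[of x] nb_r[of x] nb_s[of x] adj_sym[OF assms(3)] unfolding D_def by auto

lemma triangle_outside:
  assumes "x \<in> V" "x \<notin> D"
  obtains a b where "adj E x a" "adj E x b" "adj E a b" "a \<notin> D" "b \<notin> D"
proof -
  obtain a b where ab: "adj E x a" "adj E x b" "adj E a b" using triangle assms(1) by blast
  have "\<not> (a' \<in> D \<and> adj E x a' \<and> adj E x b' \<and> adj E a' b')" for a' b'
  proof
    assume a: "a' \<in> D \<and> adj E x a' \<and> adj E x b' \<and> adj E a' b'"
    then have "x = u \<and> a' = p \<or> x = v \<and> a' = s" using nb_outside assms by blast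
    then have "b' = q \<or> b' = r" using a nb_p[of b'] nb_s[of b'] irr by auto
    then have "adj E q x \<or> adj E r x" using a adj_sym by metis
    then show False using nb_q[of x] nb_r[of x] assms(2) unfolding D_def by auto
  qed
  then show ?thesis using that[of a b] ab adj_sym by metis
qed

text \<open>Were the two outer neighbours equal, the third edge at that vertex would be the only way
  out of the diamond, hence a bridge.\<close>

lemma u_neq_v: "u \<noteq> v"
proof
  assume uv: "u = v"
  obtain w where w: "adj E u w" "w \<noteq> p" "w \<noteq> s" using third[of u p s] pu sv uv adj_sym ps by metis
  have "w \<notin> D" using nb_outside[of u w] uvD w by blast
  have nu: "adj E u x \<Longrightarrow> x = p \<or> x = s \<or> x = w" for x
    using nb3[of u p s w x] w pu sv uv adj_sym ps by metis
  have wu: "w \<noteq> u" using w irr by blast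
  show False
  proof (rule no_bridge[of p "insert u D" w u w])
    show "insert u D \<subseteq> V" using inV[OF pq] inV[OF rs] inV[OF pu] by (simp add: D_def)
    show "w \<in> V" "adj E u w" using w inV by blast+
    show "p \<in> insert u D" by (simp add: D_def)
    show "w \<notin> insert u D" using \<open>w \<notin> D\<close> wu by simp
    fix a b assume "a \<in> insert u D" "adj E a b" "b \<notin> insert u D"
    then show "{a, b} = {u, w}"
      using nu[of b] nb_p[of b] nb_q[of b] nb_r[of b] nb_s[of b] uv unfolding D_def by auto
  qed
qed

text \<open>The new edge must not be parallel to an old one. If \<open>u\<close> and
  \<open>v\<close> were adjacent, the triangle at \<open>u\<close> would have to contain
  \<open>v\<close>, because \<open>p\<close> lies in no triangle with \<open>u\<close>; the third
  edge at the common neighbour \<open>w\<close> would then be a bridge.\<close>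

lemma nadj_uv: "\<not> adj E u v"
proof
  assume uv: "adj E u v"
  obtain a b where ab: "adj E u a" "adj E u b" "adj E a b" "a \<notin> D" "b \<notin> D"
    using triangle_outside[of u] uvD inV(2)[OF pu] by blast
  have "p \<in> D" "s \<in> D" by (simp_all add: D_def)
  then have "v = a \<or> v = b" using nb3[of u p a b v] ab pu adj_sym irr uv uvD by metis
  then obtain w where w: "adj E u w" "adj E v w" "w \<notin> D" using ab adj_sym by metis
  have nu: "adj E u x \<Longrightarrow> x = p \<or> x = v \<or> x = w" for x
    using nb3[of u p v w x] w pu uv adj_sym irr uvD \<open>p \<in> D\<close> by metis
  have nv: "adj E v x \<Longrightarrow> x = s \<or> x = u \<or> x = w" for x
    using nb3[of v s u w x] w sv uv adj_sym irr uvD \<open>s \<in> D\<close> by metis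
  have wuv: "w \<noteq> u" "w \<noteq> v" using w irr by blast+
  obtain z where z: "adj E w z" "z \<noteq> u" "z \<noteq> v" using third[of w u v] w adj_sym u_neq_v by metis
  have nw: "adj E w x \<Longrightarrow> x = u \<or> x = v \<or> x = z" for x
    using nb3[of w u v z x] w z adj_sym u_neq_v by metis
  have zD: "z \<notin> D" using nb_outside[of w z] w z wuv by blast
  have zw: "z \<noteq> w" using z irr by blast
  show False
  proof (rule no_bridge[of p "{u, v, w} \<union> D" z w z])
    show "{u, v, w} \<union> D \<subseteq> V" using inV[OF pq] inV[OF rs] inV[OF uv] inV[OF w(1)] by (simp add: D_def)
    show "z \<in> V" "adj E w z" using z inV by blast+
    show "p \<in> {u, v, w} \<union> D" by (simp add: D_def)
    show "z \<notin> {u, v, w} \<union> D" using zD zw z by simp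
    fix a b assume "a \<in> {u, v, w} \<union> D" "adj E a b" "b \<notin> {u, v, w} \<union> D"
    then show "{a, b} = {w, z}"
      using nu[of b] nv[of b] nw[of b] nb_p[of b] nb_q[of b] nb_r[of b] nb_s[of b] unfolding D_def by auto
  qed
qed

lemma nadj_vu: "\<not> adj E v u"
  using nadj_uv adj_sym[of E v u] by blast

lemma adj_E0: "adj E0 x y \<longleftrightarrow> adj E x y \<and> x \<notin> D \<and> y \<notin> D \<or> x = u \<and> y = v \<or> x = v \<and> y = u"
  unfolding E0_def adj_def del_verts_E_def by (auto simp: doubleton_eq_iff)

lemma uvV0: "u \<in> V0" "v \<in> V0"
  using uvD inV(2)[OF pu] inV(2)[OF sv] by (auto simp: V0_def)

lemma DV: "D \<subseteq> V"
  using inV[OF pq] inV[OF rs] by (simp add: D_def)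

lemma E_eq: "E = insert_diamond E0 u v p q r s" "V = V0 \<union> {p, q, r, s}"
proof -
  show "V = V0 \<union> {p, q, r, s}" using DV by (auto simp: V0_def D_def)
  have "{u, v} \<notin> del_verts_E E D" using nadj_uv by (simp add: del_verts_E_def adj_def)
  then have m: "E0 - {{u, v}} = del_verts_E E D" by (simp add: E0_def)
  have e: "{p, u} \<in> E" "{s, v} \<in> E" "{p, q} \<in> E" "{p, r} \<in> E" "{q, r} \<in> E" "{q, s} \<in> E" "{r, s} \<in> E"
    using pu sv pq pr qr qs rs by (simp_all add: adj_def)
  show "E = insert_diamond E0 u v p q r s"
    unfolding insert_diamond_def m
  proof (intro equalityI subsetI)
    fix e assume eE: "e \<in> E"
    show "e \<in> del_verts_E E D \<union> {{u, p}, {s, v}} \<union> diamond_edges p q r s"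
    proof (cases "e \<inter> D = {}")
      case False
      then obtain x where x: "x \<in> D" "x \<in> e" by blast
      obtain x' y' where "e = {x', y'}" using simple eE unfolding simple_graph_def by metis
      then have "e = {x, x'} \<or> e = {x, y'}" using x(2) by auto
      then obtain y where y: "e = {x, y}" by metis
      then have "adj E x y" using eE by (simp add: adj_def)
      then have "e \<in> {{u, p}, {s, v}} \<union> diamond_edges p q r s"
      proof -
        have "x = p \<and> (y = q \<or> y = r \<or> y = u) \<or> x = q \<and> (y = p \<or> y = r \<or> y = s) \<or>
          x = r \<and> (y = p \<or> y = q \<or> y = s) \<or> x = s \<and> (y = q \<or> y = r \<or> y = v)"
          using x(1) nb_p[of y] nb_q[of y] nb_r[of y] nb_s[of y] \<open>adj E x y\<close> unfolding D_def by auto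
        then show ?thesis unfolding y diamond_edges_def
          by (elim disjE conjE) (simp_all add: insert_commute)
      qed
      then show ?thesis by blast
    qed (use eE in \<open>simp add: del_verts_E_def\<close>)
  next
    fix e assume "e \<in> del_verts_E E D \<union> {{u, p}, {s, v}} \<union> diamond_edges p q r s"
    then show "e \<in> E" using e unfolding del_verts_E_def diamond_edges_def by (auto simp: insert_commute)
  qed
qed

lemma simple_E0: "simple_graph V0 E0"
  using simple_graph_del_verts[OF simple, of D] uvV0 u_neq_v
  unfolding simple_graph_def E0_def V0_def by auto

lemma nbrs_E0:
  assumes "x \<in> V0"
  shows "card (nbrs E0 x) = 3"
proof -
  have xD: "x \<in> V" "x \<notin> D" using assms by (auto simp: V0_def)
  have c: "card (nbrs E x) = 3" using card_nbrs xD by blast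
  then have fin: "finite (nbrs E x)" using card.infinite by fastforce
  have pD: "p \<in> D" "s \<in> D" by (simp_all add: D_def)
  consider "x = u" | "x = v" | "x \<noteq> u" "x \<noteq> v" by blast
  then show ?thesis
  proof cases
    case 1
    have "nbrs E0 x = insert v (nbrs E x - {p})"
      using nb_outside[of u] u_neq_v uvD pD unfolding nbrs_def adj_E0 1 by auto
    moreover have "p \<in> nbrs E x" "v \<notin> nbrs E x" using adj_sym[OF pu] nadj_uv 1 by (auto simp: nbrs_def)
    ultimately show ?thesis using fin c by simp
  next
    case 2
    have "nbrs E0 x = insert u (nbrs E x - {s})"
      using nb_outside[of v] u_neq_v uvD pD unfolding nbrs_def adj_E0 2 by auto
    moreover have "s \<in> nbrs E x" "u \<notin> nbrs E x" using sv nadj_vu adj_sym[OF sv] 2 by (auto simp: nbrs_def)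
    ultimately show ?thesis using fin c by simp
  next
    case 3
    have "nbrs E0 x = nbrs E x" using nb_outside[of x] 3 xD unfolding nbrs_def adj_E0 by auto
    then show ?thesis using c by simp
  qed
qed

text \<open>Collapsing \<open>D\<close> to \<open>u\<close> turns a walk of \<open>E\<close> that
  avoids \<open>e\<close> into a walk of \<open>E0\<close> that avoids \<open>e0\<close>, so the
  property is inherited from the larger graph.\<close>

lemma bridgeless_E0:
  assumes "e0 \<in> E0"
  shows "connected V0 (E0 - {e0})"
proof -
  define f where "f x = (if x \<in> D then u else x)" for x
  have fD: "f x = u" if "x \<in> D" for x using that by (simp add: f_def)
  have fN: "f x = x" if "x \<notin> D" for x using that by (simp add: f_def)
  \<comment> \<open>The new edge stands for the passage through the diamond; after the collapse of
    \<open>D\<close> to \<open>u\<close>, the edge \<open>{s, v}\<close> is what becomes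
    \<open>{u, v}\<close>.\<close>
  define e where "e = (if e0 = {u, v} then {s, v} else e0)"
  have eE: "e \<in> E" using assms sv by (auto simp: e_def E0_def del_verts_E_def adj_def)
  have e0D: "e0 \<inter> D = {}" using assms uvD by (auto simp: E0_def del_verts_E_def)
  have step: "f a = f b \<or> adj (E0 - {e0}) (f a) (f b)" if ab: "adj (E - {e}) a b" for a b
  proof -
    have abE: "adj E a b" and abe: "{a, b} \<noteq> e" using ab by (auto simp: adj_def)
    consider "a \<in> D" "b \<in> D" | "a \<in> D" "b \<notin> D" | "a \<notin> D" "b \<in> D" | "a \<notin> D" "b \<notin> D" by blast
    then show ?thesis
    proof cases
      case 1 then show ?thesis by (simp add: fD)
    next
      case 2
      then have "b = u \<or> b = v \<and> a = s" using nb_outside adj_sym[OF abE] by blast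
      then show ?thesis
      proof
        assume "b = u" then show ?thesis using 2 by (simp add: fD fN)
      next
        assume b: "b = v \<and> a = s"
        then have "e0 \<noteq> {u, v}" using abe by (auto simp: e_def)
        then show ?thesis using b 2 by (simp add: fD fN adj_def E0_def)
      qed
    next
      case 3
      then have "a = u \<or> a = v \<and> b = s" using nb_outside abE by blast
      then show ?thesis
      proof
        assume "a = u" then show ?thesis using 3 by (simp add: fD fN)
      next
        assume b: "a = v \<and> b = s"
        then have "e0 \<noteq> {u, v}" using abe by (auto simp: e_def insert_commute)
        then show ?thesis using b 3 by (simp add: fD fN adj_def E0_def insert_commute)
      qed
    next
      case 4
      have "{a, b} \<noteq> {u, v}" using abE nadj_uv nadj_vu by (auto simp: doubleton_eq_iff)
      then have "{a, b} \<noteq> e0" using abe by (auto simp: e_def split: if_splits)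
      moreover have "adj E0 a b" using 4 abE adj_E0 by blast
      ultimately show ?thesis using 4 by (simp add: fN adj_def)
    qed
  qed
  have "(adj (E0 - {e0}))\<^sup>*\<^sup>* x y" if xy: "x \<in> V0" "y \<in> V0" for x y
  proof -
    have "(adj (E - {e}))\<^sup>*\<^sup>* x y" using bridgeless[OF eE] xy by (auto simp: connected_def V0_def)
    then have "(adj (E0 - {e0}))\<^sup>*\<^sup>* (f x) (f y)" using step by (rule rtranclp_map)
    then show ?thesis using xy by (simp add: fN V0_def)
  qed
  then show ?thesis using uvV0 by (auto simp: connected_def)
qed

lemma good_E0: "good_graph V0 E0"
proof
  show "simple_graph V0 E0" by (rule simple_E0)
  show "cubic V0 E0" using nbrs_E0 degree_eq_card_nbrs[OF simple_E0] by (simp add: cubic_def)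
  show "connected V0 (E0 - {e})" if "e \<in> E0" for e using that by (rule bridgeless_E0)
  have "{u, v} \<in> E0" by (simp add: E0_def)
  from connected_mono[OF bridgeless_E0[OF this] Diff_subset] show "connected V0 E0" .
  fix x assume "x \<in> V0"
  then obtain a b where "adj E x a" "adj E x b" "adj E a b" "a \<notin> D" "b \<notin> D" "x \<notin> D"
    using triangle_outside[of x] by (auto simp: V0_def)
  then show "\<exists>a b. adj E0 x a \<and> adj E0 x b \<and> adj E0 a b" using adj_E0 by blast
qed

text \<open>A common neighbour \<open>w\<close> of \<open>u\<close> and \<open>v\<close> lies in the
  old triangle at \<open>u\<close> and in the old triangle at \<open>v\<close>. Beyond
  \<open>u\<close> and \<open>v\<close> it has only one more neighbour, so both triangles have the
  same third vertex, and together with the new edge these four vertices form K4.\<close>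

lemma uv_triangle_K4:
  assumes "adj E0 u w" "adj E0 v w"
  shows "card V0 = 4"
proof -
  interpret G0: good_graph V0 E0 by (rule good_E0)
  obtain a b where ab: "adj E u a" "adj E u b" "adj E a b" "a \<notin> D" "b \<notin> D"
    using triangle_outside[of u] uvD uvV0 by (auto simp: V0_def)
  obtain c e where ce: "adj E v c" "adj E v e" "adj E c e" "c \<notin> D" "e \<notin> D"
    using triangle_outside[of v] uvD uvV0 by (auto simp: V0_def)
  have w: "adj E u w" "adj E v w" "w \<notin> D"
    using assms G0.irr uvD unfolding adj_E0 by metis+
  have pD: "p \<in> D" "s \<in> D" by (simp_all add: D_def)
  have "\<exists>b'. adj E u b' \<and> adj E w b' \<and> b' \<notin> D"
    using nb3[of u p a b w] ab w pu pD irr adj_sym by metis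
  then obtain b' where b': "adj E u b'" "adj E w b'" "b' \<notin> D" by blast
  have "\<exists>c'. adj E v c' \<and> adj E w c' \<and> c' \<notin> D"
    using nb3[of v s c e w] ce w sv pD irr adj_sym by metis
  then obtain c' where c': "adj E v c'" "adj E w c'" "c' \<notin> D" by blast
  have "b' \<noteq> v" "c' \<noteq> u" using b' c' nadj_uv adj_sym by metis+
  moreover have "b' \<noteq> u" "c' \<noteq> v" using b' c' irr by blast+
  ultimately have "c' = b'" using nb3[of w u v b' c'] w b' c' adj_sym u_neq_v by metis
  then have "adj E0 u v" "adj E0 u w" "adj E0 v w" "adj E0 u b'" "adj E0 v b'" "adj E0 w b'"
    using assms b' c' w uvD unfolding adj_E0 by blast+
  then show ?thesis using G0.K4_card(2)[of u v w b'] by blast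
qed

end

text \<open>The last condition says that no edge at \<open>x\<close> or \<open>y\<close> is ever replaced by a diamond, so the pair
  survives diamond insertions.\<close>

definition interior_pair :: "'a set set \<Rightarrow> 'a \<Rightarrow> 'a \<Rightarrow> bool" where
  "interior_pair E x y \<longleftrightarrow> adj E x y \<and> emb 1 (del_verts_E E {x, y}) \<and>
     (\<forall>z w. z \<in> {x, y} \<longrightarrow> adj E z w \<longrightarrow> (\<exists>t. adj E z t \<and> adj E w t))"

text \<open>\<open>h\<close> counts triangles and \<open>d\<close> diamonds: a triangle weighs 2 and
  a diamond at least 1, and they have 3 and 2 outgoing edge ends. Only the inequalities needed for
  the face bound are kept. Classes are named by sets of vertices so that a new diamond supplies a
  fresh name, and the last condition makes every edge outside all triangles a crossing edge.\<close>

definition unit_partition :: "'a set \<Rightarrow> 'a set set \<Rightarrow> ('a \<Rightarrow> 'a set) \<Rightarrow> nat \<Rightarrow> nat \<Rightarrow> bool" where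
  "unit_partition V E p h d \<longleftrightarrow> 0 < h \<and> card V = 3 * h + 4 * d \<and>
     2 * h + d \<le> (\<Sum>c\<in>p ` V. even_weight V E p c) \<and> 2 * card (cross_edges E p) \<le> 3 * h + 2 * d \<and>
     (\<forall>v\<in>V. p v \<subseteq> V) \<and> (\<forall>x y. adj E x y \<and> p x = p y \<longrightarrow> (\<exists>t. adj E x t \<and> adj E y t))"

lemma emb_single_edge:
  assumes "u \<noteq> v"
  shows "emb 1 {{u, v}}"
proof -
  have "face_check [(u, v)] [[u, v]]"
    using assms by (simp add: face_check_def walk_darts_def face_table_def face_step_def)
  then show ?thesis using emb_face_check(1) by fastforce
qed

lemma even_weight_pos: "1 \<le> even_weight V E p c"
  by (simp add: even_weight_def)

context good_graph
begin

lemma complete_if_card_4: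
  assumes "card V = 4" "x \<in> V" "y \<in> V" "x \<noteq> y"
  shows "adj E x y"
proof -
  have "nbrs E x \<subseteq> V - {x}" using inV(2) irr by (auto simp: nbrs_def)
  moreover have "card (V - {x}) = 3" using assms fin by simp
  ultimately have "nbrs E x = V - {x}" using card_nbrs[OF assms(2)] fin card_subset_eq[of "V - {x}"] by simp
  then show ?thesis using assms by (auto simp: nbrs_def)
qed

lemma card_4_obtain:
  assumes "card V = 4" "x \<in> V" "y \<in> V" "x \<noteq> y"
  obtains z w where "V = {x, y, z, w}" "distinct [x, y, z, w]"
proof -
  have "card (V - {x, y}) = 2" using assms fin by (simp add: card_Diff_subset)
  then obtain z w where "V - {x, y} = {z, w}" "z \<noteq> w" using card_2_iff[of "V - {x, y}"] by auto
  then show ?thesis using assms that[of z w] by auto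
qed

lemma del_verts_card_4:
  assumes "V = {x, y, z, w}" "distinct [x, y, z, w]"
  shows "del_verts_E E {x, y} = {{z, w}}"
proof -
  have "card V = 4" using assms by simp
  then have "adj E z w" using complete_if_card_4 assms by simp
  moreover have "e = {z, w}" if e: "e \<in> E" "e \<inter> {x, y} = {}" for e
  proof -
    obtain a b where ab: "a \<in> V" "b \<in> V" "a \<noteq> b" "e = {a, b}"
      using simple e(1) unfolding simple_graph_def by metis
    then have "a \<in> {z, w}" "b \<in> {z, w}" using e(2) assms(1) by blast+
    then show ?thesis using ab(3,4) by auto
  qed
  moreover have "{z, w} \<inter> {x, y} = {}" using assms(2) by simp
  ultimately show ?thesis unfolding del_verts_E_def adj_def by blast
qed

text \<open>Deleting two vertices of K4 leaves a single edge, which has one face.\<close>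

lemma card_4_interior_pair:
  assumes "card V = 4"
  shows "\<exists>x y. interior_pair E x y"
proof -
  obtain x where "x \<in> V" using conn by (auto simp: connected_def)
  then obtain y where y: "adj E x y" using triangle by blast
  then have xy: "x \<in> V" "y \<in> V" "x \<noteq> y" using inV by auto
  obtain z w where zw: "V = {x, y, z, w}" "distinct [x, y, z, w]" using card_4_obtain[OF assms xy] by metis
  have "emb 1 (del_verts_E E {x, y})"
    unfolding del_verts_card_4[OF zw] using zw(2) by (intro emb_single_edge) simp
  moreover have "\<exists>t. adj E a t \<and> adj E b t" if "adj E a b" for a b
  proof -
    have ab: "a \<in> V" "b \<in> V" "a \<noteq> b" using inV that by auto
    obtain c d where "V = {a, b, c, d}" "distinct [a, b, c, d]" using card_4_obtain[OF assms ab] by metis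
    then have "adj E a c" "adj E b c" using complete_if_card_4[OF assms] by auto
    then show ?thesis by blast
  qed
  ultimately show ?thesis using y unfolding interior_pair_def by metis
qed

end

section \<open>Lifting from the smaller graph back over the diamond\<close>

context diamond_graph
begin

lemma mem_E: "e \<in> E \<longleftrightarrow> e \<in> insert_diamond E0 u v p q r s"
  by (rule arg_cong[where f = "\<lambda>F. e \<in> F", OF E_eq(1)])

lemma emb_del_verts_step:
  assumes "x \<in> V0" "y \<in> V0" "{u, v} \<inter> {x, y} = {}" "emb n (del_verts_E E0 {x, y})"
  shows "emb n (del_verts_E E {x, y})"
proof -
  have nD: "{p, q, r, s} \<inter> {x, y} = {}" using assms(1,2) unfolding V0_def D_def by blast
  note sg = simple_graph_del_verts[OF simple_E0, of "{x, y}"]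
  have "\<Union>E0 \<subseteq> V0" using simple_graph_finite(3)[OF simple_E0] by blast
  then have fr: "{p, q, r, s} \<inter> \<Union>(del_verts_E E0 {x, y}) = {}"
    unfolding V0_def D_def del_verts_E_def by blast
  have "{u, v} \<in> del_verts_E E0 {x, y}" using assms(3) by (simp add: del_verts_E_def E0_def)
  moreover have "del_verts_E E {x, y} = del_verts_E (insert_diamond E0 u v p q r s) {x, y}"
    by (rule arg_cong[where f = "\<lambda>F. del_verts_E F {x, y}", OF E_eq(1)])
  ultimately show ?thesis
    using emb_insert_diamond[OF assms(4) simple_graph_finite(2)[OF sg] simple_graph_loopless[OF sg] _ dist fr]
      del_verts_insert_diamond[OF assms(3) nD, of E0]
    by simp
qed

text \<open>Every edge at \<open>x\<close> or \<open>y\<close> lies in a triangle while the replaced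
  edge lies in none, so neither vertex is an end of it. For the same reason no triangle at
  \<open>x\<close> or \<open>y\<close> uses that edge, and all these triangles survive.\<close>

lemma interior_pair_step:
  assumes "interior_pair E0 x y" "\<And>w. \<not> (adj E0 u w \<and> adj E0 v w)"
  shows "interior_pair E x y"
proof -
  have xy: "adj E0 x y" "emb 1 (del_verts_E E0 {x, y})"
    and tr: "\<And>z w. z \<in> {x, y} \<Longrightarrow> adj E0 z w \<Longrightarrow> \<exists>t. adj E0 z t \<and> adj E0 w t"
    using assms(1) unfolding interior_pair_def by blast+
  have uv: "adj E0 u v" "adj E0 v u" by (simp_all add: adj_E0)
  have nz: "z \<noteq> u \<and> z \<noteq> v" if "z \<in> {x, y}" for z
    using tr[OF that] uv assms(2) by metis
  have xyV: "x \<in> V0" "y \<in> V0" using simple_graph_adj[OF simple_E0 xy(1)] by auto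
  have "adj E x y" using xy(1) nz by (auto simp: adj_E0)
  moreover have "emb 1 (del_verts_E E {x, y})"
    using emb_del_verts_step[OF xyV _ xy(2)] nz by auto
  moreover have "\<exists>t. adj E z t \<and> adj E w t" if z: "z \<in> {x, y}" and zw: "adj E z w" for z w
  proof -
    have zD: "z \<notin> D" using z xyV by (auto simp: V0_def)
    have "w \<notin> D" using nb_outside[OF zD _ zw] nz[OF z] by blast
    then have "adj E0 z w" using zD zw by (simp add: adj_E0)
    then obtain t where t: "adj E0 z t" "adj E0 w t" using tr[OF z] by blast
    have "adj E0 t z" "adj E0 w z" using t \<open>adj E0 z w\<close> adj_sym by metis+
    then have "\<not> (w = u \<and> t = v)" "\<not> (w = v \<and> t = u)"
      using t \<open>adj E0 z w\<close> assms(2)[of z] adj_sym by metis+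
    then have "adj E w t" "adj E z t" using t nz[OF z] by (auto simp: adj_E0)
    then show ?thesis by blast
  qed
  ultimately show ?thesis unfolding interior_pair_def by blast
qed

lemma interior_pair_card_4:
  assumes "card V0 = 4"
  shows "\<exists>x y. interior_pair E x y"
proof -
  interpret G0: good_graph V0 E0 by (rule good_E0)
  obtain x y where xy: "V0 = {u, v, x, y}" "distinct [u, v, x, y]"
    using G0.card_4_obtain[OF assms uvV0 u_neq_v] by metis
  then have xy': "V0 = {x, y, u, v}" "distinct [x, y, u, v]" by auto
  have "adj E0 x y" "adj E0 x u" "adj E0 x v" "adj E0 y u" "adj E0 y v"
    using G0.complete_if_card_4[OF assms] xy by auto
  then have a: "adj E x y" "adj E x u" "adj E x v" "adj E y u" "adj E y v"
    using xy(2) unfolding adj_E0 by auto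
  note a' = a[THEN adj_sym]
  have "emb 1 (del_verts_E E0 {x, y})"
    unfolding G0.del_verts_card_4[OF xy'] using u_neq_v by (rule emb_single_edge)
  then have "emb 1 (del_verts_E E {x, y})"
    using emb_del_verts_step[of x y 1] xy by auto
  moreover have "\<exists>t. adj E z t \<and> adj E w t" if z: "z \<in> {x, y}" and zw: "adj E z w" for z w
  proof -
    from z have "z = x \<and> (w = y \<or> w = u \<or> w = v) \<or> z = y \<and> (w = x \<or> w = u \<or> w = v)"
      using nb3[of x y u v w] nb3[of y x u v w] zw a a' xy(2) by auto
    then show ?thesis using a a' by blast
  qed
  ultimately show ?thesis using a(1) unfolding interior_pair_def by blast
qed

text \<open>The new diamond is one more class, of weight at least 1, and the crossing edge
  \<open>{u, v}\<close> is exchanged for the two links of the diamond. Both sides of the face bound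
  thus allow for exactly one more.\<close>

lemma unit_partition_step:
  assumes P: "unit_partition V0 E0 P h d" and nt: "\<And>w. \<not> (adj E0 u w \<and> adj E0 v w)"
  shows "\<exists>P'. unit_partition V E P' h (Suc d)"
proof -
  have P0: "0 < h" "card V0 = 3 * h + 4 * d"
    "2 * h + d \<le> (\<Sum>c\<in>P ` V0. even_weight V0 E0 P c)" "2 * card (cross_edges E0 P) \<le> 3 * h + 2 * d"
    "\<And>v. v \<in> V0 \<Longrightarrow> P v \<subseteq> V0" "\<And>x y. adj E0 x y \<Longrightarrow> P x = P y \<Longrightarrow> \<exists>t. adj E0 x t \<and> adj E0 y t"
    using P unfolding unit_partition_def by blast+
  define P' where "P' x = (if x \<in> D then D else P x)" for x
  have P'D: "P' x = D" if "x \<in> D" for x using that by (simp add: P'_def)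
  have P'N: "P' x = P x" if "x \<in> V0" for x using that by (simp add: P'_def V0_def)
  have Dne: "\<not> D \<subseteq> V0" using dist by (auto simp: D_def V0_def)
  have PneD: "P x \<noteq> D" if "x \<in> V0" for x using P0(5)[OF that] Dne by blast
  have finV0: "finite V0" "finite E0" using simple_graph_finite[OF simple_E0] by auto
  have V: "V = V0 \<union> D" "V0 \<inter> D = {}" using DV by (auto simp: V0_def)
  have memV: "x \<in> V \<longleftrightarrow> x \<in> V0 \<or> x \<in> D" for x using V by blast
  have cD: "card D = 4" using dist by (simp add: D_def)
  have e0V: "e \<subseteq> V0" if "e \<in> E0" for e using simple_graph_finite(3)[OF simple_E0] that by blast
  have uvE: "{u, v} \<in> E0" by (simp add: E0_def)
  have "adj E0 u v" by (simp add: adj_E0)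
  \<comment> \<open>An edge within a class lies in a triangle, and \<open>{u, v}\<close> does
    not.\<close>
  then have Puv: "P u \<noteq> P v" using P0(6) nt by blast
  have P'uv: "P' u = P u" "P' v = P v" using P'N uvV0 by auto
  have img: "P' ` V = insert D (P ` V0)"
  proof -
    have "P' ` V0 = P ` V0" using P'N by (auto simp: image_iff)
    moreover have "P' ` D = {D}" using P'D by (auto simp: D_def)
    moreover have "P' ` V = P' ` V0 \<union> P' ` D" by (metis V(1) image_Un)
    ultimately show ?thesis by simp
  qed
  have imge: "P' ` e = P ` e" if "e \<subseteq> V0" for e using that P'N by (intro image_cong) auto
  have newE: "e = {u, p} \<or> e = {s, v} \<or> e \<subseteq> D" if "e \<in> E" "e \<notin> E0" for e
    using that unfolding mem_E insert_diamond_def diamond_edges_def D_def by blast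
  have oldE: "e \<in> E0 \<and> e \<noteq> {u, v} \<longleftrightarrow> e \<in> E \<and> e \<in> E0" for e
  proof -
    have "{u, v} \<notin> E" using nadj_uv by (simp add: adj_def)
    then show ?thesis unfolding mem_E insert_diamond_def by blast
  qed
  have pD: "p \<in> D" "s \<in> D" by (simp_all add: D_def)
  have sumw: "even_weight V E P' c = even_weight V0 E0 P c" if c: "c \<in> P ` V0" for c
  proof -
    have cD: "c \<noteq> D" using c PneD by blast
    have "{x \<in> V. P' x = c} = {x \<in> V0. P x = c}" using cD P'D P'N memV by auto
    moreover have "{e \<in> E. P' ` e = {c}} = {e \<in> E0. P ` e = {c}}"
    proof (intro equalityI subsetI)
      fix e assume e: "e \<in> {e \<in> E. P' ` e = {c}}"
      have "e \<in> E0"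
      proof (rule ccontr)
        assume "e \<notin> E0"
        then have "e = {u, p} \<or> e = {s, v} \<or> e \<subseteq> D" using newE e by blast
        moreover have "e \<noteq> {}" using e by auto
        ultimately have "\<exists>x\<in>e. x \<in> D" using pD by auto
        then have "D \<in> P' ` e" using P'D by (metis imageI)
        then show False using e cD by simp
      qed
      then show "e \<in> {e \<in> E0. P ` e = {c}}" using e imge e0V by auto
    next
      fix e assume e: "e \<in> {e \<in> E0. P ` e = {c}}"
      then have "e \<noteq> {u, v}" using Puv by auto
      then have "e \<in> E" using e oldE by blast
      then show "e \<in> {e \<in> E. P' ` e = {c}}" using e imge e0V by auto
    qed
    ultimately show ?thesis by (simp add: even_weight_def)
  qed
  have "D \<notin> P ` V0" using PneD by blast
  then have "(\<Sum>c\<in>P' ` V. even_weight V E P' c) = even_weight V E P' D + (\<Sum>c\<in>P ` V0. even_weight V0 E0 P c)"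
    unfolding img using finV0 sumw by simp
  then have w: "2 * h + Suc d \<le> (\<Sum>c\<in>P' ` V. even_weight V E P' c)"
    using P0(3) even_weight_pos[of V E P' D] by linarith
  have "cross_edges E P' \<subseteq> (cross_edges E0 P - {{u, v}}) \<union> {{u, p}, {s, v}}"
  proof
    fix e assume e: "e \<in> cross_edges E P'"
    show "e \<in> (cross_edges E0 P - {{u, v}}) \<union> {{u, p}, {s, v}}"
    proof (cases "e \<in> E0")
      case True
      then show ?thesis using e oldE imge[OF e0V[OF True]] by (auto simp: cross_edges_def)
    next
      case False
      then have "e = {u, p} \<or> e = {s, v} \<or> e \<subseteq> D" using newE e by (auto simp: cross_edges_def)
      moreover have "\<not> e \<subseteq> D"
      proof
        assume eD: "e \<subseteq> D"
        have "e \<noteq> {}" using e simple unfolding cross_edges_def simple_graph_def by auto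
        then have "P' ` e = {D}" using eD P'D by (auto simp: image_iff)
        then show False using e by (auto simp: cross_edges_def)
      qed
      ultimately show ?thesis by blast
    qed
  qed
  moreover have fc: "finite (cross_edges E0 P)" using finV0 by (auto simp: cross_edges_def)
  ultimately have "card (cross_edges E P') \<le> card ((cross_edges E0 P - {{u, v}}) \<union> {{u, p}, {s, v}})"
    by (intro card_mono) auto
  also have "\<dots> \<le> card (cross_edges E0 P - {{u, v}}) + card {{u, p}, {s, v}}" by (rule card_Un_le)
  also have "card {{u, p}, {s, v}} \<le> 2" by (simp add: card_insert_if)
  also have "card (cross_edges E0 P - {{u, v}}) = card (cross_edges E0 P) - 1"
    using Puv uvE fc by (subst card_Diff_singleton) (auto simp: cross_edges_def)
  finally have "card (cross_edges E P') \<le> card (cross_edges E0 P) - 1 + 2" by simp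
  moreover have "card (cross_edges E0 P) \<ge> 1"
  proof -
    have "{u, v} \<in> cross_edges E0 P" using Puv uvE by (auto simp: cross_edges_def)
    then show ?thesis using fc by (simp add: Suc_le_eq card_gt_0_iff) blast
  qed
  ultimately have "card (cross_edges E P') \<le> card (cross_edges E0 P) + 1" by arith
  then have cr: "2 * card (cross_edges E P') \<le> 3 * h + 2 * Suc d" using P0(4) by presburger
  have "card V = card V0 + card D" using card_Un_disjoint[of V0 D] finV0 V by (simp add: D_def)
  then have "card V = 3 * h + 4 * Suc d" using cD P0(2) by simp
  moreover have "P' x \<subseteq> V" if "x \<in> V" for x
  proof (cases "x \<in> D")
    case True
    then show ?thesis using DV by (simp add: P'D)
  next
    case False
    then have "x \<in> V0" using that by (simp add: V0_def)
    then show ?thesis using P'N[of x] P0(5)[of x] memV by auto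
  qed
  moreover have "\<exists>t. adj E x t \<and> adj E y t" if xy: "adj E x y" "P' x = P' y" for x y
  proof (cases "x \<in> D")
    case True
    then have "y \<in> D" using xy P'D P'N PneD inV(2) by (metis Un_iff V(1))
    have "(\<exists>t. adj E x t \<and> adj E y t)" if "x \<in> D" "y \<in> D" "adj E x y"
    proof -
      have "x = p \<and> (y = q \<or> y = r) \<or> x = q \<and> (y = p \<or> y = r \<or> y = s) \<or>
          x = r \<and> (y = p \<or> y = q \<or> y = s) \<or> x = s \<and> (y = q \<or> y = r)"
        using that nb_p[of y] nb_q[of y] nb_r[of y] nb_s[of y] uvD unfolding D_def by auto
      then show ?thesis
        using pq pr qr qs rs pq[THEN adj_sym] pr[THEN adj_sym] qr[THEN adj_sym] qs[THEN adj_sym] rs[THEN adj_sym]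
        by blast
    qed
    then show ?thesis using True \<open>y \<in> D\<close> xy by blast
  next
    case False
    then have x0: "x \<in> V0" using inV(1)[OF xy(1)] by (simp add: V0_def)
    then have yD: "y \<notin> D" using xy P'D P'N PneD by metis
    then have y0: "y \<in> V0" using inV(2)[OF xy(1)] by (simp add: V0_def)
    have a0: "adj E0 x y" using xy(1) False yD by (simp add: adj_E0)
    then obtain t where t: "adj E0 x t" "adj E0 y t" using P0(6) xy(2) P'N x0 y0 by metis
    have "\<not> (x = u \<and> t = v)" "\<not> (x = v \<and> t = u)" "\<not> (y = u \<and> t = v)" "\<not> (y = v \<and> t = u)"
      using t a0 nt adj_sym by metis+
    then have "adj E x t" "adj E y t" using t unfolding adj_E0 by blast+
    then show ?thesis by blast
  qed
  ultimately show ?thesis using P0(1) w cr unfolding unit_partition_def by blast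
qed

end

section \<open>Cubic graphs partitioned into triangles\<close>

text \<open>The situation when no diamond is left to reduce: each edge lies in at most one triangle,
  so the triangle at a vertex is unique.\<close>

locale triangle_graph = good_graph +
  assumes no_shared_edge:
    "\<And>p q r s. adj E p q \<Longrightarrow> adj E p r \<Longrightarrow> adj E q r \<Longrightarrow> adj E q s \<Longrightarrow> adj E r s \<Longrightarrow> p = s"
begin

definition tri :: "'a \<Rightarrow> 'a set" where
  "tri v = insert v {w. adj E v w \<and> (\<exists>t. adj E v t \<and> adj E w t)}"

text \<open>The third neighbour \<open>c\<close> shares no triangle with \<open>v\<close>: such a
  triangle would use \<open>a\<close> or \<open>b\<close> and so be a second one on the edge from
  \<open>v\<close> to it.\<close>

lemma tri_obtain:
  assumes "v \<in> V"
  obtains a b c where "adj E v a" "adj E v b" "adj E a b" "adj E v c" "a \<noteq> b" "c \<noteq> a" "c \<noteq> b"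
    "tri v = {v, a, b}" "\<And>w. adj E v w \<Longrightarrow> w = a \<or> w = b \<or> w = c"
proof -
  obtain a b where ab: "adj E v a" "adj E v b" "adj E a b" using triangle assms by blast
  have abn: "a \<noteq> b" using ab irr by metis
  obtain c where c: "adj E v c" "c \<noteq> a" "c \<noteq> b" using third[OF ab(1,2) abn] by blast
  have nb: "w = a \<or> w = b \<or> w = c" if "adj E v w" for w using nb3[of v a b c w] ab c abn that by metis
  have "\<not> adj E c a" using no_shared_edge[of c a v b] ab c adj_sym by metis
  moreover have "\<not> adj E c b" using no_shared_edge[of c b v a] ab c adj_sym by metis
  ultimately have "\<not> (\<exists>t. adj E v t \<and> adj E c t)" using nb irr by metis
  then have "tri v = {v, a, b}"
    unfolding tri_def using ab adj_sym[OF ab(3)] nb by auto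
  then show ?thesis using that ab c abn nb by blast
qed

lemma card_tri: "v \<in> V \<Longrightarrow> card (tri v) = 3"
  using tri_obtain[of v] inV(3) by (metis card_3_iff)

lemma tri_self: "v \<in> tri v"
  by (simp add: tri_def)

lemma tri_subset: "v \<in> V \<Longrightarrow> tri v \<subseteq> V"
  using inV unfolding tri_def by auto

lemma tri_eq:
  assumes "x \<in> tri v" "v \<in> V"
  shows "tri x = tri v"
proof (cases "x = v")
  case False
  then obtain t where t: "adj E v x" "adj E v t" "adj E x t" using assms by (auto simp: tri_def)
  note ts = t[THEN adj_sym]
  have xV: "x \<in> V" using t inV by blast
  have nx: "t \<noteq> x" "t \<noteq> v" using t irr by metis+
  have "{v, x, t} \<subseteq> tri v" using t ts by (auto simp: tri_def)
  moreover have "{x, v, t} \<subseteq> tri x" using t ts by (auto simp: tri_def)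
  moreover have "card {v, x, t} = 3" "card {x, v, t} = 3" using False nx by auto
  moreover have "finite (tri v)" "finite (tri x)"
    using tri_subset[OF assms(2)] tri_subset[OF xV] fin(1) finite_subset by auto
  ultimately have "{v, x, t} = tri v" "{x, v, t} = tri x"
    using card_subset_eq[of "tri v" "{v, x, t}"] card_subset_eq[of "tri x" "{x, v, t}"]
      card_tri[OF assms(2)] card_tri[OF xV] by simp_all
  then show ?thesis by blast
qed simp

lemma tri_eq_iff: "v \<in> V \<Longrightarrow> tri x = tri v \<longleftrightarrow> x \<in> tri v"
  using tri_eq tri_self by metis

lemma tri_adj:
  assumes "v \<in> V" "x \<in> tri v" "x \<noteq> v"
  shows "adj E v x"
  using assms by (auto simp: tri_def)

lemma mate_ex:
  assumes "v \<in> V"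
  shows "\<exists>!c. adj E v c \<and> tri c \<noteq> tri v"
proof -
  obtain a b c where abc: "adj E v a" "adj E v b" "adj E v c" "c \<noteq> a" "c \<noteq> b"
    "tri v = {v, a, b}" "\<And>w. adj E v w \<Longrightarrow> w = a \<or> w = b \<or> w = c" by (rule tri_obtain[OF assms]) blast
  have "c \<noteq> v" using abc irr by metis
  then have "c \<notin> tri v" using abc(4,5,6) by simp
  then have "tri c \<noteq> tri v" using tri_eq_iff[OF assms] by blast
  moreover have "a \<in> tri v" "b \<in> tri v" using abc(6) by simp_all
  then have "tri a = tri v" "tri b = tri v" using tri_eq_iff[OF assms] by blast+
  ultimately show ?thesis using abc by metis
qed

definition mate :: "'a \<Rightarrow> 'a" where
  "mate v = (THE c. adj E v c \<and> tri c \<noteq> tri v)"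

lemma mate:
  assumes "v \<in> V"
  shows "adj E v (mate v)" "tri (mate v) \<noteq> tri v" "mate v \<in> V"
  using theI'[OF mate_ex[OF assms]] inV(2) unfolding mate_def[symmetric] by blast+

lemma mate_unique: "adj E v w \<Longrightarrow> tri w \<noteq> tri v \<Longrightarrow> w = mate v"
  using mate_ex[of v] mate[of v] inV(1) by metis

lemma mate_mate: "v \<in> V \<Longrightarrow> mate (mate v) = v"
  using mate_unique[of "mate v" v] mate adj_sym by metis

text \<open>The graph is determined by the partition \<open>tri\<close> and the involution
  \<open>mate\<close>, so identifying it with a model only requires matching these two.\<close>

lemma adj_iff:
  assumes "v \<in> V" "w \<in> V"
  shows "adj E v w \<longleftrightarrow> v \<noteq> w \<and> tri v = tri w \<or> w = mate v"
  using assms mate tri_adj[of v w] tri_eq_iff[of v w] mate_unique[of v w] irr tri_self by metis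

lemma card_V_tri: "card V = 3 * card (tri ` V)"
proof -
  have "\<Union>(tri ` V) = V" using tri_subset tri_self by blast
  moreover have "3 * card (tri ` V) = card (\<Union>(tri ` V))"
  proof (rule card_partition)
    show "finite (tri ` V)" using fin by simp
    show "finite (\<Union>(tri ` V))" using \<open>\<Union>(tri ` V) = V\<close> fin by simp
    show "card c = 3" if "c \<in> tri ` V" for c using that card_tri by auto
    show "c1 \<inter> c2 = {}" if c: "c1 \<in> tri ` V" "c2 \<in> tri ` V" "c1 \<noteq> c2" for c1 c2
    proof (rule ccontr)
      assume "c1 \<inter> c2 \<noteq> {}"
      then obtain x where "x \<in> c1" "x \<in> c2" by blast
      then show False using c tri_eq by (metis imageE)
    qed
  qed
  ultimately show ?thesis by simp
qed

lemma inner_edges: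
  assumes "v \<in> V"
  shows "card {e \<in> E. tri ` e = {tri v}} = 3"
proof -
  obtain a b where ab: "adj E v a" "adj E v b" "adj E a b" "a \<noteq> b" "tri v = {v, a, b}"
    by (rule tri_obtain[OF assms]) blast
  have "a \<in> tri v" "b \<in> tri v" using ab(5) by simp_all
  then have tr: "tri a = tri v" "tri b = tri v" using tri_eq_iff[OF assms] by blast+
  have n: "a \<noteq> v" "b \<noteq> v" using ab irr by metis+
  have "{e \<in> E. tri ` e = {tri v}} = {{v, a}, {v, b}, {a, b}}"
  proof (intro equalityI subsetI)
    fix e assume e: "e \<in> {e \<in> E. tri ` e = {tri v}}"
    then obtain x y where xy: "x \<in> V" "y \<in> V" "x \<noteq> y" "e = {x, y}"
      using simple unfolding simple_graph_def by (metis (no_types, lifting) mem_Collect_eq)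
    then have "x \<in> tri v" "y \<in> tri v" using e tri_eq_iff[OF assms] by auto
    then show "e \<in> {{v, a}, {v, b}, {a, b}}" using xy ab(5) by auto
  next
    fix e assume "e \<in> {{v, a}, {v, b}, {a, b}}"
    then show "e \<in> {e \<in> E. tri ` e = {tri v}}" using ab tr unfolding adj_def by auto
  qed
  moreover have "card {{v, a}, {v, b}, {a, b}} = 3" using n ab(4) by (auto simp: doubleton_eq_iff card_insert_if)
  ultimately show ?thesis by simp
qed

text \<open>A triangle has three vertices and three edges, an even total, so its weight is 2. Of the
  9h/2 edges, 3h lie in triangles, and 3h/2 remain.\<close>

lemma unit_partition_tri: "unit_partition V E tri (card (tri ` V)) 0"
proof -
  let ?h = "card (tri ` V)"
  have V0: "V \<noteq> {}" using conn by (simp add: connected_def)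
  have "even_weight V E tri c = 2" if c: "c \<in> tri ` V" for c
  proof -
    obtain v where v: "v \<in> V" "c = tri v" using c by blast
    have "{x \<in> V. tri x = tri v} = tri v" using v tri_subset tri_eq_iff tri_self by blast
    then show ?thesis using inner_edges card_tri v by (simp add: even_weight_def)
  qed
  then have w: "(\<Sum>c\<in>tri ` V. even_weight V E tri c) = 2 * ?h" by simp
  have Eeq: "E = cross_edges E tri \<union> (\<Union>c\<in>tri ` V. {e \<in> E. tri ` e = {c}})" (is "_ = _ \<union> ?I")
  proof -
    have "c \<in> tri ` V" if e: "e \<in> E" "tri ` e = {c}" for e c
      using simple_graph_finite(3)[OF simple e(1)] e(2) by (metis image_mono insert_subset)
    note c = this
    show ?thesis
    proof (intro equalityI subsetI)
      fix e assume e: "e \<in> E"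
      show "e \<in> cross_edges E tri \<union> ?I"
      proof (cases "\<exists>c. tri ` e = {c}")
        case True
        then obtain c0 where "tri ` e = {c0}" by blast
        then show ?thesis using c[OF e] e by (intro UnI2 UN_I[of c0]) simp_all
      next
        case False
        then show ?thesis using e by (simp add: cross_edges_def)
      qed
    next
      fix e assume "e \<in> cross_edges E tri \<union> ?I"
      then show "e \<in> E" by (auto simp: cross_edges_def)
    qed
  qed
  have "cross_edges E tri \<inter> ?I = {}" by (auto simp: cross_edges_def)
  moreover have "finite (cross_edges E tri)" "finite ?I" using fin by (auto simp: cross_edges_def)
  ultimately have "card (cross_edges E tri \<union> ?I) = card (cross_edges E tri) + card ?I"
    by (simp only: card_Un_disjoint)
  from trans[OF arg_cong[OF Eeq, of card] this]
  have "card E = card (cross_edges E tri) + card ?I" .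
  moreover have "card ?I = (\<Sum>c\<in>tri ` V. card {e \<in> E. tri ` e = {c}})"
    by (rule card_UN_disjoint) (use fin in auto)
  moreover have "(\<Sum>c\<in>tri ` V. card {e \<in> E. tri ` e = {c}}) = 3 * ?h"
  proof -
    have "(\<Sum>c\<in>tri ` V. card {e \<in> E. tri ` e = {c}}) = (\<Sum>c\<in>tri ` V. 3)"
      by (rule sum.cong) (auto simp: inner_edges)
    then show ?thesis by simp
  qed
  moreover have "2 * card E = 3 * card V" using handshake[OF simple cubic] .
  ultimately have "2 * card (cross_edges E tri) = 3 * ?h" using card_V_tri by simp
  moreover have "0 < ?h" using V0 fin by (simp add: card_gt_0_iff)
  moreover have "\<exists>t. adj E x t \<and> adj E y t" if "adj E x y" "tri x = tri y" for x y
  proof -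
    have "y \<in> tri x" using that tri_self by metis
    then show ?thesis using that irr by (auto simp: tri_def)
  qed
  ultimately show ?thesis
    unfolding unit_partition_def using w card_V_tri tri_subset by simp
qed

text \<open>\<open>t\<close> numbers the triangles, and \<alpha> chooses for each base edge the
  vertex at its first end, whose mate is then at the second. The model has 12 labels and
  \<open>V\<close> has 12 vertices, so distinctness of the chosen vertices makes the labelling
  bijective, and \<open>adj_iff\<close> does the rest.\<close>

lemma base_models:
  assumes t: "inj_on t {..<4}" and fs: "\<And>j. j < 6 \<Longrightarrow> fst (B j) < (4::nat) \<and> snd (B j) < 4"
    and \<alpha>: "\<And>j. j < 6 \<Longrightarrow> \<alpha> j \<in> V \<and> tri (\<alpha> j) = t (fst (B j)) \<and> tri (mate (\<alpha> j)) = t (snd (B j))"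
    and inj: "\<And>i j. i < j \<Longrightarrow> j < 6 \<Longrightarrow> \<alpha> i \<noteq> \<alpha> j \<and> \<alpha> i \<noteq> mate (\<alpha> j)"
    and card: "card V = 12"
  shows "\<exists>g. models B (\<lambda>_. 0) g V E"
proof -
  define g where "g x = (case x of Tri j s \<Rightarrow> if s = 0 then \<alpha> j else mate (\<alpha> j) | Dia j i l \<Rightarrow> undefined)" for x
  have g: "g (Tri j 0) = \<alpha> j" "g (Tri j 1) = mate (\<alpha> j)" "g (Tri j (Suc 0)) = mate (\<alpha> j)" for j by (simp_all add: g_def)
  have FV: "FV (\<lambda>_. 0) = {Tri j s | j s. j < 6 \<and> s < 2}" by (simp add: FV_def)
  have \<alpha>V: "\<alpha> j \<in> V" if "j < 6" for j using \<alpha> that by blast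
  have ne: "\<alpha> i \<noteq> \<alpha> j" "\<alpha> i \<noteq> mate (\<alpha> j)" "mate (\<alpha> i) \<noteq> \<alpha> j" "mate (\<alpha> i) \<noteq> mate (\<alpha> j)" if "i < 6" "j < 6" "i \<noteq> j" for i j
    using inj[of i j] inj[of j i] that \<alpha>V mate_mate by (metis nat_neq_iff)+
  have ne0: "\<alpha> i \<noteq> mate (\<alpha> i)" if "i < 6" for i using mate[OF \<alpha>V[OF that]] irr by metis
  have s2: "s = 0 \<or> s = 1" if "s < 2" for s :: nat using that by linarith
  have gV: "g x \<in> V" if x: "x \<in> FV (\<lambda>_. 0)" for x
  proof -
    obtain j s where "x = Tri j s" "j < 6" "s < 2" using x unfolding FV by blast
    then show ?thesis using s2[of s] g \<alpha>V mate(3) by auto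
  qed
  have injg: "inj_on g (FV (\<lambda>_. 0))"
  proof (rule inj_onI)
    fix x y assume "x \<in> FV (\<lambda>_. 0)" "y \<in> FV (\<lambda>_. 0)" and e: "g x = g y"
    then obtain j s j' s' where x: "x = Tri j s" "j < 6" "s < 2" and y: "y = Tri j' s'" "j' < 6" "s' < 2"
      unfolding FV by blast
    show "x = y"
    proof (cases "j = j'")
      case True
      then show ?thesis using s2[OF x(3)] s2[OF y(3)] x y e g ne0[OF x(2)] by metis
    next
      case False
      then show ?thesis using s2[OF x(3)] s2[OF y(3)] x y e g ne[OF x(2) y(2)] by metis
    qed
  qed
  have "FV (\<lambda>_. 0) = (\<lambda>(j, s). Tri j s) ` ({..<6} \<times> {..<2})" unfolding FV by auto
  moreover have "inj_on (\<lambda>(j, s). Tri j s) ({..<6} \<times> {..<2})" by (auto simp: inj_on_def)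
  ultimately have "card (FV (\<lambda>_. 0)) = 12" by (simp add: card_image)
  then have "card (g ` FV (\<lambda>_. 0)) = card V" using injg card by (simp add: card_image)
  then have gim: "g ` FV (\<lambda>_. 0) = V" using gV fin by (metis card_subset_eq image_subsetI)
  have trig: "tri (g (Tri j s)) = t (endpt B j s)" if "j < 6" "s < 2" for j s
    using s2[OF that(2)] \<alpha>[OF that(1)] g by (auto simp: endpt_def)
  have e4: "endpt B j s < 4" if "j < 6" for j s using fs[OF that] by (simp add: endpt_def)
  have tinj: "t (endpt B j s) = t (endpt B j' s') \<longleftrightarrow> endpt B j s = endpt B j' s'" if "j < 6" "j' < 6" for j s j' s'
    using t e4 that by (auto simp: inj_on_def)
  have mateg: "g (Tri j' s') = mate (g (Tri j s)) \<longleftrightarrow> j = j' \<and> s \<noteq> s'" if j: "j < 6" "j' < 6" "s < 2" "s' < 2" for j s j' s'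
  proof (cases "j = j'")
    case True
    have "mate (\<alpha> j) \<noteq> \<alpha> j" "mate (mate (\<alpha> j)) = \<alpha> j" using ne0[OF j(1)] mate_mate \<alpha>V j by metis+
    then show ?thesis using True s2[OF j(3)] s2[OF j(4)] g by auto
  next
    case False
    have "mate (mate (\<alpha> j)) = \<alpha> j" using mate_mate \<alpha>V j by metis
    then show ?thesis using False ne[OF j(1,2)] s2[OF j(3)] s2[OF j(4)] g by metis
  qed
  have GE0: "{Tri j s, Tri j' s'} \<in> GE B (\<lambda>_. 0) \<longleftrightarrow>
      (j, s) \<noteq> (j', s') \<and> endpt B j s = endpt B j' s' \<or> j = j' \<and> s \<noteq> s'"
    if j: "j < 6" "j' < 6" "s < 2" "s' < 2" for j s j' s'
  proof -
    have "conn (\<lambda>_. 0) a 0 = {Tri a 0, Tri a 1}" for a by (simp add: conn_def lport_def rport_def)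
    then have "GE B (\<lambda>_. 0) = tri_edges B \<union> {{Tri j 0, Tri j 1} | j. j < 6}" unfolding GE_def by auto
    moreover have "{Tri j s, Tri j' s'} \<in> tri_edges B \<longleftrightarrow> (j, s) \<noteq> (j', s') \<and> endpt B j s = endpt B j' s'"
    proof
      assume "{Tri j s, Tri j' s'} \<in> tri_edges B"
      then obtain a b a' b' where "{Tri j s, Tri j' s'} = {Tri a b, Tri a' b'}" "(a, b) \<noteq> (a', b')"
        "endpt B a b = endpt B a' b'" unfolding tri_edges_def by blast
      then show "(j, s) \<noteq> (j', s') \<and> endpt B j s = endpt B j' s'" by (auto simp: doubleton_eq_iff)
    next
      assume "(j, s) \<noteq> (j', s') \<and> endpt B j s = endpt B j' s'"
      then show "{Tri j s, Tri j' s'} \<in> tri_edges B" unfolding tri_edges_def using j by blast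
    qed
    moreover have "{Tri j s, Tri j' s'} \<in> {{Tri j 0, Tri j 1} | j. j < 6} \<longleftrightarrow> j = j' \<and> s \<noteq> s'"
      using j s2[OF j(3)] s2[OF j(4)] by (auto simp: doubleton_eq_iff)
    ultimately show ?thesis by blast
  qed
  have key: "{g x, g y} \<in> E \<longleftrightarrow> {x, y} \<in> GE B (\<lambda>_. 0)" if xy: "x \<in> FV (\<lambda>_. 0)" "y \<in> FV (\<lambda>_. 0)" for x y
  proof -
    obtain j s j' s' where x: "x = Tri j s" "j < 6" "s < 2" and y: "y = Tri j' s'" "j' < 6" "s' < 2"
      using xy unfolding FV by blast
    have "g x = g y \<longleftrightarrow> (j, s) = (j', s')" using inj_on_eq_iff[OF injg xy] x(1) y(1) by simp
    then show ?thesis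
      using adj_iff[OF gV[OF xy(1)] gV[OF xy(2)]] GE0[OF x(2) y(2) x(3) y(3)] mateg[OF x(2) y(2) x(3) y(3)]
        trig x y tinj[OF x(2) y(2)] unfolding adj_def by metis
  qed
  have "(`) g ` GE B (\<lambda>_. 0) = E"
  proof (intro equalityI subsetI)
    fix e assume "e \<in> (`) g ` GE B (\<lambda>_. 0)"
    then obtain e' where e': "e' \<in> GE B (\<lambda>_. 0)" "e = g ` e'" by blast
    then obtain x y where "x \<in> FV (\<lambda>_. 0)" "y \<in> FV (\<lambda>_. 0)" "e' = {x, y}"
      using simple_graph_GE[of "\<lambda>_. 0" B] unfolding simple_graph_def by blast
    then show "e \<in> E" using key e' by simp
  next
    fix e assume e: "e \<in> E"
    then obtain a b where "a \<in> V" "b \<in> V" "e = {a, b}" using simple unfolding simple_graph_def by blast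
    then obtain x y where xy: "x \<in> FV (\<lambda>_. 0)" "y \<in> FV (\<lambda>_. 0)" "e = {g x, g y}" using gim by blast
    then have "{x, y} \<in> GE B (\<lambda>_. 0)" using key e by simp
    moreover have "e = g ` {x, y}" using xy by simp
    ultimately show "e \<in> (`) g ` GE B (\<lambda>_. 0)" by blast
  qed
  then show ?thesis using injg gim unfolding models_def by blast
qed

lemma tri_three:
  assumes "x \<in> V" "y \<in> V" "z \<in> V" "tri y = tri x" "tri z = tri x" "x \<noteq> y" "x \<noteq> z" "y \<noteq> z" "tri w = tri x"
  shows "w = x \<or> w = y \<or> w = z"
proof -
  have "{x, y, z} \<subseteq> tri x" using assms tri_self by (metis empty_subsetI insert_subset)
  moreover have "card {x, y, z} = 3" using assms by simp
  moreover have "finite (tri x)" using tri_subset[OF assms(1)] fin(1) finite_subset by blast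
  ultimately have "{x, y, z} = tri x" using card_tri[OF assms(1)] card_subset_eq by metis
  then show ?thesis using assms(9) tri_self[of w] by auto
qed

lemma tri_others:
  assumes "x \<in> V"
  obtains y z where "y \<in> V" "z \<in> V" "tri y = tri x" "tri z = tri x" "x \<noteq> y" "x \<noteq> z" "y \<noteq> z"
proof -
  obtain a b where ab: "adj E x a" "adj E x b" "a \<noteq> b" "tri x = {x, a, b}"
    by (rule tri_obtain[OF assms]) blast
  have "a \<in> tri x" "b \<in> tri x" using ab(4) by simp_all
  then have "tri a = tri x" "tri b = tri x" using tri_eq_iff[OF assms] by blast+
  moreover have "x \<noteq> a" "x \<noteq> b" using ab irr by metis+
  moreover have "a \<in> V" "b \<in> V" using ab inV by blast+
  ultimately show ?thesis using that ab(3) by blast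
qed

lemma mate_inj: "x \<in> V \<Longrightarrow> y \<in> V \<Longrightarrow> mate x = mate y \<Longrightarrow> x = y"
  using mate_mate by metis

text \<open>Connectedness passes to the multigraph obtained by contracting the triangles.\<close>

lemma closed_tri:
  assumes "c \<in> C" "C \<subseteq> tri ` V" "\<And>x. x \<in> V \<Longrightarrow> tri x \<in> C \<Longrightarrow> tri (mate x) \<in> C"
  shows "C = tri ` V"
proof -
  obtain v where v: "v \<in> V" "c = tri v" using assms by blast
  have "{x \<in> V. tri x \<in> C} = V"
  proof (rule closed_eq[of v])
    show "v \<in> {x \<in> V. tri x \<in> C}" using v assms(1) by blast
    fix a b assume a: "a \<in> {x \<in> V. tri x \<in> C}" and ab: "adj E a b"
    then have "tri a = tri b \<or> b = mate a" using adj_iff[of a b] inV[OF ab] by blast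
    then have "tri b \<in> C" using a assms(3)[of a] by auto
    then show "b \<in> {x \<in> V. tri x \<in> C}" using inV(2)[OF ab] by blast
  qed blast
  then show ?thesis using assms(2) by blast
qed

text \<open>The three edges leaving a triangle go to three different triangles, which are all the
  others; so any two triangles are joined, and contraction gives K4.\<close>

lemma K4_case:
  assumes four: "card (tri ` V) = 4"
    and dif: "\<And>x y. x \<in> V \<Longrightarrow> y \<in> V \<Longrightarrow> x \<noteq> y \<Longrightarrow> tri x = tri y \<Longrightarrow> tri (mate x) \<noteq> tri (mate y)"
  shows "\<exists>g. models K4_base (\<lambda>_. 0) g V E"
proof -
  have hit: "\<exists>x\<in>V. tri x = c \<and> tri (mate x) = c'" if cc: "c \<in> tri ` V" "c' \<in> tri ` V" "c \<noteq> c'" for c c'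
  proof -
    obtain x where x: "x \<in> V" "c = tri x" using cc by blast
    obtain y z where yz: "y \<in> V" "z \<in> V" "tri y = tri x" "tri z = tri x" "x \<noteq> y" "x \<noteq> z" "y \<noteq> z"
      by (rule tri_others[OF x(1)])
    let ?S = "{tri (mate x), tri (mate y), tri (mate z)}"
    have "card ?S = 3" using dif[of x y] dif[of x z] dif[of y z] x yz by simp
    moreover have "?S \<subseteq> tri ` V - {c}"
      using mate[OF x(1)] mate[OF yz(1)] mate[OF yz(2)] x yz by auto
    moreover have "card (tri ` V - {c}) = 3" using four cc(1) by (simp add: fin)
    ultimately have "?S = tri ` V - {c}" using fin card_subset_eq by (metis finite_Diff finite_imageI)
    then have "c' \<in> ?S" using cc by blast
    then show ?thesis using x yz by auto
  qed
  obtain t where t: "bij_betw t {..<4::nat} (tri ` V)"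
    using ex_bij_betw_nat_finite[of "tri ` V"] four fin by (auto simp: atLeast0LessThan)
  have tin: "t i \<in> tri ` V" if "i < 4" for i using t that by (auto simp: bij_betw_def)
  have tinj: "t i = t j \<longleftrightarrow> i = j" if "i < 4" "j < 4" for i j
    using t that by (auto simp: bij_betw_def inj_on_def)
  define \<alpha> where "\<alpha> j = (SOME x. x \<in> V \<and> tri x = t (fst (K4_base j)) \<and> tri (mate x) = t (snd (K4_base j)))" for j
  have six: "j = 0 \<or> j = 1 \<or> j = 2 \<or> j = 3 \<or> j = 4 \<or> j = 5" if "j < 6" for j :: nat using that by linarith
  have B: "fst (K4_base j) < 4 \<and> snd (K4_base j) < 4 \<and> fst (K4_base j) \<noteq> snd (K4_base j)" if "j < 6" for j
    using six[OF that] by (auto simp: K4_base_def)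
  have \<alpha>: "\<alpha> j \<in> V \<and> tri (\<alpha> j) = t (fst (K4_base j)) \<and> tri (mate (\<alpha> j)) = t (snd (K4_base j))" if "j < 6" for j
    unfolding \<alpha>_def
    by (rule someI_ex) (use hit[of "t (fst (K4_base j))" "t (snd (K4_base j))"] tin tinj B[OF that] in blast)
  show ?thesis
  proof (rule base_models[where t = t and \<alpha> = \<alpha>])
    show "inj_on t {..<4}" using t by (simp add: bij_betw_def)
    show "card V = 12" using card_V_tri four by simp
    fix i j :: nat assume ij: "i < j" "j < 6"
    then have i6: "i < 6" by simp
    have "(fst (K4_base i), snd (K4_base i)) \<noteq> (fst (K4_base j), snd (K4_base j))"
      "(fst (K4_base i), snd (K4_base i)) \<noteq> (snd (K4_base j), fst (K4_base j))"
      using six[OF i6] six[OF ij(2)] ij(1) by (elim disjE; simp add: K4_base_def)+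
    then show "\<alpha> i \<noteq> \<alpha> j \<and> \<alpha> i \<noteq> mate (\<alpha> j)"
      using \<alpha>[OF i6] \<alpha>[OF ij(2)] mate_mate[of "\<alpha> j"] tinj B[OF i6] B[OF ij(2)] by (metis prod.inject)
  qed (use B \<alpha> in blast)+
qed

text \<open>A double edge between two triangles \<open>T0\<close>, \<open>T1\<close> leaves one free
  vertex in each. These lead to two distinct further triangles, and the ends still unmatched there
  must be joined by a second double edge.\<close>

lemma L4_case:
  assumes four: "card (tri ` V) = 4"
    and a: "a1 \<in> V" "a2 \<in> V" "a1 \<noteq> a2" "tri a1 = tri a2" "tri (mate a1) = tri (mate a2)"
  shows "\<exists>g. models L4_base (\<lambda>_. 0) g V E"
proof -
  define T0 T1 where "T0 = tri a1" and "T1 = tri (mate a1)"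
  have mm: "mate (mate x) = x" "mate x \<in> V" "tri (mate x) \<noteq> tri x" if "x \<in> V" for x
    using mate_mate mate that by blast+
  obtain a3 where a3: "a3 \<in> V" "tri a3 = T0" "a3 \<noteq> a1" "a3 \<noteq> a2"
  proof -
    obtain y z where yz: "y \<in> V" "z \<in> V" "tri y = tri a1" "tri z = tri a1" "a1 \<noteq> y" "a1 \<noteq> z" "y \<noteq> z"
      by (rule tri_others[OF a(1)])
    show ?thesis using that[of y] that[of z] yz unfolding T0_def by metis
  qed
  have T0: "w = a1 \<or> w = a2 \<or> w = a3" if "tri w = T0" for w
    using tri_three[of a1 a2 a3 w] a a3 that unfolding T0_def by metis
  define b1 b2 where "b1 = mate a1" and "b2 = mate a2"
  have b: "b1 \<in> V" "b2 \<in> V" "b1 \<noteq> b2" "tri b1 = T1" "tri b2 = T1" "mate b1 = a1" "mate b2 = a2"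
    using mm a mate_inj[OF a(1,2)] unfolding b1_def b2_def T1_def by auto
  obtain c where c: "c \<in> V" "tri c = T1" "c \<noteq> b1" "c \<noteq> b2"
  proof -
    obtain y z where yz: "y \<in> V" "z \<in> V" "tri y = tri b1" "tri z = tri b1" "b1 \<noteq> y" "b1 \<noteq> z" "y \<noteq> z"
      by (rule tri_others[OF b(1)])
    show ?thesis using that[of y] that[of z] yz b by metis
  qed
  have T1: "w = b1 \<or> w = b2 \<or> w = c" if "tri w = T1" for w
    using tri_three[of b1 b2 c w] b c that by metis
  have T01: "T0 \<noteq> T1" using mm(3)[OF a(1)] unfolding T0_def T1_def by simp
  have T01in: "T0 \<in> tri ` V" "T1 \<in> tri ` V" using a mm(2) unfolding T0_def T1_def by blast+
  have ma: "mate a1 = b1" "mate a2 = b2" by (simp_all add: b1_def b2_def)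
  \<comment> \<open>If the two free vertices were mates, the six vertices of \<open>T0\<close> and
    \<open>T1\<close> would be closed under adjacency, leaving no room for four triangles.\<close>
  have m3: "tri (mate a3) \<noteq> T1"
  proof
    assume "tri (mate a3) = T1"
    then have "mate a3 = b1 \<or> mate a3 = b2 \<or> mate a3 = c" by (rule T1)
    moreover have "mate a3 \<noteq> b1" "mate a3 \<noteq> b2" using mate_inj a a3 ma by metis+
    ultimately have m: "mate a3 = c" "mate c = a3" using mm(1)[OF a3(1)] by auto
    have "{T0, T1} = tri ` V"
    proof (rule closed_tri[of T0])
      fix x assume x: "x \<in> V" "tri x \<in> {T0, T1}"
      then have "x \<in> {a1, a2, a3, b1, b2, c}" using T0[of x] T1[of x] by blast
      then show "tri (mate x) \<in> {T0, T1}" using m b a3 c ma a unfolding T0_def by auto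
    qed (use T01in in auto)
    then show False using four T01 by (metis card_2_iff numeral_eq_iff semiring_norm(85) semiring_norm(87) verit_eq_simplify(8) zero_neq_numeral numeral_2_eq_2 One_nat_def)
  qed
  define T3 where "T3 = tri (mate a3)"
  have T3: "T3 \<noteq> T0" "T3 \<noteq> T1" "T3 \<in> tri ` V" using mm[OF a3(1)] a3 m3 unfolding T3_def by auto
  define T2 where "T2 = tri (mate c)"
  have "mate c \<noteq> a1" "mate c \<noteq> a2" using mm(1)[OF c(1)] c ma by metis+
  moreover have "mate c \<noteq> a3" using mm(1)[OF c(1)] c(2) T3 unfolding T3_def by metis
  ultimately have T20: "T2 \<noteq> T0" using T0 unfolding T2_def by blast
  have T2: "T2 \<noteq> T1" "T2 \<in> tri ` V" using mm[OF c(1)] c unfolding T2_def by auto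
  have fromT0: "tri (mate x) \<in> {T1, T3}" if "x \<in> V" "tri x = T0" for x
    using T0[OF that(2)] ma b unfolding T3_def by auto
  have fromT1: "tri (mate x) \<in> {T0, T2}" if "x \<in> V" "tri x = T1" for x
    using T1[OF that(2)] b a unfolding T2_def T0_def by auto
  \<comment> \<open>If both free vertices led to the same triangle, the fourth triangle could send
    its three edges only there, and so would occupy all three of its vertices, among them the mate
    of \<open>a3\<close>.\<close>
  have T23: "T2 \<noteq> T3"
  proof
    assume e: "T2 = T3"
    have "card (tri ` V - {T0, T1, T3}) = 1"
      using four T01 T3 T01in fin by (subst card_Diff_subset) auto
    then obtain T where T: "tri ` V - {T0, T1, T3} = {T}" by (rule card_1_singletonE)
    have "T \<in> tri ` V - {T0, T1, T3}" unfolding T by simp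
    then have "T \<in> tri ` V" and Tn: "T \<notin> {T0, T1, T3}" by simp_all
    then obtain x where x: "x \<in> V" "tri x = T" by (metis imageE)
    note x = x Tn
    have Tall: "C \<in> {T0, T1, T3, T}" if "C \<in> tri ` V" for C
      using that T by (metis Diff_iff insert_iff singletonD)
    have toT3: "tri (mate y) = T3" if y: "y \<in> V" "tri y = T" for y
    proof -
      have "tri (mate y) \<in> tri ` V" "tri (mate y) \<noteq> T" using mm(2,3)[OF y(1)] y by auto
      moreover have "tri (mate y) \<noteq> T0" using fromT0[of "mate y"] mm(1,2)[OF y(1)] y x by auto
      moreover have "tri (mate y) \<noteq> T1" using fromT1[of "mate y"] mm(1,2)[OF y(1)] y x e by auto
      ultimately show ?thesis using Tall[of "tri (mate y)"] by simp
    qed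
    obtain y z where yz: "y \<in> V" "z \<in> V" "tri y = tri x" "tri z = tri x" "x \<noteq> y" "x \<noteq> z" "y \<noteq> z"
      by (rule tri_others[OF x(1)])
    have "mate x \<noteq> mate y" "mate x \<noteq> mate z" "mate y \<noteq> mate z" using mate_inj x yz by metis+
    then have "mate a3 = mate x \<or> mate a3 = mate y \<or> mate a3 = mate z"
      using tri_three[of "mate x" "mate y" "mate z" "mate a3"] toT3 x yz mm(2) unfolding T3_def by metis
    then have "a3 = x \<or> a3 = y \<or> a3 = z" using mate_inj a3 x yz by metis
    then show False using a3 x yz by auto
  qed
  have all: "tri ` V = {T0, T1, T2, T3}"
  proof -
    have "card {T0, T1, T2, T3} = 4" using T01 T3 T2 T20 T23 by auto
    moreover have "{T0, T1, T2, T3} \<subseteq> tri ` V" using T01in T3 T2 by simp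
    ultimately show ?thesis using four fin card_subset_eq by (metis finite_imageI)
  qed
  have mc: "mate c \<in> V" "tri (mate c) = T2" "mate (mate c) = c" using mm[OF c(1)] unfolding T2_def by auto
  obtain y1 y2 where y: "y1 \<in> V" "y2 \<in> V" "tri y1 = T2" "tri y2 = T2" "mate c \<noteq> y1" "mate c \<noteq> y2" "y1 \<noteq> y2"
    using tri_others[OF mc(1)] mc(2) by metis
  have to3: "tri (mate z) = T3" if z: "z \<in> V" "tri z = T2" "mate c \<noteq> z" for z
  proof -
    have "tri (mate z) \<in> tri ` V" "tri (mate z) \<noteq> T2" using mm(2,3)[OF z(1)] z by auto
    moreover have "tri (mate z) \<noteq> T0" using fromT0[of "mate z"] mm(1,2)[OF z(1)] z T2 T23 by auto
    moreover have "tri (mate z) \<noteq> T1"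
    proof
      assume "tri (mate z) = T1"
      then have "mate z = b1 \<or> mate z = b2 \<or> mate z = c" by (rule T1)
      then have "z = a1 \<or> z = a2 \<or> z = mate c" using mm(1)[OF z(1)] b by metis
      then show False using z T20 a unfolding T0_def by auto
    qed
    ultimately show ?thesis using all by blast
  qed
  have t3: "tri (mate y1) = T3" "tri (mate y2) = T3" using to3 y by auto
  \<comment> \<open>In the order of \<open>L4_base\<close>: the double edge from 0 to 1, the edge
    from 1 to 2, the double edge from 2 to 3, and the edge from 3 back to 0, which starts at the
    mate of \<open>a3\<close>.\<close>
  define \<alpha> where "\<alpha> j = [a1, a2, c, y1, y2, mate a3] ! j" for j
  define t where "t j = [T0, T1, T2, T3] ! j" for j
  have six: "j = 0 \<or> j = 1 \<or> j = 2 \<or> j = 3 \<or> j = 4 \<or> j = 5" if "j < 6" for j :: nat using that by linarith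
  have m: "mate a3 \<in> V" "mate (mate a3) = a3" "tri (mate a3) = T3" using mm[OF a3(1)] unfolding T3_def by auto
  have tr: "tri a1 = T0" "tri a2 = T0" "tri a3 = T0" using a a3 unfolding T0_def by auto
  have tne: "T0 \<noteq> T1" "T1 \<noteq> T0" "T0 \<noteq> T2" "T2 \<noteq> T0" "T0 \<noteq> T3" "T3 \<noteq> T0" "T1 \<noteq> T2" "T2 \<noteq> T1"
      "T1 \<noteq> T3" "T3 \<noteq> T1" "T2 \<noteq> T3" "T3 \<noteq> T2" using T01 T3 T2 T20 T23 by auto
  note sm = tr b(4,5) c(2) y(3,4) t3 m mc ma
  show ?thesis
  proof (rule base_models[where t = t and \<alpha> = \<alpha>])
    show "inj_on t {..<4}"
    proof (rule inj_onI)
      fix i j :: nat assume ij: "i \<in> {..<4}" "j \<in> {..<4}" and e: "t i = t j"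
      have lt: "k = 0 \<or> k = 1 \<or> k = 2 \<or> k = 3" if "k \<in> {..<4}" for k :: nat
        using that by (simp add: less_Suc_eq numeral_eq_Suc)
      show "i = j"
        using lt[OF ij(1)] lt[OF ij(2)] e by (elim disjE; simp add: t_def tne)
    qed
    show "card V = 12" using card_V_tri four by simp
    show "fst (L4_base j) < 4 \<and> snd (L4_base j) < 4" if "j < 6" for j
      using six[OF that] by (auto simp: L4_base_def)
    show "\<alpha> j \<in> V \<and> tri (\<alpha> j) = t (fst (L4_base j)) \<and> tri (mate (\<alpha> j)) = t (snd (L4_base j))" if "j < 6" for j
      using six[OF that] a(1,2) c(1) y(1,2) by (elim disjE; simp add: \<alpha>_def t_def L4_base_def sm)
    fix i j :: nat assume ij: "i < j" "j < 6"
    then have "i < 6" by simp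
    have ne: "x \<noteq> x'" if "tri x \<noteq> tri x'" for x x' using that by blast
    have ys: "mate a3 \<noteq> mate y1" "mate a3 \<noteq> mate y2"
      using mate_inj[OF a3(1) y(1)] mate_inj[OF a3(1) y(2)] a3(2) y(3,4) tne by auto
    have n: "a1 \<noteq> c" "a1 \<noteq> y1" "a1 \<noteq> y2" "a1 \<noteq> mate a3" "a1 \<noteq> b2" "a1 \<noteq> mate c" "a1 \<noteq> mate y1" "a1 \<noteq> mate y2"
      "a2 \<noteq> c" "a2 \<noteq> y1" "a2 \<noteq> y2" "a2 \<noteq> mate a3" "a2 \<noteq> b1" "a2 \<noteq> mate c" "a2 \<noteq> mate y1" "a2 \<noteq> mate y2"
      "c \<noteq> y1" "c \<noteq> y2" "c \<noteq> mate a3" "c \<noteq> mate y1" "c \<noteq> mate y2" "c \<noteq> a3"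
      "y1 \<noteq> mate a3" "y1 \<noteq> mate y2" "y1 \<noteq> a3"
      "y2 \<noteq> mate a3" "y2 \<noteq> a3"
      by (rule ne, simp only: sm tne not_False_eq_True)+
    have n3: "a1 \<noteq> a3" "a2 \<noteq> a3" using a3(3,4) by simp_all
    show "\<alpha> i \<noteq> \<alpha> j \<and> \<alpha> i \<noteq> mate (\<alpha> j)"
      using six[OF \<open>i < 6\<close>] six[OF ij(2)] ij(1) n n3 a(3) y(7)
      by (elim disjE; simp add: \<alpha>_def sm)
  qed
qed

lemma four_triangles:
  assumes "card (tri ` V) = 4"
  shows "\<exists>B\<in>{K4_base, L4_base}. \<exists>g. models B (\<lambda>_. 0) g V E"
  using K4_case[OF assms] L4_case[OF assms] by blast

end

section \<open>The structure theorem\<close>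

definition ends_check :: "(nat \<Rightarrow> nat \<times> nat) \<Rightarrow> (nat \<times> nat) list list \<Rightarrow> bool" where
  "ends_check B L \<longleftrightarrow> list_all (\<lambda>c. length (L ! c) = 3 \<and> distinct (L ! c) \<and>
     list_all (\<lambda>(j, s). j < 6 \<and> s < 2) (L ! c) \<and>
     list_all (\<lambda>(j, s). endpt B j s = c \<longleftrightarrow> (j, s) \<in> set (L ! c)) (List.product [0..<6] [0..<2])) [0..<4]"

lemma ends_check_K4: "ends_check K4_base
    [[(0, 0), (1, 0), (2, 0)], [(0, 1), (3, 0), (4, 0)], [(1, 1), (3, 1), (5, 0)], [(2, 1), (4, 1), (5, 1)]]"
  by code_simp

lemma ends_check_L4: "ends_check L4_base
    [[(0, 0), (1, 0), (5, 1)], [(0, 1), (1, 1), (2, 0)], [(2, 1), (3, 0), (4, 0)], [(3, 1), (4, 1), (5, 0)]]"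
  by code_simp

text \<open>The base multigraphs are cubic: the three edge ends at a base vertex, read off from
  explicit tables, are the vertices of its triangle.\<close>

lemma three_ends:
  assumes "B \<in> {K4_base, L4_base}" "c < 4"
  obtains a b d :: "nat \<times> nat" where "distinct [a, b, d]" "{a, b, d} \<subseteq> {..<6} \<times> {..<2}"
    "\<And>j s. j < 6 \<Longrightarrow> s < 2 \<Longrightarrow> endpt B j s = c \<longleftrightarrow> (j, s) \<in> {a, b, d}"
proof -
  obtain L where L: "ends_check B L" using assms(1) ends_check_K4 ends_check_L4 by blast
  have c: "length (L ! c) = 3" "distinct (L ! c)" "\<forall>(j, s) \<in> set (L ! c). j < 6 \<and> s < 2"
    "\<forall>(j, s) \<in> {..<6} \<times> {..<2}. endpt B j s = c \<longleftrightarrow> (j, s) \<in> set (L ! c)"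
    using L assms(2) by (auto simp: ends_check_def list_all_iff)
  obtain a b d where abd: "L ! c = [a, b, d]" using c(1) by (auto simp: numeral_3_eq_3 length_Suc_conv)
  show ?thesis
  proof
    show "distinct [a, b, d]" using c(2) abd by simp
    show "{a, b, d} \<subseteq> {..<6} \<times> {..<2}" using c(3) abd by auto
    show "endpt B j s = c \<longleftrightarrow> (j, s) \<in> {a, b, d}" if "j < 6" "s < 2" for j s
      using bspec[OF c(4), of "(j, s)"] that unfolding abd by simp
  qed
qed

lemma endpt_less_4:
  assumes "B \<in> {K4_base, L4_base}" "j < 6"
  shows "endpt B j s < 4"
proof -
  have "j = 0 \<or> j = 1 \<or> j = 2 \<or> j = 3 \<or> j = 4 \<or> j = 5" using assms(2) by linarith
  then show ?thesis using assms(1) by (auto simp: K4_base_def L4_base_def endpt_def)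
qed

lemma tri_edgesI:
  "j < 6 \<Longrightarrow> s < 2 \<Longrightarrow> j' < 6 \<Longrightarrow> s' < 2 \<Longrightarrow> (j, s) \<noteq> (j', s') \<Longrightarrow> endpt B j s = endpt B j' s' \<Longrightarrow>
    {Tri j s, Tri j' s'} \<in> tri_edges B"
  unfolding tri_edges_def by blast

text \<open>An edge of the model that lies in no triangle must be a connecting edge; this locates
  the string that the next diamond lengthens.\<close>

lemma conn_or_triangle:
  assumes B: "B \<in> {K4_base, L4_base}" and e: "{x, y} \<in> GE B k"
  shows "(\<exists>j i. j < 6 \<and> i \<le> k j \<and> {x, y} = conn k j i) \<or>
    (\<exists>t. {x, t} \<in> GE B k \<and> {y, t} \<in> GE B k)"
proof -
  consider "{x, y} \<in> tri_edges B" | j i where "j < 6" "i < k j" "{x, y} \<in> dia_edges j i"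
    | j i where "j < 6" "i \<le> k j" "{x, y} = conn k j i" using e unfolding GE_def by blast
  then show ?thesis
  proof cases
    case 1
    then obtain j s j' s' where js: "{x, y} = {Tri j s, Tri j' s'}" "j < 6" "s < 2" "j' < 6" "s' < 2"
      "(j, s) \<noteq> (j', s')" "endpt B j s = endpt B j' s'" unfolding tri_edges_def by blast
    obtain a b d where abd: "distinct [a, b, d]" "{a, b, d} \<subseteq> {..<6} \<times> {..<2}"
      "\<And>i r. i < 6 \<Longrightarrow> r < 2 \<Longrightarrow> endpt B i r = endpt B j s \<longleftrightarrow> (i, r) \<in> {a, b, d}"
      using three_ends[OF B endpt_less_4[OF B js(2), of s]] by metis
    have "(j, s) \<in> {a, b, d}" "(j', s') \<in> {a, b, d}" using abd(3) js by metis+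
    have "\<not> {a, b, d} \<subseteq> {(j, s), (j', s')}"
    proof
      assume "{a, b, d} \<subseteq> {(j, s), (j', s')}"
      then have "card {a, b, d} \<le> card {(j, s), (j', s')}" by (intro card_mono) auto
      also have "\<dots> \<le> 2" by (simp add: card_insert_if)
      finally show False using abd(1) by simp
    qed
    then obtain f where f: "f \<in> {a, b, d}" "f \<noteq> (j, s)" "f \<noteq> (j', s')" by blast
    obtain i r where ir: "f = (i, r)" by (cases f)
    have "(i, r) \<in> {..<6} \<times> {..<2}" using f(1) abd(2) ir by blast
    then have i: "i < 6" "r < 2" by simp_all
    have ee: "endpt B i r = endpt B j s" using abd(3)[OF i] f(1) ir by simp
    have "(j, s) \<noteq> (i, r)" "(j', s') \<noteq> (i, r)" using f(2,3) ir by auto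
    then have "{Tri j s, Tri i r} \<in> tri_edges B" "{Tri j' s', Tri i r} \<in> tri_edges B"
      using tri_edgesI[OF js(2,3) i, of B] tri_edgesI[OF js(4,5) i, of B] ee js(7) by simp_all
    then have "{Tri j s, Tri i r} \<in> GE B k" "{Tri j' s', Tri i r} \<in> GE B k"
      unfolding GE_def by simp_all
    moreover have "x = Tri j s \<and> y = Tri j' s' \<or> x = Tri j' s' \<and> y = Tri j s"
      using js(1) by (auto simp: doubleton_eq_iff)
    ultimately show ?thesis by blast
  next
    case 2
    then have sub: "dia_edges j i \<subseteq> GE B k" unfolding GE_def by blast
    have "\<exists>t. {x, t} \<in> dia_edges j i \<and> {y, t} \<in> dia_edges j i"
    proof -
      define a b c d where "a = Dia j i 0" and "b = Dia j i 1" and "c = Dia j i 2" and "d = Dia j i 3"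
      have D: "dia_edges j i = {{a, b}, {a, c}, {b, c}, {b, d}, {c, d}}"
        by (simp add: dia_edges_def diamond_edges_def a_def b_def c_def d_def)
      have "{x, y} \<in> {{a, b}, {a, c}, {b, c}, {b, d}, {c, d}}" using 2(3) D by simp
      then have "{x, y} = {a, b} \<or> {x, y} = {a, c} \<or> {x, y} = {b, c} \<or> {x, y} = {b, d} \<or> {x, y} = {c, d}"
        by (simp only: insert_iff empty_iff simp_thms)
      then consider "{x, y} = {a, b}" | "{x, y} = {a, c}" | "{x, y} = {b, c}" | "{x, y} = {b, d}" | "{x, y} = {c, d}"
        by argo
      then have "\<exists>t. {x, t} \<in> {{a, b}, {a, c}, {b, c}, {b, d}, {c, d}} \<and> {y, t} \<in> {{a, b}, {a, c}, {b, c}, {b, d}, {c, d}}"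
      proof cases
        case 1
        then have "x = a \<and> y = b \<or> x = b \<and> y = a" by (simp add: doubleton_eq_iff)
        then show ?thesis by (intro exI[of _ c]) (elim disjE conjE; simp add: insert_commute)
      next
        case 2
        then have "x = a \<and> y = c \<or> x = c \<and> y = a" by (simp add: doubleton_eq_iff)
        then show ?thesis by (intro exI[of _ b]) (elim disjE conjE; simp add: insert_commute)
      next
        case 3
        then have "x = b \<and> y = c \<or> x = c \<and> y = b" by (simp add: doubleton_eq_iff)
        then show ?thesis by (intro exI[of _ a]) (elim disjE conjE; simp add: insert_commute)
      next
        case 4
        then have "x = b \<and> y = d \<or> x = d \<and> y = b" by (simp add: doubleton_eq_iff)
        then show ?thesis by (intro exI[of _ c]) (elim disjE conjE; simp add: insert_commute)
      next
        case 5
        then have "x = c \<and> y = d \<or> x = d \<and> y = c" by (simp add: doubleton_eq_iff)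
        then show ?thesis by (intro exI[of _ b]) (elim disjE conjE; simp add: insert_commute)
      qed
      then show ?thesis unfolding D .
    qed
    then show ?thesis using sub by blast
  next
    case 3
    then show ?thesis by blast
  qed
qed

text \<open>Either alternative for the reduced graph lifts, provided that the new edge lies in no
  triangle; the exception, a reduced graph with four vertices, yields an interior pair directly. A
  model is claimed only for \<open>h = 4\<close>, since the face bound and parity rule out all other
  values.\<close>

lemma good_graph_structure:
  "good_graph V E \<Longrightarrow> (\<exists>x y. interior_pair E x y) \<or>
    (\<exists>P h d. unit_partition V E P h d \<and>
      (h = 4 \<longrightarrow> (\<exists>B\<in>{K4_base, L4_base}. \<exists>k g. models B k g V E)))"
proof (induction "card V" arbitrary: V E rule: less_induct)
  case less
  interpret good_graph V E by (rule less.prems)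
  show ?case
  proof (cases "triangle_graph V E")
    case True
    interpret triangle_graph V E by (rule True)
    show ?thesis using unit_partition_tri four_triangles by blast
  next
    case False
    then have "\<exists>p q r s. adj E p q \<and> adj E p r \<and> adj E q r \<and> adj E q s \<and> adj E r s \<and> p \<noteq> s"
      using less.prems unfolding triangle_graph_def triangle_graph_axioms_def by blast
    then obtain p q r s where d: "adj E p q" "adj E p r" "adj E q r" "adj E q s" "adj E r s" "p \<noteq> s" by blast
    show ?thesis
    proof (cases "adj E p s")
      case True
      then show ?thesis using card_4_interior_pair K4_card(2) d by blast
    next
      case nps: False
      obtain u where u: "adj E p u" "u \<noteq> q" "u \<noteq> r" using third[of p q r] d irr by metis
      obtain v where v: "adj E s v" "v \<noteq> q" "v \<noteq> r" using third[of s q r] d irr adj_sym by metis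
      interpret dg: diamond_graph V E p q r s u v
        by unfold_locales (use d nps u v in auto)
      have lt: "card dg.V0 < card V"
      proof (rule psubset_card_mono[OF fin(1)])
        have "p \<in> V" "p \<notin> dg.V0" using inV(1)[OF d(1)] by (auto simp: dg.V0_def dg.D_def)
        then show "dg.V0 \<subset> V" by (auto simp: dg.V0_def)
      qed
      show ?thesis
      proof (cases "card dg.V0 = 4")
        case True
        then show ?thesis using dg.interior_pair_card_4 by blast
      next
        case False
        then have nt: "\<not> (adj dg.E0 u w \<and> adj dg.E0 v w)" for w using dg.uv_triangle_K4 by blast
        from less.hyps[OF lt dg.good_E0] show ?thesis
        proof
          assume "\<exists>x y. interior_pair dg.E0 x y"
          then show ?thesis using dg.interior_pair_step nt by blast
        next
          assume "\<exists>P h d. unit_partition dg.V0 dg.E0 P h d \<and>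
            (h = 4 \<longrightarrow> (\<exists>B\<in>{K4_base, L4_base}. \<exists>k g. models B k g dg.V0 dg.E0))"
          then obtain P h d where P: "unit_partition dg.V0 dg.E0 P h d"
            "h = 4 \<Longrightarrow> \<exists>B\<in>{K4_base, L4_base}. \<exists>k g. models B k g dg.V0 dg.E0" by blast
          obtain P' where P': "unit_partition V E P' h (Suc d)"
            using dg.unit_partition_step[OF P(1)] nt by blast
          have "\<exists>B\<in>{K4_base, L4_base}. \<exists>k g. models B k g V E" if h: "h = 4"
          proof -
            obtain B k g where B: "B \<in> {K4_base, L4_base}" and M: "models B k g dg.V0 dg.E0"
              using P(2)[OF h] by blast
            have im: "(`) g ` GE B k = dg.E0" using M by (simp add: models_def)
            have "{u, v} \<in> dg.E0" by (simp add: dg.E0_def)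
            then obtain e where e: "e \<in> GE B k" "{u, v} = g ` e" using im by blast
            then obtain x y where xy: "e = {x, y}" using simple_graph_GE unfolding simple_graph_def by metis
            \<comment> \<open>A triangle on this edge of the model would be carried to a triangle on
              \<open>{u, v}\<close>.\<close>
            have "\<not> (\<exists>t. {x, t} \<in> GE B k \<and> {y, t} \<in> GE B k)"
            proof
              assume "\<exists>t. {x, t} \<in> GE B k \<and> {y, t} \<in> GE B k"
              then obtain t where "g ` {x, t} \<in> dg.E0" "g ` {y, t} \<in> dg.E0" using im by blast
              then have "adj dg.E0 (g x) (g t)" "adj dg.E0 (g y) (g t)" by (simp_all add: adj_def)
              moreover have "g x = u \<and> g y = v \<or> g x = v \<and> g y = u"
                using e(2) xy by (auto simp: doubleton_eq_iff)
              ultimately show False using nt by metis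
            qed
            then obtain j i where ji: "j < 6" "i \<le> k j" "e = conn k j i"
              using conn_or_triangle[OF B e(1)[unfolded xy]] unfolding xy by blast
            have fr: "{p, q, r, s} \<inter> dg.V0 = {}" by (auto simp: dg.V0_def dg.D_def)
            have "\<exists>g'. models B (k(j := Suc (k j))) g' (dg.V0 \<union> {p, q, r, s}) (insert_diamond dg.E0 u v p q r s)"
              by (rule models_insert[OF base_endpt_neq[OF B] M ji(1,2) _ dg.dist fr]) (use e(2) ji(3) in simp)
            then show ?thesis using dg.E_eq B by metis
          qed
          then show ?thesis using P' by blast
        qed
      qed
    qed
  qed
qed

text \<open>To bypass an edge \<open>{x, y}\<close>, leave \<open>x\<close> through another
  neighbour \<open>z\<close> and go on to \<open>y\<close> avoiding \<open>x\<close>, which is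
  possible because \<open>x\<close> is not a cut vertex.\<close>

lemma good_graphI:
  assumes sg: "simple_graph V E" and tc: "two_connected V E" and cf: "claw_free V E" and cu: "cubic V E"
  shows "good_graph V E"
proof
  have nb: "card (nbrs E v) = 3" if "v \<in> V" for v
    using cu degree_eq_card_nbrs[OF sg] that by (simp add: cubic_def)
  show "simple_graph V E" "cubic V E" by fact+
  show con: "connected V E" using tc by (simp add: two_connected_def)
  show "\<exists>a b. adj E v a \<and> adj E v b \<and> adj E a b" if v: "v \<in> V" for v
  proof -
    obtain a b c where "nbrs E v = {a, b, c}" and n: "a \<noteq> b" "a \<noteq> c" "b \<noteq> c"
      using nb[OF v] by (metis card_3_iff)
    then have a: "adj E v a" "adj E v b" "adj E v c" by (auto simp: nbrs_def)
    moreover have "a \<in> V" "b \<in> V" "c \<in> V" using a simple_graph_adj[OF sg] by blast+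
    ultimately have "adj E a b \<or> adj E a c \<or> adj E b c"
      using cf v n unfolding claw_free_def adj_def by blast
    then show ?thesis using a by blast
  qed
  fix e assume e: "e \<in> E"
  then obtain x y where xy: "x \<in> V" "y \<in> V" "x \<noteq> y" "e = {x, y}" using sg unfolding simple_graph_def by metis
  have "nbrs E x \<noteq> {y}" using nb[OF xy(1)] by auto
  moreover have "y \<in> nbrs E x" using e xy by (simp add: nbrs_def adj_def)
  ultimately obtain z where z: "adj E x z" "z \<noteq> y" by (auto simp: nbrs_def)
  have zV: "z \<in> V" "z \<noteq> x" using simple_graph_adj[OF sg z(1)] by auto
  have "adj (E - {e}) x z" using z xy by (auto simp: adj_def doubleton_eq_iff)
  moreover have "(adj (E - {e}))\<^sup>*\<^sup>* z y"
  proof -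
    have "connected (V - {x}) (del_verts_E E {x})" using tc xy(1) by (simp add: two_connected_def)
    then have "(adj (del_verts_E E {x}))\<^sup>*\<^sup>* z y" using zV xy by (simp add: connected_def)
    then show ?thesis
    proof (rule rtranclp_map[where f = id, simplified])
      show "a = b \<or> adj (E - {e}) a b" if "adj (del_verts_E E {x}) a b" for a b
        using that xy by (auto simp: adj_def del_verts_E_def)
    qed
  qed
  ultimately have xy': "(adj (E - {e}))\<^sup>*\<^sup>* x y" by (rule converse_rtranclp_into_rtranclp)
  have "symp (adj (E - {e}))" by (auto simp: symp_def adj_def insert_commute)
  note sy = symp_rtranclp[OF this]
  have symp: "(adj (E - {e}))\<^sup>*\<^sup>* b a" if "(adj (E - {e}))\<^sup>*\<^sup>* a b" for a b
    by (rule sympD[OF sy that])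
  have step: "(adj (E - {e}))\<^sup>*\<^sup>* a b" if "adj E a b" for a b
  proof (cases "{a, b} = e")
    case True
    then have "a = x \<and> b = y \<or> a = y \<and> b = x" using xy by (auto simp: doubleton_eq_iff)
    then show ?thesis using xy' symp by blast
  next
    case False
    then have "adj (E - {e}) a b" using that by (simp add: adj_def)
    then show ?thesis by blast
  qed
  have "(adj (E - {e}))\<^sup>*\<^sup>* a b" if "(adj E)\<^sup>*\<^sup>* a b" for a b
    using that by (induction rule: rtranclp_induct) (auto intro: rtranclp_trans step)
  then show "connected V (E - {e})" using con by (auto simp: connected_def)
qed

lemma cubic_no_isolated:
  assumes "simple_graph V E" "cubic V E" "v \<in> V - {x, y}"
  shows "\<exists>w. {v, w} \<in> del_verts_E E {x, y}"
proof -
  have c: "card (nbrs E v) = 3" using assms degree_eq_card_nbrs[OF assms(1)] by (simp add: cubic_def)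
  have "\<not> nbrs E v \<subseteq> {x, y}"
  proof
    assume "nbrs E v \<subseteq> {x, y}"
    then have "card (nbrs E v) \<le> card {x, y}" by (intro card_mono) auto
    also have "\<dots> \<le> 2" by (simp add: card_insert_if)
    finally show False using c by simp
  qed
  then obtain w where "adj E v w" "w \<notin> {x, y}" by (auto simp: nbrs_def)
  then have "{v, w} \<in> del_verts_E E {x, y}" using assms(3) by (auto simp: del_verts_E_def adj_def)
  then show ?thesis by blast
qed

text \<open>With 3n/2 edges on n vertices the Betti number is n/2 + 1.\<close>

lemma cubic_card:
  assumes "simple_graph V E" "cubic V E"
  shows "odd (betti V E) \<longleftrightarrow> 4 dvd card V"
proof -
  have h: "2 * card E = 3 * card V" by (rule handshake[OF assms])
  then have "even (card V)" by presburger
  then obtain m where m: "card V = 2 * m" by blast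
  then have "card E = 3 * m" using h by simp
  then have "betti V E = int m + 1" using m by (simp add: betti_def)
  moreover have "4 dvd card V \<longleftrightarrow> even m" unfolding m by presburger
  ultimately show ?thesis by simp
qed

text \<open>The single face provides connectedness of the rest besides the embedding. Three vertices
  are asked for so that the rest is not empty.\<close>

lemma (in good_graph) interior_pair_removable:
  assumes "adj E x y" "emb 1 (del_verts_E E {x, y})" "card V \<ge> 3"
  shows "removable_pair V E x y"
proof -
  note xy = inV[OF assms(1)]
  note sg = simple_graph_del_verts[OF simple, of "{x, y}"]
  have "V - {x, y} \<noteq> {}"
  proof
    assume "V - {x, y} = {}"
    then have "card V \<le> card {x, y}" by (intro card_mono) auto
    also have "\<dots> \<le> 2" by (simp add: card_insert_if)
    finally show False using assms(3) by simp
  qed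
  from emb_one_connected[OF assms(2) simple_graph_finite(2)[OF sg] simple_graph_loopless[OF sg] this
      cubic_no_isolated[OF simple cubic]]
  have c: "connected (V - {x, y}) (del_verts_E E {x, y})" .
  have "emb 2 (del_verts_E E {x, y})" using assms(2) unfolding emb_def by (meson le_trans one_le_numeral)
  then have "upper_embeddable (V - {x, y}) (del_verts_E E {x, y})"
    using c upper_embeddable_iff[OF simple_graph_loopless[OF sg]] by blast
  moreover have "{x, y} \<in> E" using assms(1) by (simp add: adj_def)
  moreover have "\<not> is_bridge V E {x, y}" using bridgeless[OF \<open>{x, y} \<in> E\<close>] by (simp add: is_bridge_def)
  ultimately show ?thesis using xy c unfolding removable_pair_def by blast
qed

section \<open>Tightness of the family\<close>

text \<open>Deleting both ends of an edge lowers the total weight by at most as much as it lowers the number of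
  crossing edges: at most one of the classes involved has weight 2.\<close>

lemma excess_after_removal:
  assumes sg: "simple_graph V E" and xy: "adj E x y"
    and w: "\<And>c. c \<in> p ` V \<Longrightarrow> w c \<le> even_weight V E p c \<and> 1 \<le> w c \<and> w c \<le> 2"
    and ex: "card (cross_edges E p) + 2 \<le> (\<Sum>c\<in>p ` V. w c)"
    and large: "\<And>v. v \<in> V \<Longrightarrow> 3 \<le> card {u \<in> V. p u = p v}"
    and port: "\<And>v. v \<in> V \<Longrightarrow> w (p v) = 2 \<Longrightarrow> \<exists>e\<in>cross_edges E p. v \<in> e"
    and light: "\<And>a b. adj E a b \<Longrightarrow> p a \<noteq> p b \<Longrightarrow> w (p a) = 1 \<or> w (p b) = 1"
  shows "card (cross_edges (del_verts_E E {x, y}) p) + 2 \<le>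
    (\<Sum>c\<in>p ` (V - {x, y}). even_weight (V - {x, y}) (del_verts_E E {x, y}) p c)"
proof -
  let ?E = "del_verts_E E {x, y}" and ?V = "V - {x, y}"
  have xyV: "x \<in> V" "y \<in> V" "x \<noteq> y" using simple_graph_adj[OF sg xy] by auto
  have fin: "finite V" "finite E" using simple_graph_finite[OF sg] by auto
  have img: "p ` ?V = p ` V"
  proof (intro equalityI subsetI)
    fix c assume "c \<in> p ` V"
    then obtain v where v: "v \<in> V" "c = p v" by blast
    have "\<not> {u \<in> V. p u = p v} \<subseteq> {x, y}"
    proof
      assume "{u \<in> V. p u = p v} \<subseteq> {x, y}"
      then have "card {u \<in> V. p u = p v} \<le> card {x, y}" by (intro card_mono) auto
      also have "\<dots> \<le> 2" by (simp add: card_insert_if)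
      finally show False using large[OF v(1)] by simp
    qed
    then obtain u where u: "u \<in> V" "p u = p v" "u \<notin> {x, y}" by blast
    then have "u \<in> ?V" "c = p u" using v(2) by simp_all
    then show "c \<in> p ` ?V" by blast
  qed auto
  \<comment> \<open>The classes of \<open>x\<close> and \<open>y\<close> are credited with weight 1
    only, which holds for any class; all other classes are untouched by the deletion.\<close>
  define w' where "w' c = (if c \<in> {p x, p y} then 1 else w c)" for c
  have "w' c \<le> even_weight ?V ?E p c" if c: "c \<in> p ` V" for c
  proof (cases "c \<in> {p x, p y}")
    case True
    then show ?thesis using even_weight_pos by (simp add: w'_def)
  next
    case False
    then have n: "p x \<noteq> c" "p y \<noteq> c" by auto
    then have "{v \<in> ?V. p v = c} = {v \<in> V. p v = c}" by blast
    moreover have "{e \<in> ?E. p ` e = {c}} = {e \<in> E. p ` e = {c}}"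
      unfolding del_verts_E_def using n by auto
    ultimately have "even_weight ?V ?E p c = even_weight V E p c" by (simp add: even_weight_def)
    then show ?thesis using w[OF c] n by (simp add: w'_def)
  qed
  then have le: "(\<Sum>c\<in>p ` V. w' c) \<le> (\<Sum>c\<in>p ` ?V. even_weight ?V ?E p c)"
    unfolding img by (rule sum_mono)
  let ?R = "p ` V - {p x, p y}"
  have split: "(\<Sum>c\<in>p ` V. f c) = (\<Sum>c\<in>?R. f c) + (\<Sum>c\<in>{p x, p y}. f c)" for f :: "'b \<Rightarrow> nat"
    by (rule sum.subset_diff) (use fin xyV in auto)
  have "(\<Sum>c\<in>?R. w' c) = (\<Sum>c\<in>?R. w c)" by (rule sum.cong) (auto simp: w'_def)
  then have sw: "(\<Sum>c\<in>p ` V. w' c) + (\<Sum>c\<in>{p x, p y}. w c) = (\<Sum>c\<in>p ` V. w c) + (\<Sum>c\<in>{p x, p y}. w' c)"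
    using split[of w] split[of w'] by simp
  have finc: "finite (cross_edges E p)" using fin by (auto simp: cross_edges_def)
  have sub: "cross_edges ?E p \<subseteq> cross_edges E p" by (auto simp: cross_edges_def del_verts_E_def)
  have strict: "card (cross_edges ?E p) + 1 \<le> card (cross_edges E p)"
    if e: "e \<in> cross_edges E p" "e \<inter> {x, y} \<noteq> {}" for e
  proof -
    have "e \<notin> cross_edges ?E p" using e by (auto simp: cross_edges_def del_verts_E_def)
    then have "cross_edges ?E p \<subset> cross_edges E p" using sub e(1) by (metis psubsetI)
    from psubset_card_mono[OF finc this] show ?thesis by simp
  qed
  have wx: "w (p x) \<le> 2" "1 \<le> w (p x)" "w (p y) \<le> 2" "1 \<le> w (p y)" using w[of "p x"] w[of "p y"] xyV by simp_all
  show ?thesis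
  proof (cases "p x = p y")
    case True
    then have eq: "(\<Sum>c\<in>p ` V. w' c) + w (p x) = (\<Sum>c\<in>p ` V. w c) + 1" using sw by (simp add: w'_def)
    show ?thesis
    proof (cases "w (p x) = 2")
      case 2: True
      \<comment> \<open>Both vertices lie in one class of weight 2: the loss of 1 is made good by
        the crossing edge at \<open>x\<close>, which disappears.\<close>
      obtain e where "e \<in> cross_edges E p" "x \<in> e" using port[OF xyV(1) 2] by blast
      then have "card (cross_edges ?E p) + 1 \<le> card (cross_edges E p)" using strict[of e] by (metis IntI empty_iff insertI1)
      then show ?thesis using eq 2 ex le by linarith
    next
      case False
      then have "w (p x) = 1" using wx by linarith
      then show ?thesis using eq ex le card_mono[OF finc sub] by linarith
    qed
  next
    case False
    then have eq: "(\<Sum>c\<in>p ` V. w' c) + (w (p x) + w (p y)) = (\<Sum>c\<in>p ` V. w c) + 2" using sw by (simp add: w'_def)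
    \<comment> \<open>Now \<open>{x, y}\<close> itself crosses and disappears, while the two classes
      together fall from at most 3 to 2.\<close>
    have "{x, y} \<in> cross_edges E p" using False xy by (auto simp: cross_edges_def adj_def)
    then have "card (cross_edges ?E p) + 1 \<le> card (cross_edges E p)" using strict[of "{x, y}"] by simp
    moreover have "w (p x) + w (p y) \<le> 3" using light[OF xy False] wx by linarith
    ultimately show ?thesis using eq ex le by linarith
  qed
qed

lemma card_del_pair:
  assumes sg: "simple_graph V E" and "cubic V E" and xy: "adj E x y"
  shows "card (del_verts_E E {x, y}) + 5 = card E" "card (V - {x, y}) + 2 = card V"
proof -
  have xyV: "x \<in> V" "y \<in> V" "x \<noteq> y" using simple_graph_adj[OF sg xy] by auto
  have fin: "finite V" "finite E" using simple_graph_finite[OF sg] by auto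
  let ?X = "{e \<in> E. x \<in> e}" and ?Y = "{e \<in> E. y \<in> e}"
  have "card ?X = 3" "card ?Y = 3" using assms(2) xyV unfolding cubic_def degree_def by auto
  moreover have "?X \<inter> ?Y = {{x, y}}"
  proof (intro equalityI subsetI)
    fix e assume e: "e \<in> ?X \<inter> ?Y"
    then obtain a b where "e = {a, b}" using sg unfolding simple_graph_def by (metis (no_types, lifting) IntE mem_Collect_eq)
    then show "e \<in> {{x, y}}" using e xyV(3) by auto
  qed (use xy in \<open>auto simp: adj_def\<close>)
  ultimately have "card (?X \<union> ?Y) + 1 = 6" using card_Un_Int[of ?X ?Y] fin by simp
  moreover have "card (del_verts_E E {x, y} \<union> (?X \<union> ?Y)) = card (del_verts_E E {x, y}) + card (?X \<union> ?Y)"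
    by (rule card_Un_disjoint) (use fin in \<open>auto simp: del_verts_E_def\<close>)
  moreover have "del_verts_E E {x, y} \<union> (?X \<union> ?Y) = E" by (auto simp: del_verts_E_def)
  ultimately show "card (del_verts_E E {x, y}) + 5 = card E" by simp
  have "card {x, y} \<le> card V" by (rule card_mono) (use fin xyV in auto)
  then show "card (V - {x, y}) + 2 = card V" using card_Diff_subset[of "{x, y}" V] xyV by simp
qed

text \<open>After the deletion vertices plus edges are odd in number, hence so is the number of
  faces, and at most two faces means one. The excess of 2 over the crossing edges demands at least
  two.\<close>

lemma not_emb_2_after_removal:
  assumes sg: "simple_graph V E" and cu: "cubic V E" and xy: "adj E x y" and four: "4 dvd card V"
    and ex: "card (cross_edges (del_verts_E E {x, y}) p) + 2 \<le>
      (\<Sum>c\<in>p ` (V - {x, y}). even_weight (V - {x, y}) (del_verts_E E {x, y}) p c)"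
  shows "\<not> emb 2 (del_verts_E E {x, y})"
proof
  let ?E = "del_verts_E E {x, y}" and ?V = "V - {x, y}"
  assume "emb 2 ?E"
  then obtain \<rho> where \<rho>: "rotation_system UNIV ?E \<rho>" "ncyc (darts ?E) (face_perm \<rho>) \<le> 2"
    unfolding emb_def by blast
  note sg' = simple_graph_del_verts[OF sg, of "{x, y}"]
  note res = ncyc_face_perm_parity_bound[OF sg' \<rho>(1) cubic_no_isolated[OF sg cu]]
  obtain m where m: "card V = 4 * m" using four by blast
  then have "card E = 6 * m" using handshake[OF sg cu] by simp
  then have "odd (card ?V + card ?E)"
    using card_del_pair[OF sg cu xy] m by presburger
  moreover have "even (ncyc (darts ?E) (face_perm \<rho>) + card ?V + card ?E)"
    by (rule res(1))
  ultimately have "odd (ncyc (darts ?E) (face_perm \<rho>))" by presburger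
  then have "ncyc (darts ?E) (face_perm \<rho>) \<noteq> 2" by auto
  then have "ncyc (darts ?E) (face_perm \<rho>) \<le> 1" using \<rho>(2) by linarith
  moreover have "(\<Sum>c\<in>p ` ?V. even_weight ?V ?E p c) \<le> ncyc (darts ?E) (face_perm \<rho>) + card (cross_edges ?E p)"
    by (rule res(2))
  ultimately show False using ex by linarith
qed

section \<open>Weights of triangles and diamonds in the family\<close>

definition unit_of :: "(nat \<Rightarrow> nat \<times> nat) \<Rightarrow> fvert \<Rightarrow> nat + nat \<times> nat" where
  "unit_of B x = (case x of Tri j s \<Rightarrow> Inl (endpt B j s) | Dia j i l \<Rightarrow> Inr (j, i))"

lemma unit_of_simps [simp]:
  "unit_of B (Tri j s) = Inl (endpt B j s)"
  "unit_of B (Dia j i l) = Inr (j, i)"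
  by (simp_all add: unit_of_def)

text \<open>A triangle has 3 + 3 vertices and edges, an even total, and a diamond 4 + 5, an odd
  one.\<close>

definition unit_weight :: "nat + nat \<times> nat \<Rightarrow> nat" where
  "unit_weight c = (case c of Inl _ \<Rightarrow> 2 | Inr _ \<Rightarrow> 1)"

lemma unit_of_tri_edge: "e \<in> tri_edges B \<Longrightarrow> \<exists>c. unit_of B ` e = {Inl c}"
  unfolding tri_edges_def by auto

lemma unit_of_dia_edge: "e \<in> dia_edges j i \<Longrightarrow> unit_of B ` e = {Inr (j, i)}"
  unfolding dia_edges_def diamond_edges_def by auto

context
  fixes B :: "nat \<Rightarrow> nat \<times> nat" and k :: "nat \<Rightarrow> nat"
  assumes B: "B \<in> {K4_base, L4_base}" and k: "\<forall>j<6. 1 \<le> k j"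
begin

text \<open>This is where positive string lengths enter: every connecting edge has an end in a
  diamond, so it never joins two units of weight 2.\<close>

lemma unit_of_conn:
  assumes "j < 6" "i \<le> k j"
  shows "\<exists>a b. conn k j i = {a, b} \<and> unit_of B a \<noteq> unit_of B b \<and>
    (unit_weight (unit_of B a) = 1 \<or> unit_weight (unit_of B b) = 1)"
proof -
  have "1 \<le> k j" using k assms by simp
  then show ?thesis unfolding conn_def using assms
    by (intro exI[of _ "lport j i"] exI[of _ "rport k j i"])
      (cases i; auto simp: lport_def rport_def unit_weight_def)
qed

lemma cross_edges_GE: "cross_edges (GE B k) (unit_of B) = {conn k j i | j i. j < 6 \<and> i \<le> k j}"
proof (intro equalityI subsetI)
  fix e assume e: "e \<in> cross_edges (GE B k) (unit_of B)"
  then have "e \<notin> tri_edges B" "\<And>j i. e \<notin> dia_edges j i"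
    using unit_of_tri_edge[of e B] unit_of_dia_edge[of e _ _ B] by (auto simp: cross_edges_def)
  then show "e \<in> {conn k j i | j i. j < 6 \<and> i \<le> k j}" using e by (auto simp: cross_edges_def GE_def)
next
  fix e assume "e \<in> {conn k j i | j i. j < 6 \<and> i \<le> k j}"
  then obtain j i where ji: "e = conn k j i" "j < 6" "i \<le> k j" by blast
  obtain a b where "e = {a, b}" "unit_of B a \<noteq> unit_of B b" using unit_of_conn[OF ji(2,3)] ji(1) by metis
  then have "\<not> (\<exists>c. unit_of B ` e = {c})" by auto
  moreover have "e \<in> GE B k" unfolding GE_def using ji by blast
  ultimately show "e \<in> cross_edges (GE B k) (unit_of B)" by (simp add: cross_edges_def)
qed

lemma card_cross_edges_GE: "card (cross_edges (GE B k) (unit_of B)) \<le> 6 + (\<Sum>j<6. k j)"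
proof -
  have "{conn k j i | j i. j < 6 \<and> i \<le> k j} = (\<lambda>(j, i). conn k j i) ` (SIGMA j:{..<6}. {..k j})" by auto
  then have "card (cross_edges (GE B k) (unit_of B)) \<le> card (SIGMA j:{..<6}. {..k j})"
    unfolding cross_edges_GE using card_image_le[of "SIGMA j:{..<6}. {..k j}" "\<lambda>(j, i). conn k j i"] by simp
  also have "\<dots> = (\<Sum>j<6. Suc (k j))" by simp
  also have "\<dots> = (\<Sum>j<6::nat. 1) + (\<Sum>j<6. k j)" by (simp only: Suc_eq_plus1_left sum.distrib)
  also have "\<dots> = 6 + (\<Sum>j<6. k j)" by simp
  finally show ?thesis .
qed

lemma triangle_unit:
  assumes "c < 4"
  shows "card {v \<in> FV k. unit_of B v = Inl c} = 3" "card {e \<in> GE B k. unit_of B ` e = {Inl c}} = 3"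
proof -
  obtain a b d where abd: "distinct [a, b, d]" "{a, b, d} \<subseteq> {..<6} \<times> {..<2}"
    "\<And>j s. j < 6 \<Longrightarrow> s < 2 \<Longrightarrow> endpt B j s = c \<longleftrightarrow> (j, s) \<in> {a, b, d}"
    using three_ends[OF B assms] by metis
  define T where "T q = Tri (fst q) (snd q)" for q
  have Tinj: "T q = T q' \<longleftrightarrow> q = q'" for q q' by (auto simp: T_def prod_eq_iff)
  have mem: "fst q < 6 \<and> snd q < 2 \<and> endpt B (fst q) (snd q) = c" if "q \<in> {a, b, d}" for q
  proof -
    have "q \<in> {..<6} \<times> {..<2}" using abd(2) that by blast
    then have "fst q < 6" "snd q < 2" by auto
    then show ?thesis using abd(3)[of "fst q" "snd q"] that by simp
  qed
  have V: "{v \<in> FV k. unit_of B v = Inl c} = {T a, T b, T d}"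
  proof (intro equalityI subsetI)
    fix v assume v: "v \<in> {v \<in> FV k. unit_of B v = Inl c}"
    then obtain j s where js: "v = Tri j s" by (cases v) auto
    then have "(j, s) \<in> {a, b, d}" using v abd(3)[of j s] by simp
    moreover have "v = T (j, s)" by (simp add: T_def js)
    ultimately show "v \<in> {T a, T b, T d}" by blast
  next
    fix v assume "v \<in> {T a, T b, T d}"
    then obtain q where "q \<in> {a, b, d}" "v = T q" by blast
    then show "v \<in> {v \<in> FV k. unit_of B v = Inl c}" using mem[of q] by (simp add: T_def)
  qed
  show "card {v \<in> FV k. unit_of B v = Inl c} = 3" unfolding V using abd(1) by (simp add: Tinj)
  have ed: "{T q, T q'} \<in> tri_edges B" if "q \<in> {a, b, d}" "q' \<in> {a, b, d}" "q \<noteq> q'" for q q'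
    unfolding T_def by (rule tri_edgesI) (use mem[OF that(1)] mem[OF that(2)] that(3) in \<open>auto simp: prod_eq_iff\<close>)
  have "{e \<in> GE B k. unit_of B ` e = {Inl c}} = {{T a, T b}, {T a, T d}, {T b, T d}}"
  proof (intro equalityI subsetI)
    fix e assume e: "e \<in> {e \<in> GE B k. unit_of B ` e = {Inl c}}"
    then obtain x y where xy: "x \<in> FV k" "y \<in> FV k" "x \<noteq> y" "e = {x, y}"
      using simple_graph_GE[of k B] unfolding simple_graph_def by (metis (no_types, lifting) mem_Collect_eq)
    then have "x \<in> {T a, T b, T d}" "y \<in> {T a, T b, T d}" using e V by auto
    then show "e \<in> {{T a, T b}, {T a, T d}, {T b, T d}}" using xy(3,4) by auto
  next
    fix e assume "e \<in> {{T a, T b}, {T a, T d}, {T b, T d}}"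
    then consider "e = {T a, T b}" | "e = {T a, T d}" | "e = {T b, T d}" by blast
    then obtain q q' where q: "q \<in> {a, b, d}" "q' \<in> {a, b, d}" "q \<noteq> q'" "e = {T q, T q'}"
    proof cases
      case 1 then show ?thesis using that[of a b] abd(1) by simp
    next
      case 2 then show ?thesis using that[of a d] abd(1) by simp
    next
      case 3 then show ?thesis using that[of b d] abd(1) by simp
    qed
    then have "e \<in> GE B k" using ed[OF q(1-3)] unfolding GE_def by simp
    moreover have "unit_of B ` e = {Inl c}" using mem[OF q(1)] mem[OF q(2)] q(4) by (simp add: T_def)
    ultimately show "e \<in> {e \<in> GE B k. unit_of B ` e = {Inl c}}" by blast
  qed
  moreover have "card {{T a, T b}, {T a, T d}, {T b, T d}} = 3"
    using abd(1) by (auto simp: doubleton_eq_iff card_insert_if Tinj)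
  ultimately show "card {e \<in> GE B k. unit_of B ` e = {Inl c}} = 3" by simp
qed

lemma unit_image: "unit_of B ` FV k = Inl ` {..<4::nat} \<union> Inr ` (SIGMA j:{..<6}. {..<k j})"
proof (intro equalityI subsetI)
  fix c assume "c \<in> unit_of B ` FV k"
  then obtain x where x: "x \<in> FV k" "c = unit_of B x" by blast
  then show "c \<in> Inl ` {..<4::nat} \<union> Inr ` (SIGMA j:{..<6}. {..<k j})"
    using endpt_less_4[OF B] by (cases x) auto
next
  fix c assume "c \<in> Inl ` {..<4::nat} \<union> Inr ` (SIGMA j:{..<6}. {..<k j})"
  then consider a where "a < 4" "c = Inl a" | j i where "j < 6" "i < k j" "c = Inr (j, i)" by auto
  then show "c \<in> unit_of B ` FV k"
  proof cases
    case 1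
    then have "{v \<in> FV k. unit_of B v = Inl a} \<noteq> {}" using triangle_unit(1)[OF 1(1)] by (metis card.empty zero_neq_numeral)
    then obtain v where "v \<in> FV k" "unit_of B v = c" using 1(2) by auto
    then show ?thesis by blast
  next
    case 2
    then have "Dia j i 0 \<in> FV k" "unit_of B (Dia j i 0) = c" by simp_all
    then show ?thesis by blast
  qed
qed

text \<open>Against at most \<open>6 + (\<Sum>j<6. k j)\<close> crossing edges this leaves exactly
  the excess of 2 that survives the deletion of an adjacent pair.\<close>

lemma sum_unit_weight: "(\<Sum>c\<in>unit_of B ` FV k. unit_weight c) = 8 + (\<Sum>j<6. k j)"
proof -
  have "(\<Sum>c\<in>unit_of B ` FV k. unit_weight c) =
    (\<Sum>c\<in>Inl ` {..<4::nat}. unit_weight c) + (\<Sum>c\<in>Inr ` (SIGMA j:{..<6}. {..<k j}). unit_weight c)"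
    unfolding unit_image by (rule sum.union_disjoint) auto
  moreover have "(\<Sum>c\<in>Inl ` {..<4::nat}. unit_weight c) = (\<Sum>a\<in>{..<4::nat}. 2)"
    by (subst sum.reindex) (auto simp: unit_weight_def)
  moreover have "(\<Sum>c\<in>Inr ` (SIGMA j:{..<6}. {..<k j}). unit_weight c) = (\<Sum>q\<in>(SIGMA j:{..<6}. {..<k j}). 1)"
    by (subst sum.reindex) (auto simp: unit_weight_def)
  moreover have "(\<Sum>q\<in>(SIGMA j:{..<6}. {..<k j}). 1) = (\<Sum>j<6. k j)" by simp
  ultimately show ?thesis by simp
qed

text \<open>A triangle vertex is the end of the first or last connecting edge of its string, so a
  deletion inside a triangle always destroys a crossing edge; crossing pairs are covered by the
  diamond at one end of each connecting edge.\<close>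

lemma GE_no_removable:
  assumes cu: "cubic (FV k) (GE B k)" and four: "4 dvd card (FV k)" and xy: "adj (GE B k) x y"
  shows "\<not> emb 2 (del_verts_E (GE B k) {x, y})"
proof (rule not_emb_2_after_removal[OF simple_graph_GE cu xy four])
  show "card (cross_edges (del_verts_E (GE B k) {x, y}) (unit_of B)) + 2 \<le>
    (\<Sum>c\<in>unit_of B ` (FV k - {x, y}). even_weight (FV k - {x, y}) (del_verts_E (GE B k) {x, y}) (unit_of B) c)"
  proof (rule excess_after_removal[OF simple_graph_GE xy, where w = unit_weight])
    fix c assume c: "c \<in> unit_of B ` FV k"
    show "unit_weight c \<le> even_weight (FV k) (GE B k) (unit_of B) c \<and> 1 \<le> unit_weight c \<and> unit_weight c \<le> 2"
    proof (cases c)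
      case (Inl a)
      then have "a < 4" using c unit_image by auto
      then have "even_weight (FV k) (GE B k) (unit_of B) c = 2"
        unfolding Inl even_weight_def using triangle_unit[of a] by simp
      then show ?thesis by (simp add: unit_weight_def Inl)
    next
      case (Inr q)
      then show ?thesis using even_weight_pos by (simp add: unit_weight_def)
    qed
  next
    show "card (cross_edges (GE B k) (unit_of B)) + 2 \<le> (\<Sum>c\<in>unit_of B ` FV k. unit_weight c)"
      using card_cross_edges_GE sum_unit_weight by simp
  next
    fix v assume v: "v \<in> FV k"
    show "3 \<le> card {u \<in> FV k. unit_of B u = unit_of B v}"
    proof (cases v)
      case (Tri j s)
      then have "endpt B j s < 4" using endpt_less_4[OF B] v by simp
      then show ?thesis using triangle_unit(1) Tri by simp
    next
      case (Dia j i l)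
      have "{Dia j i 0, Dia j i 1, Dia j i 2} \<subseteq> {u \<in> FV k. unit_of B u = unit_of B v}"
        using v Dia by simp
      moreover have "finite {u \<in> FV k. unit_of B u = unit_of B v}" using finite_FV by simp
      ultimately have "card {Dia j i 0, Dia j i 1, Dia j i 2} \<le> card {u \<in> FV k. unit_of B u = unit_of B v}"
        by (rule card_mono[rotated])
      moreover have "card {Dia j i 0, Dia j i 1, Dia j i 2} = 3" by simp
      ultimately show ?thesis by linarith
    qed
    assume "unit_weight (unit_of B v) = 2"
    then obtain j s where js: "v = Tri j s" by (cases v) (auto simp: unit_weight_def)
    then have j: "j < 6" "s = 0 \<or> s = 1" using v by auto
    have "Tri j 0 \<in> conn k j 0" "Tri j 1 \<in> conn k j (k j)"
      by (simp_all add: conn_def lport_def rport_def)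
    moreover have "conn k j i \<in> cross_edges (GE B k) (unit_of B)" if "i \<le> k j" for i
      unfolding cross_edges_GE using that j(1) by blast
    ultimately show "\<exists>e\<in>cross_edges (GE B k) (unit_of B). v \<in> e" using j(2) js by (metis le0 order_refl)
  next
    fix a b assume ab: "adj (GE B k) a b" "unit_of B a \<noteq> unit_of B b"
    then have "{a, b} \<in> cross_edges (GE B k) (unit_of B)" by (auto simp: cross_edges_def adj_def)
    then obtain j i where "{a, b} = conn k j i" "j < 6" "i \<le> k j" unfolding cross_edges_GE by blast
    then obtain c d where "{a, b} = {c, d}" "unit_weight (unit_of B c) = 1 \<or> unit_weight (unit_of B d) = 1"
      using unit_of_conn by metis
    then show "unit_weight (unit_of B a) = 1 \<or> unit_weight (unit_of B b) = 1" by (auto simp: doubleton_eq_iff)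
  qed
qed

end

lemma four_dvd_card_FV: "4 dvd card (FV k)"
proof -
  have FV: "FV k = (\<Union>j<6. Tri j ` {..<2}) \<union> (\<Union>q\<in>(SIGMA j:{..<6}. {..<k j}). Dia (fst q) (snd q) ` {..<4})"
    (is "_ = ?A \<union> ?B")
  proof (intro equalityI subsetI)
    fix x assume "x \<in> FV k"
    then show "x \<in> ?A \<union> ?B"
    proof (cases x)
      case (Dia j i l)
      then have "(j, i) \<in> (SIGMA j:{..<6}. {..<k j})" "l \<in> {..<4}" using \<open>x \<in> FV k\<close> by simp_all
      then show ?thesis unfolding Dia by (intro UnI2 UN_I[of "(j, i)"]) auto
    next
      case (Tri j s)
      then show ?thesis using \<open>x \<in> FV k\<close> unfolding Tri by (intro UnI1 UN_I[of j]) auto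
    qed
  qed auto
  have "card (?A \<union> ?B) = card ?A + card ?B" by (rule card_Un_disjoint) auto
  moreover have "card ?A = (\<Sum>j<6::nat. card (Tri j ` {..<2}))" by (rule card_UN_disjoint) auto
  moreover have "(\<Sum>j<6::nat. card (Tri j ` {..<2})) = 12" by (simp add: card_image inj_on_def)
  moreover have "card ?B = (\<Sum>q\<in>(SIGMA j:{..<6}. {..<k j}). card (Dia (fst q) (snd q) ` {..<4}))"
    by (rule card_UN_disjoint) auto
  moreover have "(\<Sum>q\<in>(SIGMA j:{..<6}. {..<k j}). card (Dia (fst q) (snd q) ` {..<4})) = 4 * card (SIGMA j:{..<6}. {..<k j})"
    by (simp add: card_image inj_on_def)
  ultimately show ?thesis unfolding FV by simp
qed

lemma models_inverse:
  assumes "models B k g V E"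
  obtains f where "inj_on f V" "f ` V = FV k" "(`) f ` E = GE B k"
proof -
  have g: "inj_on g (FV k)" "g ` FV k = V" "(`) g ` GE B k = E" using assms by (auto simp: models_def)
  let ?f = "inv_into (FV k) g"
  have "inj_on ?f V" unfolding g(2)[symmetric] by (rule inj_on_inv_into) simp
  moreover have im: "?f ` g ` X = X" if "X \<subseteq> FV k" for X using g(1) that by (rule inv_into_image_cancel)
  moreover have "(`) ?f ` (`) g ` GE B k = GE B k"
  proof -
    have "(`) ?f ` (`) g ` GE B k = (\<lambda>e. ?f ` g ` e) ` GE B k" by (simp only: image_image)
    also have "\<dots> = (\<lambda>e. e) ` GE B k" by (rule image_cong[OF refl im[OF GE_subset]])
    finally show ?thesis by simp
  qed
  ultimately show ?thesis using that[of ?f] g(2,3) by blast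
qed

lemma cubic_image:
  assumes "cubic V E" "inj_on f V" "\<And>e. e \<in> E \<Longrightarrow> e \<subseteq> V"
  shows "cubic (f ` V) ((`) f ` E)"
  unfolding cubic_def
proof
  fix x assume "x \<in> f ` V"
  then obtain v where v: "v \<in> V" "x = f v" by blast
  have "{e \<in> (`) f ` E. x \<in> e} = (`) f ` {e \<in> E. v \<in> e}"
  proof -
    have "f v \<in> f ` e \<longleftrightarrow> v \<in> e" if "e \<in> E" for e
      using inj_on_image_mem_iff[OF assms(2) v(1) assms(3)[OF that]] .
    then show ?thesis unfolding v(2) by blast
  qed
  moreover have "inj_on ((`) f) {e \<in> E. v \<in> e}"
  proof (rule inj_onI)
    fix e e' assume "e \<in> {e \<in> E. v \<in> e}" "e' \<in> {e \<in> E. v \<in> e}" "f ` e = f ` e'"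
    then show "e = e'" using inj_on_image_eq_iff[OF assms(2)] assms(3) by blast
  qed
  ultimately have "degree ((`) f ` E) x = degree E v" by (simp add: degree_def card_image)
  then show "degree ((`) f ` E) x = 3" using assms(1) v by (simp add: cubic_def)
qed

text \<open>The embedding is carried from the model to \<open>E\<close>. Absence of removable pairs
  goes the other way: an embedding of the rest of \<open>E\<close> is carried to the model, which
  takes its cubicity from \<open>E\<close>.\<close>

lemma family_tight:
  assumes gg: "good_graph V E" and B: "B \<in> {K4_base, L4_base}" and k: "\<forall>j<6. 1 \<le> k j"
    and M: "models B k g V E"
  shows "tightly_two_face_embeddable V E"
proof -
  interpret good_graph V E by (rule gg)
  note ll = simple_graph_loopless[OF simple]
  obtain f where f: "inj_on f V" "f ` V = FV k" "(`) f ` E = GE B k" by (rule models_inverse[OF M])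
  have sub: "e \<subseteq> V" if "e \<in> E" for e using simple_graph_finite(3)[OF simple that] .
  have cubicGE: "cubic (FV k) (GE B k)" using cubic_image[OF cubic f(1) sub] f(2,3) by simp
  have "card V = card (FV k)" using f(1,2) card_image by metis
  then have four: "4 dvd card V" using four_dvd_card_FV by simp
  have "emb 2 (del_verts_E E (g ` {}))"
    by (rule emb_models[OF M]) (use emb_GE[OF B] in auto)
  then have "upper_embeddable V E" using upper_embeddable_iff[OF ll] conn by simp
  then have two: "two_face_embeddable V E"
    unfolding two_face_embeddable_def using cubic cubic_card[OF simple cubic] four by blast
  have "\<not> removable_pair V E x y" for x y
  proof
    assume rp: "removable_pair V E x y"
    then have xy: "x \<in> V" "y \<in> V" "{x, y} \<in> E" by (auto simp: removable_pair_def)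
    note sg = simple_graph_del_verts[OF simple, of "{x, y}"]
    have "emb 2 (del_verts_E E {x, y})"
      using rp upper_embeddable_iff[OF simple_graph_loopless[OF sg]] by (auto simp: removable_pair_def)
    then have "emb 2 ((`) f ` del_verts_E E {x, y})"
    proof (rule emb_image[OF _ simple_graph_finite(2)[OF sg] simple_graph_loopless[OF sg]])
      show "inj_on f (\<Union>(del_verts_E E {x, y}))"
        by (rule inj_on_subset[OF f(1)]) (use sub in \<open>auto simp: del_verts_E_def\<close>)
    qed
    moreover have "inj_on f (\<Union>E \<union> {x, y})" by (rule inj_on_subset[OF f(1)]) (use sub xy in auto)
    ultimately have "emb 2 (del_verts_E (GE B k) (f ` {x, y}))"
      using del_verts_image[of f E "{x, y}"] f(3) by simp
    moreover have "f ` {x, y} \<in> GE B k" using xy(3) f(3) by blast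
    then have "adj (GE B k) (f x) (f y)" by (simp add: adj_def)
    ultimately show False using GE_no_removable[OF B k cubicGE four_dvd_card_FV] by simp
  qed
  then show ?thesis using two unfolding tightly_two_face_embeddable_def by blast
qed

lemma tight_family:
  assumes gg: "good_graph V E" and tight: "tightly_two_face_embeddable V E" and c3: "3 \<le> card V"
  shows "\<exists>B\<in>{K4_base, L4_base}. \<exists>k g. (\<forall>j<6. 1 \<le> k j) \<and> models B k g V E"
proof -
  interpret good_graph V E by (rule gg)
  note ll = simple_graph_loopless[OF simple]
  have two: "two_face_embeddable V E" and nr: "\<And>x y. \<not> removable_pair V E x y"
    using tight unfolding tightly_two_face_embeddable_def by blast+
  have "\<not> interior_pair E x y" for x y
    using interior_pair_removable[OF _ _ c3, of x y] nr unfolding interior_pair_def by blast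
  then obtain P h d where P: "unit_partition V E P h d"
    "h = 4 \<longrightarrow> (\<exists>B\<in>{K4_base, L4_base}. \<exists>k g. models B k g V E)" using good_graph_structure[OF gg] by blast
  have "emb 2 E" using two upper_embeddable_iff[OF ll] unfolding two_face_embeddable_def by blast
  then obtain \<rho> where \<rho>: "rotation_system UNIV E \<rho>" "ncyc (darts E) (face_perm \<rho>) \<le> 2"
    unfolding emb_def by blast
  have "\<exists>w. {v, w} \<in> E" if "v \<in> V" for v using triangle[OF that] by (auto simp: adj_def)
  from ncyc_face_perm_parity_bound(2)[OF simple \<rho>(1) this, where p = P]
  have "(\<Sum>c\<in>P ` V. even_weight V E P c) \<le> 2 + card (cross_edges E P)" using \<rho>(2) by simp
  then have "h \<le> 4" using P(1) unfolding unit_partition_def by linarith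
  moreover have "0 < h" "card V = 3 * h + 4 * d" using P(1) unfolding unit_partition_def by blast+
  moreover have "4 dvd card V" using two cubic_card[OF simple cubic] unfolding two_face_embeddable_def by blast
  \<comment> \<open>From \<open>4 dvd 3 * h + 4 * d\<close> it follows that 4 divides
    \<open>h\<close>, and \<open>0 < h \<le> 4\<close>.\<close>
  ultimately have "h = 4" by presburger
  then obtain B k g where B: "B \<in> {K4_base, L4_base}" and M: "models B k g V E" using P(2) by blast
  \<comment> \<open>The structure theorem allows empty strings; an empty one would leave two
    adjacent triangle vertices whose deletion leaves a one-face graph, hence a removable
    pair.\<close>
  have "1 \<le> k j" if j: "j < 6" for j
  proof (rule ccontr)
    assume "\<not> 1 \<le> k j"
    then have kj: "k j = 0" by simp
    have "emb 1 (del_verts_E E (g ` {Tri j 0, Tri j 1}))"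
      by (rule emb_models[OF M emb_GE_minus_pair[where k = k, OF B j kj]]) (use j in auto)
    moreover have "conn k j 0 = {Tri j 0, Tri j 1}" using kj by (simp add: conn_def lport_def rport_def)
    then have "{Tri j 0, Tri j 1} \<in> GE B k" using j unfolding GE_def by blast
    then have "g ` {Tri j 0, Tri j 1} \<in> E" using M unfolding models_def by blast
    then have "adj E (g (Tri j 0)) (g (Tri j 1))" by (simp add: adj_def)
    ultimately show False using interior_pair_removable[OF _ _ c3] nr by (metis image_empty image_insert)
  qed
  then show ?thesis using B M by blast
qed

theorem theorem17:
  fixes V :: "'a set" and E :: "'a set set"
  assumes "simple_graph V E"
    and "two_connected V E"
    and "claw_free V E"
    and "cubic V E"
  shows "tightly_two_face_embeddable V E \<longleftrightarrow> in_family_F V E"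
proof -
  have gg: "good_graph V E" by (rule good_graphI[OF assms])
  have "3 \<le> card V" using assms(2) by (simp add: two_connected_def)
  then show ?thesis
    unfolding in_family_F_iff[OF assms(1)] using tight_family[OF gg] family_tight[OF gg] by blast
qed

end
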